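(* Suppose $(\mathcal{C},\mathcal{D})$ is a unital pseudo-Cartan inclusion. Then $\mathcal{D}$ norms $\mathcal{C}$.
   Context: A unital inclusion $(\mathcal{C},\mathcal{D})$: C*-algebra $\mathcal{C}$ with C*-subalgebra $\mathcal{D}$ containing the unit of $\mathcal{C}$. $\mathcal{N}(\mathcal{C},\mathcal{D})=\{v: v\mathcal{D}v^*\cup v^*\mathcal{D}v\subseteq\mathcal{D}\}$; regular: span dense. $\mathcal{D}^c$: relative commutant. Ideal intersection property: every nonzero closed ideal of the larger algebra meets the subalgebra nontrivially. Pseudo-Cartan inclusion: regular inclusion with $\mathcal{D}$ and $\mathcal{D}^c$ abelian and both $(\mathcal{C},\mathcal{D}^c)$, $(\mathcal{D}^c,\mathcal{D})$ having the ideal intersection property. ($\mathcal{D}$ norms $\mathcal{C}$ in the sense of Pop–Sinclair–Smith: for every $n\in\mathbb{N}$ and $X\in M_n(\mathcal{C})$, $\|X\|=\sup\{\|RXK\|: R\in M_{1,n}(\mathcal{D}), K\in M_{n,1}(\mathcal{D}), \|R\|\leq1,\|K\|\leq1\}$.) *)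

theory Defs
  imports "HOL-Analysis.Analysis"
begin

text \<open>A unital C*-algebra is modelled on a type 'a that is a (real) unital Banach algebra,
  equipped with a complex scalar multiplication sc (extending scaleR) and an involution st
  satisfying the C*-identity.\<close>

definition cstar_algebra ::
  "(complex \<Rightarrow> 'a::{banach,real_normed_algebra_1} \<Rightarrow> 'a) \<Rightarrow> ('a \<Rightarrow> 'a) \<Rightarrow> bool" where
  "cstar_algebra sc st \<longleftrightarrow>
     (\<forall>c x y. sc c (x + y) = sc c x + sc c y) \<and>
     (\<forall>c d x. sc (c + d) x = sc c x + sc d x) \<and>
     (\<forall>c d x. sc (c * d) x = sc c (sc d x)) \<and>
     (\<forall>r x. sc (complex_of_real r) x = scaleR r x) \<and>
     (\<forall>c x y. sc c (x * y) = sc c x * y \<and> sc c (x * y) = x * sc c y) \<and>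
     (\<forall>c x. norm (sc c x) = cmod c * norm x) \<and>
     (\<forall>x y. st (x + y) = st x + st y) \<and>
     (\<forall>c x. st (sc c x) = sc (cnj c) (st x)) \<and>
     (\<forall>x y. st (x * y) = st y * st x) \<and>
     (\<forall>x. st (st x) = x) \<and>
     (\<forall>x. norm (st x * x) = (norm x)\<^sup>2)"

definition csubspace :: "(complex \<Rightarrow> 'a::real_normed_algebra_1 \<Rightarrow> 'a) \<Rightarrow> 'a set \<Rightarrow> bool" where
  "csubspace sc S \<longleftrightarrow> 0 \<in> S \<and> (\<forall>x\<in>S. \<forall>y\<in>S. x + y \<in> S) \<and> (\<forall>c. \<forall>x\<in>S. sc c x \<in> S)"

definition cspan :: "(complex \<Rightarrow> 'a::real_normed_algebra_1 \<Rightarrow> 'a) \<Rightarrow> 'a set \<Rightarrow> 'a set" where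
  "cspan sc S = {y. \<exists>F c. finite F \<and> F \<subseteq> S \<and> y = (\<Sum>x\<in>F. sc (c x) x)}"

definition unital_cstar_subalgebra ::
  "(complex \<Rightarrow> 'a::real_normed_algebra_1 \<Rightarrow> 'a) \<Rightarrow> ('a \<Rightarrow> 'a) \<Rightarrow> 'a set \<Rightarrow> bool" where
  "unital_cstar_subalgebra sc st A \<longleftrightarrow> csubspace sc A \<and> closed A \<and>
     (\<forall>x\<in>A. \<forall>y\<in>A. x * y \<in> A) \<and> (\<forall>x\<in>A. st x \<in> A) \<and> 1 \<in> A"

definition normalizers :: "('a \<Rightarrow> 'a) \<Rightarrow> 'a::real_normed_algebra_1 set \<Rightarrow> 'a set" where
  "normalizers st D = {v. \<forall>d\<in>D. v * d * st v \<in> D \<and> st v * d * v \<in> D}"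

definition regular_inclusion ::
  "(complex \<Rightarrow> 'a::real_normed_algebra_1 \<Rightarrow> 'a) \<Rightarrow> ('a \<Rightarrow> 'a) \<Rightarrow> 'a set \<Rightarrow> bool" where
  "regular_inclusion sc st D \<longleftrightarrow> closure (cspan sc (normalizers st D)) = UNIV"

definition rel_commutant :: "'a::real_normed_algebra_1 set \<Rightarrow> 'a set" where
  "rel_commutant D = {x. \<forall>d\<in>D. x * d = d * x}"

definition abelian :: "'a::real_normed_algebra_1 set \<Rightarrow> bool" where
  "abelian A \<longleftrightarrow> (\<forall>x\<in>A. \<forall>y\<in>A. x * y = y * x)"

definition closed_ideal ::
  "(complex \<Rightarrow> 'a::real_normed_algebra_1 \<Rightarrow> 'a) \<Rightarrow> 'a set \<Rightarrow> 'a set \<Rightarrow> bool" where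
  "closed_ideal sc A J \<longleftrightarrow> J \<subseteq> A \<and> csubspace sc J \<and> closed J \<and>
     (\<forall>a\<in>A. \<forall>x\<in>J. a * x \<in> J \<and> x * a \<in> J)"

definition ideal_intersection_property ::
  "(complex \<Rightarrow> 'a::real_normed_algebra_1 \<Rightarrow> 'a) \<Rightarrow> 'a set \<Rightarrow> 'a set \<Rightarrow> bool" where
  "ideal_intersection_property sc A B \<longleftrightarrow>
     (\<forall>J. closed_ideal sc A J \<and> J \<noteq> {0} \<longrightarrow> J \<inter> B \<noteq> {0})"

definition pseudo_cartan ::
  "(complex \<Rightarrow> 'a::real_normed_algebra_1 \<Rightarrow> 'a) \<Rightarrow> ('a \<Rightarrow> 'a) \<Rightarrow> 'a set \<Rightarrow> bool" where
  "pseudo_cartan sc st D \<longleftrightarrow>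
     unital_cstar_subalgebra sc st D \<and> regular_inclusion sc st D \<and>
     abelian D \<and> abelian (rel_commutant D) \<and>
     ideal_intersection_property sc UNIV (rel_commutant D) \<and>
     ideal_intersection_property sc (rel_commutant D) D"

definition mat_set :: "nat \<Rightarrow> (nat \<Rightarrow> nat \<Rightarrow> 'a::real_normed_algebra_1) set" where
  "mat_set n = {X. \<forall>i j. (n \<le> i \<or> n \<le> j) \<longrightarrow> X i j = 0}"

definition mat_add :: "(nat \<Rightarrow> nat \<Rightarrow> 'a::real_normed_algebra_1) \<Rightarrow> (nat \<Rightarrow> nat \<Rightarrow> 'a) \<Rightarrow> nat \<Rightarrow> nat \<Rightarrow> 'a" where
  "mat_add X Y = (\<lambda>i j. X i j + Y i j)"

definition mat_scale :: "(complex \<Rightarrow> 'a::real_normed_algebra_1 \<Rightarrow> 'a) \<Rightarrow> complex \<Rightarrow> (nat \<Rightarrow> nat \<Rightarrow> 'a) \<Rightarrow> nat \<Rightarrow> nat \<Rightarrow> 'a" where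
  "mat_scale sc c X = (\<lambda>i j. sc c (X i j))"

definition mat_mult :: "nat \<Rightarrow> (nat \<Rightarrow> nat \<Rightarrow> 'a::real_normed_algebra_1) \<Rightarrow> (nat \<Rightarrow> nat \<Rightarrow> 'a) \<Rightarrow> nat \<Rightarrow> nat \<Rightarrow> 'a" where
  "mat_mult n X Y = (\<lambda>i j. if i < n \<and> j < n then (\<Sum>k<n. X i k * Y k j) else 0)"

definition mat_star :: "('a \<Rightarrow> 'a) \<Rightarrow> (nat \<Rightarrow> nat \<Rightarrow> 'a::real_normed_algebra_1) \<Rightarrow> nat \<Rightarrow> nat \<Rightarrow> 'a" where
  "mat_star st X = (\<lambda>i j. st (X j i))"

text \<open>N is a C*-norm on M_n(C) (with the standard *-algebra structure). Such a norm exists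
  and is unique, so quantifying over all of them describes the norm of M_n(C).\<close>
definition cstar_matrix_norm ::
  "(complex \<Rightarrow> 'a::real_normed_algebra_1 \<Rightarrow> 'a) \<Rightarrow> ('a \<Rightarrow> 'a) \<Rightarrow> nat \<Rightarrow> ((nat \<Rightarrow> nat \<Rightarrow> 'a) \<Rightarrow> real) \<Rightarrow> bool" where
  "cstar_matrix_norm sc st n N \<longleftrightarrow>
     (\<forall>X\<in>mat_set n. 0 \<le> N X \<and> (N X = 0 \<longleftrightarrow> X = (\<lambda>i j. 0))) \<and>
     (\<forall>X\<in>mat_set n. \<forall>Y\<in>mat_set n. N (mat_add X Y) \<le> N X + N Y) \<and>
     (\<forall>c. \<forall>X\<in>mat_set n. N (mat_scale sc c X) = cmod c * N X) \<and>
     (\<forall>X\<in>mat_set n. \<forall>Y\<in>mat_set n. N (mat_mult n X Y) \<le> N X * N Y) \<and>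
     (\<forall>X\<in>mat_set n. N (mat_mult n (mat_star st X) X) = (N X)\<^sup>2)"

text \<open>D norms C (Pop--Sinclair--Smith). For R = row (r_0..r_{n-1}), K = column (k_0..k_{n-1}):
  RXK = sum r_i x_ij k_j, norm R = sqrt(norm(sum r_i r_i*)), norm K = sqrt(norm(sum k_j* k_j)).\<close>
definition norms ::
  "(complex \<Rightarrow> 'a::real_normed_algebra_1 \<Rightarrow> 'a) \<Rightarrow> ('a \<Rightarrow> 'a) \<Rightarrow> 'a set \<Rightarrow> bool" where
  "norms sc st D \<longleftrightarrow>
     (\<forall>n::nat. 1 \<le> n \<longrightarrow> (\<forall>N. cstar_matrix_norm sc st n N \<longrightarrow>
       (\<forall>X\<in>mat_set n. N X = Sup {norm (\<Sum>i<n. \<Sum>j<n. r i * X i j * k j) | r k.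
            (\<forall>i<n. r i \<in> D) \<and> (\<forall>j<n. k j \<in> D) \<and>
            norm (\<Sum>i<n. r i * st (r i)) \<le> 1 \<and> norm (\<Sum>j<n. st (k j) * k j) \<le> 1})))"

end

theory Submission
  imports Defs
begin

text \<open>It suffices to compare columns: if \<open>\<parallel>X K\<parallel> \<le> \<parallel>K\<parallel>\<close> for all columns \<open>K\<close> over \<open>D\<close>, then
  \<open>\<parallel>X Y\<parallel> \<le> \<parallel>Y\<parallel>\<close> for all columns \<open>Y\<close> over the whole algebra; rows follow by taking adjoints.
  Classically one represents the algebra so that \<open>D\<close> is diagonal with one-dimensional eigenspaces and
  writes finitely many vectors \<open>\<xi>\<^sub>j\<close> as \<open>K\<^sub>j f\<close> with a single \<open>f\<close>. Here points of the spectrum are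
  replaced by small nonzero elements \<open>h\<close> of \<open>D\<close>, or of its commutant \<open>B\<close>: after shrinking \<open>h\<close>,
  finitely many elements of the abelian algebra are nearly scalar on \<open>h\<close>, and a normalizer \<open>y\<close>
  satisfies either \<open>h y h = 0\<close> or \<open>y h \<in> B\<close>. Hence for normalizers \<open>v, w\<close> the vectors \<open>v h\<close> and
  \<open>w h\<close> are either separated by \<open>D\<close> or nearly proportional, which yields the columns \<open>K\<close>. If the
  comparison failed, the positive part of \<open>(X Y)\<^sup>* (X Y) - t\<close> would generate a nonzero ideal; this
  ideal meets \<open>D\<close>, and an \<open>h\<close> supported there gives a contradiction.\<close>

section \<open>C*-algebras: square roots and positivity\<close>

text \<open>The delicate point is the order of choices. The element of \<open>D\<close> found in the
  ideal is only a limit of finite sums of \<open>c * a * c'\<close>, with \<open>a\<close> the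
  positive part. It provides a finite list of \<open>z\<close> such that for every suitable
  \<open>k\<close> some \<open>a * z * k\<close> is not small, but which \<open>z\<close> this is
  depends on \<open>k\<close>. Hence \<open>k\<close> has to be found first and has to serve the
  columns \<open>Y j * g * z\<close> for all \<open>z\<close> at once, while each such column gets
  its own \<open>K\<close>. A second obstacle is that the coefficients relating two normalizers lie
  in \<open>B\<close>, whereas the entries of \<open>K\<close> must lie in \<open>D\<close>. The
  multipliers that separate the vectors \<open>v * k\<close> are therefore built from an element
  \<open>g\<close> of \<open>D\<close>, and only afterwards is the support shrunk inside
  \<open>B\<close>. What survives shrinking is that a product such as \<open>h * m\<close> is
  nonzero; its size is restored by rescaling, so all errors are measured against elements of norm
  one. The matrix norm \<open>N\<close> is given only by axioms. Uniqueness of C*-norms, applied to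
  the entry at position 0, 0, ties it to \<open>norm\<close>.\<close>

locale cstar =
  fixes sc :: "complex \<Rightarrow> 'a::{banach,real_normed_algebra_1} \<Rightarrow> 'a"
    and st :: "'a \<Rightarrow> 'a"
  assumes cstar: "cstar_algebra sc st"
begin

lemma
  shows sc_add_right: "sc c (x + y) = sc c x + sc c y"
    and sc_add_left: "sc (c + d) x = sc c x + sc d x"
    and sc_sc [simp]: "sc c (sc d x) = sc (c * d) x"
    and sc_of_real [simp]: "sc (complex_of_real r) x = scaleR r x"
    and sc_mult_left [simp]: "sc c x * y = sc c (x * y)"
    and sc_mult_right [simp]: "x * sc c y = sc c (x * y)"
    and norm_sc [simp]: "norm (sc c x) = cmod c * norm x"
    and st_add [simp]: "st (x + y) = st x + st y"
    and st_sc [simp]: "st (sc c x) = sc (cnj c) (st x)"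
    and st_mult [simp]: "st (x * y) = st y * st x"
    and st_st [simp]: "st (st x) = x"
    and cstar_identity: "norm (st x * x) = (norm x)\<^sup>2"
  using cstar unfolding cstar_algebra_def by metis+

lemma sc_one [simp]: "sc 1 x = x"
  using sc_of_real[of 1 x] by simp

lemma sc_zero [simp]: "sc 0 x = 0"
  using sc_of_real[of 0 x] by simp

lemma sc_zero_right [simp]: "sc c 0 = 0"
  using sc_add_right[of c 0 0] by simp

lemma sc_minus_right [simp]: "sc c (- x) = - sc c x"
  using sc_add_right[of c x "- x"] by (simp add: eq_neg_iff_add_eq_0 add.commute)

lemma sc_diff_right: "sc c (x - y) = sc c x - sc c y"
  using sc_add_right[of c x "- y"] by simp

lemma sc_minus_left [simp]: "sc (- c) x = - sc c x"
  using sc_add_left[of c "- c" x] by (simp add: eq_neg_iff_add_eq_0 add.commute)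

lemma sc_scaleR [simp]: "sc c (scaleR r x) = scaleR r (sc c x)"
  by (metis sc_of_real sc_sc mult.commute)

lemma sc_sum: "sc c (\<Sum>i\<in>I. f i) = (\<Sum>i\<in>I. sc c (f i))"
  by (induction I rule: infinite_finite_induct) (auto simp: sc_add_right)

lemma sc_sum_left: "sc (\<Sum>i\<in>I. f i) x = (\<Sum>i\<in>I. sc (f i) x)"
  by (induction I rule: infinite_finite_induct) (auto simp: sc_add_left)

lemma st_zero [simp]: "st 0 = 0"
  using st_add[of 0 0] by simp

lemma st_one [simp]: "st 1 = 1"
  using st_mult[of "st 1" 1] by simp

lemma st_minus [simp]: "st (- x) = - st x"
  using st_add[of x "- x"] by (simp add: eq_neg_iff_add_eq_0 add.commute)

lemma st_diff [simp]: "st (x - y) = st x - st y"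
  using st_add[of x "- y"] by simp

lemma st_scaleR [simp]: "st (scaleR r x) = scaleR r (st x)"
  using st_sc[of "complex_of_real r" x] by simp

lemma st_sum: "st (\<Sum>i\<in>I. f i) = (\<Sum>i\<in>I. st (f i))"
  by (induction I rule: infinite_finite_induct) auto

lemma norm_st [simp]: "norm (st x) = norm x"
proof -
  have le: "norm y \<le> norm (st y)" for y
  proof (cases "y = 0")
    case False
    have "norm y * norm y \<le> norm (st y) * norm y"
      using norm_mult_ineq[of "st y" y] by (simp add: cstar_identity power2_eq_square)
    then show ?thesis using False by simp
  qed simp
  from le[of x] le[of "st x"] show ?thesis by simp
qed

lemma st_mult_self_eq_0 [simp]: "st x * x = 0 \<longleftrightarrow> x = 0"
  using cstar_identity[of x] by (metis mult_zero_right norm_eq_zero power_eq_0_iff)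

lemma norm_square: "st a = a \<Longrightarrow> norm (a * a) = (norm a)\<^sup>2"
  using cstar_identity[of a] by simp

lemma square_eq_0: "st a = a \<Longrightarrow> a * a = 0 \<longleftrightarrow> a = 0"
  using st_mult_self_eq_0[of a] by simp

lemma tendsto_st: "(f \<longlongrightarrow> l) F \<Longrightarrow> ((\<lambda>x. st (f x)) \<longlongrightarrow> st l) F"
proof -
  have "bounded_linear st"
    by (rule bounded_linear_intro[where K = 1]) auto
  then show "(f \<longlongrightarrow> l) F \<Longrightarrow> ?thesis" by (rule bounded_linear.tendsto)
qed

abbreviation csub :: "'a set \<Rightarrow> bool" where
  "csub \<equiv> unital_cstar_subalgebra sc st"

lemma
  assumes "csub A"
  shows csub_zero: "0 \<in> A" and csub_one: "1 \<in> A"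
    and csub_add: "x \<in> A \<Longrightarrow> y \<in> A \<Longrightarrow> x + y \<in> A"
    and csub_sc: "x \<in> A \<Longrightarrow> sc c x \<in> A"
    and csub_mult: "x \<in> A \<Longrightarrow> y \<in> A \<Longrightarrow> x * y \<in> A"
    and csub_st: "x \<in> A \<Longrightarrow> st x \<in> A"
    and csub_closed: "closed A"
  using assms unfolding unital_cstar_subalgebra_def csubspace_def by auto

lemma csub_scaleR: "csub A \<Longrightarrow> x \<in> A \<Longrightarrow> scaleR r x \<in> A"
  by (metis csub_sc sc_of_real)

lemma csub_minus: "csub A \<Longrightarrow> x \<in> A \<Longrightarrow> - x \<in> A"
  by (metis csub_scaleR scaleR_minus1_left)

lemma csub_diff: "csub A \<Longrightarrow> x \<in> A \<Longrightarrow> y \<in> A \<Longrightarrow> x - y \<in> A"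
  using csub_add[of A x "- y"] csub_minus[of A y] by simp

lemma csub_sum: "csub A \<Longrightarrow> (\<And>i. i \<in> I \<Longrightarrow> f i \<in> A) \<Longrightarrow> (\<Sum>i\<in>I. f i) \<in> A"
  by (induction I rule: infinite_finite_induct) (auto simp: csub_zero csub_add)

lemmas csub_intros = csub_zero csub_one csub_add csub_sc csub_mult csub_st csub_scaleR
  csub_minus csub_diff csub_sum

lemma csub_rel_commutant:
  assumes "\<And>x. x \<in> S \<Longrightarrow> st x \<in> S"
  shows "csub (rel_commutant S)"
proof -
  have eq: "rel_commutant S = (\<Inter>d\<in>S. {x. x * d = d * x})"
    by (auto simp: rel_commutant_def)
  have cl: "closed (rel_commutant S)" unfolding eq
    by (intro closed_INT ballI closed_Collect_eq continuous_intros)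
  have "st x * d = d * st x" if "x \<in> rel_commutant S" "d \<in> S" for x d
  proof -
    have "x * st d = st d * x" using that assms by (auto simp: rel_commutant_def)
    then have "st (x * st d) = st (st d * x)" by simp
    then show ?thesis by simp
  qed
  then show ?thesis using cl
    unfolding unital_cstar_subalgebra_def csubspace_def
    by (auto simp: rel_commutant_def algebra_simps) (metis mult.assoc)+
qed

text \<open>Membership in the unital C*-subalgebra generated by \<open>a\<close>, recorded for every
  element produced by a limit. It yields both that \<open>b\<close> commutes with whatever commutes
  with a self-adjoint \<open>a\<close>, and that \<open>b\<close> stays in \<open>D\<close> or
  \<open>B\<close> when \<open>a\<close> is there.\<close>

definition gen :: "'a \<Rightarrow> 'a \<Rightarrow> bool" where
  "gen a b \<longleftrightarrow> (\<forall>A. csub A \<longrightarrow> a \<in> A \<longrightarrow> b \<in> A)"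

lemma genD: "gen a b \<Longrightarrow> csub A \<Longrightarrow> a \<in> A \<Longrightarrow> b \<in> A"
  by (auto simp: gen_def)

lemma gen_refl: "gen a a" by (auto simp: gen_def)

lemma gen_trans: "gen a b \<Longrightarrow> gen b c \<Longrightarrow> gen a c" by (auto simp: gen_def)

lemma
  shows gen_add: "gen a x \<Longrightarrow> gen a y \<Longrightarrow> gen a (x + y)"
    and gen_diff: "gen a x \<Longrightarrow> gen a y \<Longrightarrow> gen a (x - y)"
    and gen_mult: "gen a x \<Longrightarrow> gen a y \<Longrightarrow> gen a (x * y)"
    and gen_scaleR: "gen a x \<Longrightarrow> gen a (scaleR r x)"
    and gen_minus: "gen a x \<Longrightarrow> gen a (- x)"
    and gen_one: "gen a 1"
  unfolding gen_def by (blast intro: csub_intros)+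

lemmas gen_intros = gen_refl gen_add gen_diff gen_mult gen_scaleR gen_minus gen_one

text \<open>The commutant of \<open>{z, st z}\<close> is a C*-subalgebra. Self-adjointness of
  \<open>a\<close> makes \<open>a\<close> commute with \<open>st z\<close> as well, so this
  subalgebra contains \<open>a\<close> and hence \<open>b\<close>.\<close>

lemma gen_commute:
  assumes "gen a b" "st a = a" "z * a = a * z"
  shows "z * b = b * z"
proof -
  have "csub (rel_commutant {z, st z})" by (rule csub_rel_commutant) auto
  moreover have "a * st z = st z * a" using arg_cong[OF assms(3), of st] assms(2) by simp
  then have "a \<in> rel_commutant {z, st z}" using assms by (auto simp: rel_commutant_def)
  ultimately show ?thesis using assms(1) by (auto simp: gen_def rel_commutant_def)
qed

lemma gen_commute2:
  assumes "gen a b" "gen a c" "st a = a"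
  shows "b * c = c * b"
proof (rule gen_commute[OF assms(2,3)])
  show "b * a = a * b" using gen_commute[OF assms(1,3), of a] by simp
qed

text \<open>The element \<open>u = a + i b\<close> satisfies \<open>st u * u = t\<close>, so the
  C*-identity gives its norm, and \<open>a\<close> is the average of \<open>u\<close> and
  \<open>st u\<close>. This is the source of the norm estimates for positive elements.\<close>

lemma norm_le_of_square_sum:
  assumes "st a = a" "st b = b" "a * b = b * a" "a * a + b * b = scaleR t 1"
  shows "(norm a)\<^sup>2 \<le> \<bar>t\<bar>"
proof -
  define u where "u = a + sc \<i> b"
  have stu: "st u = a - sc \<i> b" by (simp add: u_def assms)
  have "st u * u = scaleR t 1"
    unfolding stu unfolding u_def
    using assms(3,4) by (simp add: algebra_simps sc_diff_right sc_add_right)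
  then have nu: "(norm u)\<^sup>2 = \<bar>t\<bar>" using cstar_identity[of u] by simp
  have "scaleR 2 a = u + st u" unfolding stu unfolding u_def by (simp add: scaleR_2)
  then have "2 * norm a \<le> norm u + norm (st u)"
    using norm_triangle_ineq[of u "st u"] by (metis norm_scaleR abs_numeral)
  then have "norm a \<le> norm u" by simp
  then show ?thesis using nu by (metis norm_ge_zero power_mono)
qed

text \<open>The iteration \<open>y \<mapsto> (x + y\<^sup>2) / 2\<close> solves \<open>(1 - y)\<^sup>2 = 1 - x\<close>; its increments are dominated
  by those of the same scalar iteration for \<open>x = 1\<close>, which converges even on the boundary.\<close>

lemma sqrt_one_minus:
  assumes x: "st x = x" "norm x \<le> 1"
  shows "\<exists>y. st y = y \<and> norm y \<le> 1 \<and> (1 - y) * (1 - y) = 1 - x \<and> gen x y"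
proof -
  define f where "f y = scaleR (1/2) (x + y * y)" for y
  define Y where "Y n = (f ^^ n) 0" for n
  define t where "t n = ((\<lambda>s::real. (1 + s\<^sup>2) / 2) ^^ n) 0" for n :: nat
  have Y0: "Y 0 = 0" and YS: "Y (Suc n) = f (Y n)" for n by (auto simp: Y_def)
  have t0: "t 0 = 0" and tS: "t (Suc n) = (1 + (t n)\<^sup>2) / 2" for n by (auto simp: t_def)
  have t01: "0 \<le> t n \<and> t n \<le> 1" for n
    by (induction n) (auto simp: t0 tS power_le_one)
  have tinc: "t n \<le> t (Suc n)" for n
  proof -
    have "0 \<le> (1 - t n)\<^sup>2" by simp
    then show ?thesis by (simp add: tS power2_eq_square algebra_simps)
  qed
  have YA: "gen x (Y n)" for n
    by (induction n) (auto simp: Y0 YS f_def gen_def intro!: csub_intros)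
  have stY: "st (Y n) = Y n" for n
    by (induction n) (auto simp: Y0 YS f_def x)
  have nY: "norm (Y n) \<le> t n" for n
  proof (induction n)
    case (Suc n)
    have "norm (x + Y n * Y n) \<le> 1 + (t n)\<^sup>2"
    proof -
      have "norm (Y n * Y n) \<le> t n * t n"
        using norm_mult_ineq[of "Y n" "Y n"] mult_mono[OF Suc Suc] t01[of n] by force
      then show ?thesis using norm_triangle_ineq[of x "Y n * Y n"] x
        by (simp add: power2_eq_square)
    qed
    then show ?case by (simp add: YS f_def tS)
  qed (simp add: Y0 t0)
  have dY: "norm (Y (Suc n) - Y n) \<le> t (Suc n) - t n" for n
  proof (induction n)
    case 0
    then show ?case using x by (simp add: Y0 YS f_def t0 tS)
  next
    case (Suc n)
    have comm: "Y n * Y (Suc n) = Y (Suc n) * Y n"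
      by (rule gen_commute2[OF YA YA x(1)])
    have "Y (Suc (Suc n)) - Y (Suc n) = scaleR (1/2) (Y (Suc n) * Y (Suc n) - Y n * Y n)"
      unfolding YS[of "Suc n"] YS[of n] f_def by (simp add: algebra_simps)
    also have "Y (Suc n) * Y (Suc n) - Y n * Y n = (Y (Suc n) + Y n) * (Y (Suc n) - Y n)"
      using comm by (simp add: algebra_simps)
    finally have "norm (Y (Suc (Suc n)) - Y (Suc n))
        \<le> 1/2 * (norm (Y (Suc n) + Y n) * norm (Y (Suc n) - Y n))"
      by (simp add: norm_mult_ineq)
    also have "\<dots> \<le> 1/2 * ((t (Suc n) + t n) * (t (Suc n) - t n))"
    proof -
      have "norm (Y (Suc n) + Y n) \<le> t (Suc n) + t n"
        using norm_triangle_ineq[of "Y (Suc n)" "Y n"] nY[of n] nY[of "Suc n"] by linarith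
      then show ?thesis using Suc t01[of n] t01[of "Suc n"]
        by (intro mult_left_mono mult_mono) auto
    qed
    also have "\<dots> = t (Suc (Suc n)) - t (Suc n)"
      by (simp add: tS[of "Suc n"] tS[of n] field_simps power2_eq_square)
    finally show ?case .
  qed
  have "summable (\<lambda>n. t (Suc n) - t n)"
  proof -
    have "incseq t" by (rule incseq_SucI) (rule tinc)
    then obtain l where "t \<longlonglongrightarrow> l" using incseq_convergent[of t 1] t01 by blast
    then show ?thesis by (rule telescope_summable)
  qed
  then have "summable (\<lambda>n. Y (Suc n) - Y n)"
    by (rule summable_comparison_test') (use dY in auto)
  then have "convergent (\<lambda>n. \<Sum>i<n. Y (Suc i) - Y i)" by (simp add: summable_iff_convergent)
  then have "convergent Y" by (simp add: sum_lessThan_telescope Y0)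
  then obtain y where lim: "Y \<longlonglongrightarrow> y" by (auto simp: convergent_def)
  have "(\<lambda>n. f (Y n)) \<longlonglongrightarrow> f y" unfolding f_def using lim by (intro tendsto_intros)
  moreover have "(\<lambda>n. f (Y n)) \<longlonglongrightarrow> y" using LIMSEQ_Suc[OF lim] by (simp add: YS)
  ultimately have fy: "y = f y" by (rule LIMSEQ_unique[symmetric])
  then have "scaleR 2 y = scaleR 2 (f y)" by simp
  then have "y + y = x + y * y" by (simp add: f_def scaleR_2)
  then have "(1 - y) * (1 - y) = 1 - x" by (simp add: algebra_simps)
  moreover have "st y = y"
    using tendsto_st[OF lim] lim by (simp add: stY LIMSEQ_unique)
  moreover have "norm y \<le> 1"
    using nY t01 by (intro LIMSEQ_le_const2[OF tendsto_norm[OF lim]]) (meson order_trans)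
  moreover have "gen x y" unfolding gen_def
    by (metis YA genD lim csub_closed closed_sequentially)
  ultimately show ?thesis by blast
qed

section \<open>Positive elements, as squares of self-adjoint elements\<close>

definition pos :: "'a \<Rightarrow> bool" where
  "pos a \<longleftrightarrow> (\<exists>b. st b = b \<and> a = b * b)"

lemma pos_st: "pos a \<Longrightarrow> st a = a" by (auto simp: pos_def)

lemma pos_square: "st a = a \<Longrightarrow> pos (a * a)" by (auto simp: pos_def)

lemma pos_zero: "pos 0" by (auto simp: pos_def intro: exI[of _ 0])

lemma pos_scaleR: "pos a \<Longrightarrow> 0 \<le> t \<Longrightarrow> pos (scaleR t a)"
  unfolding pos_def
proof (elim exE conjE)
  fix b assume "0 \<le> t" "st b = b" "a = b * b"
  then show "\<exists>b. st b = b \<and> t *\<^sub>R a = b * b"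
    by (intro exI[of _ "scaleR (sqrt t) b"]) auto
qed

text \<open>Rescaling reduces this to the root of \<open>1 - x\<close> with
  \<open>x = 1 - a / t\<close>. The last bound places the root in a ball of the same shape, so the
  lemma applies to the root again and shows it to be positive.\<close>

lemma sqrt_of_ball0:
  assumes "st a = a" "norm (scaleR t 1 - a) \<le> t"
  shows "\<exists>b. st b = b \<and> a = b * b \<and> gen a b \<and> norm (scaleR (sqrt t) 1 - b) \<le> sqrt t"
proof (cases "t = 0")
  case True
  then show ?thesis using assms by (intro exI[of _ 0]) (auto simp: gen_def csub_zero)
next
  case False
  then have t: "t > 0" using assms(2) norm_ge_zero[of "scaleR t 1 - a"] by linarith
  define x where "x = 1 - scaleR (1/t) a"
  have "x = scaleR (1/t) (scaleR t 1 - a)" using t by (simp add: x_def scaleR_diff_right)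
  then have "norm x = (1/t) * norm (scaleR t 1 - a)" using t by (metis norm_scaleR abs_of_pos divide_pos_pos zero_less_one)
  also have "\<dots> \<le> (1/t) * t" using assms t by (intro mult_left_mono) auto
  finally have "norm x \<le> 1" using t by simp
  moreover have "st x = x" using assms by (simp add: x_def)
  ultimately obtain y where y: "st y = y" "norm y \<le> 1" "(1 - y) * (1 - y) = 1 - x" "gen x y"
    using sqrt_one_minus by blast
  define b where "b = scaleR (sqrt t) (1 - y)"
  have "gen a x" unfolding x_def by (intro gen_intros)
  then have "gen a y" using y(4) gen_trans by blast
  then have "gen a b" unfolding b_def by (intro gen_intros)
  moreover have "b * b = a" using y(3) t by (simp add: b_def x_def)
  moreover have "scaleR (sqrt t) 1 - b = scaleR (sqrt t) y"
    by (simp add: b_def scaleR_diff_right)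
  ultimately show ?thesis using y t by (intro exI[of _ b]) (auto simp: b_def)
qed

lemma sqrt_of_ball:
  assumes "st a = a" "norm (scaleR t 1 - a) \<le> t"
  shows "\<exists>b. pos b \<and> a = b * b \<and> gen a b"
  using sqrt_of_ball0[OF assms] sqrt_of_ball0 unfolding pos_def by metis

lemma posI_ball: "st a = a \<Longrightarrow> norm (scaleR t 1 - a) \<le> t \<Longrightarrow> pos a"
  using sqrt_of_ball pos_def pos_st by metis

text \<open>With \<open>a = b * b\<close>, the element \<open>t - a\<close> is within
  \<open>t\<close> of the scalar \<open>t\<close> because its distance is \<open>norm a\<close>, so
  it has a root \<open>c\<close>. The roots commute and \<open>c * c + b * b = t\<close>, which
  bounds \<open>norm (c * c)\<close>.\<close>

lemma pos_complement_sqrt: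
  assumes "pos a" "norm a \<le> t"
  shows "\<exists>c. st c = c \<and> scaleR t 1 - a = c * c \<and> gen a c \<and> norm (c * c) \<le> t"
proof (cases "t = 0")
  case True
  then show ?thesis using assms by (intro exI[of _ 0]) (auto simp: gen_def csub_zero)
next
  case False
  then have t: "t > 0" using assms norm_ge_zero[of a] by linarith
  obtain b where b: "st b = b" "a = b * b" using assms by (auto simp: pos_def)
  have sta: "st a = a" using assms pos_st by blast
  have "\<exists>c. st c = c \<and> scaleR t 1 - a = c * c \<and> gen (scaleR t 1 - a) c
    \<and> norm (scaleR (sqrt t) 1 - c) \<le> sqrt t"
    using assms sta by (intro sqrt_of_ball0) auto
  then obtain c where c: "st c = c" "scaleR t 1 - a = c * c" "gen (scaleR t 1 - a) c" by blast
  have "gen a (scaleR t 1 - a)" by (intro gen_intros)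
  then have g: "gen a c" using c gen_trans by blast
  have "b * c = c * b" by (rule gen_commute[OF g sta]) (simp add: b mult.assoc)
  then have "(norm c)\<^sup>2 \<le> \<bar>t\<bar>"
    using b c by (intro norm_le_of_square_sum[of c b]) (auto simp: algebra_simps)
  then have "norm (c * c) \<le> t" using c t norm_square[of c] by simp
  then show ?thesis using c g by blast
qed

lemma pos_complement: "pos a \<Longrightarrow> norm a \<le> t \<Longrightarrow> pos (scaleR t 1 - a)"
  using pos_complement_sqrt pos_def by metis

lemma pos_complement_norm: "pos a \<Longrightarrow> norm a \<le> t \<Longrightarrow> norm (scaleR t 1 - a) \<le> t"
  using pos_complement_sqrt by metis

text \<open>Positivity is a ball condition: a self-adjoint element within \<open>t\<close> of the
  scalar \<open>t\<close> is positive, and a positive \<open>a\<close> satisfies this with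
  \<open>t = norm a\<close>. Such balls add up by the triangle inequality.\<close>

lemma pos_add:
  assumes "pos a" "pos b" shows "pos (a + b)"
proof (rule posI_ball)
  show "st (a + b) = a + b" using assms pos_st by simp
  have "scaleR (norm a + norm b) 1 - (a + b) = (scaleR (norm a) 1 - a) + (scaleR (norm b) 1 - b)"
    by (simp add: scaleR_add_left)
  then show "norm (scaleR (norm a + norm b) 1 - (a + b)) \<le> norm a + norm b"
    using norm_triangle_le[OF add_mono[OF pos_complement_norm[OF assms(1) order_refl]
        pos_complement_norm[OF assms(2) order_refl]]]
    by metis
qed

lemma pos_sum: "(\<And>i. i \<in> I \<Longrightarrow> pos (f i)) \<Longrightarrow> pos (\<Sum>i\<in>I. f i)"
  by (induction I rule: infinite_finite_induct) (auto simp: pos_zero pos_add)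

lemma pos_sqrt:
  assumes "pos a" shows "\<exists>b. pos b \<and> a = b * b \<and> gen a b"
  using sqrt_of_ball[OF pos_st[OF assms] pos_complement_norm[OF assms order_refl]] .

lemma pos_mult:
  assumes "pos a" "pos b" "a * b = b * a" shows "pos (a * b)"
proof -
  obtain c d where c: "pos c" "a = c * c" "gen a c" and d: "pos d" "b = d * d" "gen b d"
    using pos_sqrt assms by metis
  have "b * c = c * b" using gen_commute[OF c(3) pos_st[OF assms(1)]] assms by simp
  then have cd: "c * d = d * c" using gen_commute[OF d(3) pos_st[OF assms(2)]] by simp
  have "a * b = (c * d) * (c * d)" unfolding c(2) d(2) using cd by (metis mult.assoc)
  moreover have "st (c * d) = c * d" using c d cd pos_st by simp
  ultimately show ?thesis using pos_square by metis
qed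

text \<open>For \<open>t = norm (a + b)\<close> the element \<open>t - a\<close> is a sum of two
  positive elements, hence a square \<open>c * c\<close>. Two commuting squares with sum
  \<open>t\<close> have norm at most \<open>t\<close>.\<close>

lemma pos_norm_mono:
  assumes "pos a" "pos b" shows "norm a \<le> norm (a + b)"
proof -
  define t where "t = norm (a + b)"
  have "pos (scaleR t 1 - (a + b))" using pos_complement pos_add assms by (simp add: t_def)
  then have "pos (scaleR t 1 - (a + b) + b)" using assms pos_add by blast
  then have "pos (scaleR t 1 - a)" by simp
  then obtain c where c: "pos c" "scaleR t 1 - a = c * c" "gen (scaleR t 1 - a) c"
    using pos_sqrt by blast
  obtain b where b: "st b = b" "a = b * b" using assms by (auto simp: pos_def)
  have "b * c = c * b"
    by (rule gen_commute[OF c(3)]) (use b in \<open>auto simp: algebra_simps\<close>)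
  then have "(norm b)\<^sup>2 \<le> \<bar>t\<bar>"
    using b c pos_st by (intro norm_le_of_square_sum[of b c]) (auto simp: algebra_simps)
  then show ?thesis using norm_square[of b] b by (simp add: t_def)
qed

lemma pos_add_eq_0: "pos a \<Longrightarrow> pos b \<Longrightarrow> a + b = 0 \<Longrightarrow> a = 0"
  using pos_norm_mono[of a b] by simp

text \<open>Here \<open>s\<close> is an absolute value of \<open>a\<close>, and the claim says that
  \<open>x = s + a\<close> equals its own absolute value \<open>q\<close>. For
  \<open>d = q - x\<close> one finds \<open>(s + s) * d = - (q * d)\<close>, so the positive
  elements \<open>q * (d * d)\<close> and \<open>s * (d * d) + s * (d * d)\<close> add up to zero
  and both vanish. As \<open>d * d = q * d + q * d\<close>, the cube of \<open>d\<close> is zero,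
  hence \<open>d = 0\<close>.\<close>

lemma pos_plus_of_abs:
  assumes s: "pos s" and a: "st a = a" and sa: "s * a = a * s" and eq: "s * s = a * a"
  shows "pos (s + a)"
proof -
  define x y where "x = s + a" and "y = s - a"
  have sts: "st s = s" using s pos_st by blast
  have xy: "x * y = 0" by (simp add: x_def y_def algebra_simps sa eq)
  have stx: "st x = x" and sty: "st y = y" by (simp_all add: x_def y_def sts a)
  obtain q where q: "pos q" "x * x = q * q" "gen (x * x) q"
    using pos_sqrt[OF pos_square[OF stx]] by blast
  have stq: "st q = q" using q pos_st by blast
  have "s * (x * x) = (x * x) * s" "a * (x * x) = (x * x) * a"
    by (simp_all add: x_def algebra_simps sa) (metis mult.assoc sa)+
  then have qs: "s * q = q * s" and qa: "a * q = q * a"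
    using gen_commute[OF q(3)] stx by auto
  have qx: "x * q = q * x" and qy: "y * q = q * y"
    by (simp_all add: x_def y_def algebra_simps qs qa)
  have "(q * y) * (q * y) = (q * q) * (y * y)" by (metis qy mult.assoc)
  also have "\<dots> = x * (x * y) * y" by (simp add: q(2)[symmetric] mult.assoc)
  finally have "(q * y) * (q * y) = 0" by (simp add: xy)
  then have qy0: "q * y = 0" using square_eq_0[of "q * y"] qy stq sty by simp
  define d where "d = q - x"
  have std: "st d = d" by (simp add: d_def stq stx)
  have dd: "d * d = q * d + q * d" by (simp add: d_def algebra_simps q(2) qx)
  have "s + s = x + y" by (simp add: x_def y_def)
  then have "(s + s) * d = d * (x + y)" by (simp add: d_def algebra_simps qs x_def y_def sa)
  also have "\<dots> = - (q * d)" by (simp add: d_def algebra_simps q(2) qx qy0 xy)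
  finally have "(s + s) * d * d = - (q * d) * d" by simp
  then have sum0: "q * (d * d) + (s * (d * d) + s * (d * d)) = 0"
    by (simp add: algebra_simps)
  have "s * (d * d) = (d * d) * s"
  proof -
    have "s * d = d * s" by (simp add: d_def x_def algebra_simps qs sa)
    then show ?thesis by (metis mult.assoc)
  qed
  then have p1: "pos (s * (d * d))" by (intro pos_mult s pos_square std) 
  have "q * (d * d) = (d * d) * q"
  proof -
    have "q * d = d * q" by (simp add: d_def algebra_simps qx)
    then show ?thesis by (metis mult.assoc)
  qed
  then have p2: "pos (q * (d * d))" by (intro pos_mult q pos_square std)
  have "q * (d * d) = 0" using pos_add_eq_0[OF p2 pos_add[OF p1 p1] sum0] .
  then have "(d * d) * d = 0" by (simp add: dd distrib_right mult.assoc)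
  then have "(d * d) * (d * d) = 0" by (metis mult.assoc mult_zero_left)
  then have "d = 0" using square_eq_0[of "d * d"] square_eq_0[of d] std by simp
  then show ?thesis using q by (simp add: d_def x_def)
qed

lemma pospart:
  assumes a: "st a = a"
  obtains p n where "pos p" "pos n" "a = p - n" "p * n = 0" "n * p = 0"
    "gen a p" "gen a n" "norm p \<le> norm a" "norm n \<le> norm a"
proof -
  obtain s where s: "pos s" "a * a = s * s" "gen (a * a) s"
    using pos_sqrt[OF pos_square[OF a]] by blast
  have "gen a (a * a)" by (intro gen_intros)
  then have gs: "gen a s" using s gen_trans by blast
  have sa: "s * a = a * s" using gen_commute2[OF gs gen_refl a] .
  have "(norm s)\<^sup>2 = (norm a)\<^sup>2"
    using norm_square[of a] norm_square[of s] s a pos_st by simp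
  then have ns: "norm s = norm a" by simp
  define p n where "p = scaleR (1/2) (s + a)" and "n = scaleR (1/2) (s - a)"
  have "pos p" unfolding p_def using pos_plus_of_abs[OF s(1) a sa] s(2) by (intro pos_scaleR) auto
  moreover have "pos n" unfolding n_def
    using pos_plus_of_abs[OF s(1), of "- a"] s(2) a sa by (intro pos_scaleR) auto
  moreover have "a = p - n"
    by (simp add: p_def n_def scaleR_diff_right[symmetric] scaleR_2[symmetric])
  moreover have "p * n = 0" "n * p = 0"
    by (simp_all add: p_def n_def algebra_simps sa s(2))
  moreover have "gen a p" "gen a n" unfolding p_def n_def by (intro gen_intros gs)+
  moreover have "norm p \<le> norm a" "norm n \<le> norm a"
    using norm_triangle_ineq[of s a] norm_triangle_ineq4[of s a]
    by (simp_all add: p_def n_def ns)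
  ultimately show ?thesis using that by blast
qed

text \<open>Write \<open>p = b * b\<close> and \<open>M - p = c * c\<close>. As with the double
  angle formulas, \<open>x = b * b - c * c\<close> and \<open>y = 2 b c\<close> satisfy
  \<open>x * x + y * y = M * M\<close>, so \<open>norm x \<le> M\<close>, and \<open>x\<close> is
  twice the element to be estimated.\<close>

lemma pos_norm_sub_half:
  assumes "pos p" "norm p \<le> M"
  shows "norm (p - scaleR (M / 2) 1) \<le> M / 2"
proof -
  obtain c where c: "st c = c" "scaleR M 1 - p = c * c" "gen p c"
    using pos_complement_sqrt[OF assms] by blast
  obtain b where b: "pos b" "p = b * b" "gen p b" using pos_sqrt assms by blast
  have stp: "st p = p" and stb: "st b = b" using assms b pos_st by auto
  have M: "0 \<le> M" using assms(2) norm_ge_zero order_trans by blast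
  have bc: "b * c = c * b" using gen_commute2[OF b(3) c(3) stp] .
  define x where "x = b * b - c * c"
  define y where "y = scaleR 2 (b * c)"
  have sum: "c * c = scaleR M 1 - b * b" using c b by simp
  have bbcc: "(b * b) * (c * c) = (c * c) * (b * b)" using bc by (metis mult.assoc)
  have y2: "y * y = scaleR 4 ((b * b) * (c * c))"
  proof -
    have "(b * c) * (b * c) = (b * b) * (c * c)" using bc by (metis mult.assoc)
    then show ?thesis by (simp add: y_def)
  qed
  have "x * x + y * y = (b * b + c * c) * (b * b + c * c)"
  proof -
    have "(4::real) = 2 + 2" by simp
    then have "scaleR 4 z = z + z + (z + z)" for z :: 'a by (metis scaleR_2 scaleR_add_left)
    then show ?thesis unfolding y2 x_def using bbcc by (simp add: algebra_simps)
  qed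
  also have "\<dots> = scaleR (M * M) 1" by (simp add: sum)
  finally have sq: "x * x + y * y = scaleR (M * M) 1" .
  have xy: "x * y = y * x"
  proof -
    have "(b * b) * (b * c) = (b * c) * (b * b)" "(c * c) * (b * c) = (b * c) * (c * c)"
      using bc by (metis mult.assoc)+
    then show ?thesis by (simp add: x_def y_def algebra_simps)
  qed
  have "(norm x)\<^sup>2 \<le> \<bar>M * M\<bar>"
    by (rule norm_le_of_square_sum[OF _ _ xy sq]) (simp_all add: x_def y_def c stb bc)
  then have "(norm x)\<^sup>2 \<le> M\<^sup>2" by (simp add: power2_eq_square)
  then have "norm x \<le> M" using M by (rule power2_le_imp_le)
  moreover have "p - scaleR (M / 2) 1 = scaleR (1 / 2) x"
  proof -
    have "x = scaleR 2 p - scaleR M 1" by (simp add: x_def sum b(2) scaleR_2)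
    then show ?thesis by (simp add: scaleR_diff_right)
  qed
  ultimately show ?thesis by simp
qed

text \<open>Shrinking to where \<open>h\<close> is nearly maximal: \<open>k\<close> is the positive
  part of \<open>h - (norm h - \<epsilon>)\<close>. On it \<open>h\<close> acts as
  \<open>norm h - \<epsilon> + k\<close>, so \<open>r = \<epsilon> - k\<close>, and
  \<open>0 \<le> k \<le> \<epsilon>\<close> bounds \<open>r\<close>. If
  \<open>norm h \<le> \<epsilon>\<close>, already \<open>k = 1\<close> works.\<close>

lemma top_localization:
  assumes h: "pos h" and e: "\<epsilon> > 0"
  obtains k r where "k \<noteq> 0" "gen h k" "gen h r" "norm r \<le> \<epsilon>"
    "h * k = (scaleR (norm h) 1 - r) * k"
proof (cases "norm h \<le> \<epsilon>")
  case True
  have "norm (scaleR (norm h) 1 - h) \<le> \<epsilon>"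
    using pos_complement_norm[OF h order_refl] True by simp
  moreover have "gen h (scaleR (norm h) 1 - h)" by (intro gen_intros)
  ultimately show ?thesis using that[of 1 "scaleR (norm h) 1 - h"] by (simp add: gen_one)
next
  case False
  define H where "H = norm h"
  define x where "x = h - scaleR (H - \<epsilon>) 1"
  have sth: "st h = h" using h pos_st by blast
  then have stx: "st x = x" by (simp add: x_def)
  have gx: "gen h x" unfolding x_def by (intro gen_intros)
  obtain k n where kn: "pos k" "pos n" "x = k - n" "k * n = 0" "n * k = 0" "gen x k" "gen x n"
    using pospart[OF stx] .
  have gk: "gen h k" using gx kn gen_trans by blast
  have stk: "st k = k" using kn pos_st by blast
  have "k \<noteq> 0"
  proof
    assume "k = 0"
    then have "h + n = scaleR (H - \<epsilon>) 1" using kn(3) by (simp add: x_def algebra_simps)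
    then have "norm h \<le> \<bar>H - \<epsilon>\<bar>" using pos_norm_mono[OF h kn(2)] by simp
    then show False using False e by (simp add: H_def)
  qed
  moreover have xk: "x * k = k * k" unfolding kn(3) by (simp add: left_diff_distrib kn(5))
  have "norm k \<le> \<epsilon>"
  proof -
    define c where "c = scaleR H 1 - h"
    have c: "pos c" using pos_complement[OF h] by (simp add: c_def H_def)
    have ck: "k * c = c * k"
      by (rule gen_commute2[OF gk _ sth]) (simp add: c_def gen_intros)
    have "k * k + k * c = scaleR \<epsilon> k"
    proof -
      have "x + c = scaleR \<epsilon> 1" by (simp add: x_def c_def algebra_simps)
      then have "(x + c) * k = scaleR \<epsilon> k" by simp
      then show ?thesis by (simp add: distrib_right xk ck)
    qed
    moreover have "norm (k * k) \<le> norm (k * k + k * c)"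
      by (rule pos_norm_mono[OF pos_square[OF stk] pos_mult[OF kn(1) c ck]])
    ultimately have "(norm k)\<^sup>2 \<le> \<epsilon> * norm k" using norm_square[OF stk] e by simp
    then show ?thesis using \<open>k \<noteq> 0\<close> by (simp add: power2_eq_square)
  qed
  then have "norm (scaleR \<epsilon> 1 - k) \<le> \<epsilon>" using pos_complement_norm[OF kn(1)] by blast
  moreover have "gen h (scaleR \<epsilon> 1 - k)" by (intro gen_intros gk)
  moreover have "h * k = (scaleR (norm h) 1 - (scaleR \<epsilon> 1 - k)) * k"
  proof -
    have "h * k = (x + scaleR (H - \<epsilon>) 1) * k" by (simp add: x_def)
    then show ?thesis by (simp add: distrib_right xk H_def algebra_simps)
  qed
  ultimately show ?thesis using that gk by blast
qed

text \<open>Splitting \<open>y\<close> into real and imaginary parts shows that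
  \<open>y * st y\<close> is positive. To compare the two products, take \<open>k\<close> on which
  \<open>m\<close> is nearly its norm \<open>M\<close>, and put \<open>z = k * st y\<close>,
  \<open>T = norm (y * st y)\<close>. Then \<open>z * (T - y * st y)\<close> is nearly
  \<open>(T + M) z\<close>, while its norm is at most \<open>T * norm z\<close>. This forces
  \<open>z = 0\<close>, hence \<open>k * m = 0\<close>, against the choice of
  \<open>k\<close>.\<close>

lemma neg_st_mult_eq_0:
  assumes m: "pos m" and y: "st y * y = - m"
  shows "y = 0"
proof -
  define s where "s = scaleR (1/2) (y + st y)"
  define t where "t = sc (\<i>/2) (st y - y)"
  have ss: "st s = s" "st t = t"
    by (simp_all add: s_def t_def add.commute sc_diff_right)
  have "st y * y + y * st y = scaleR 2 (s * s + t * t)"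
  proof -
    have "scaleR 4 (s * s) = (y + st y) * (y + st y)" by (simp add: s_def)
    moreover have "scaleR 4 (t * t) = - ((st y - y) * (st y - y))"
      unfolding t_def by (simp flip: sc_of_real)
    ultimately have "scaleR 4 (s * s + t * t) = scaleR 2 (st y * y + y * st y)"
      by (simp add: scaleR_add_right scaleR_2 algebra_simps)
    then have "scaleR (1/2) (scaleR 4 (s * s + t * t)) = scaleR (1/2) (scaleR 2 (st y * y + y * st y))"
      by (rule arg_cong)
    then show ?thesis by simp
  qed
  then have "y * st y = scaleR 2 (s * s + t * t) + m" using y by (simp add: algebra_simps)
  moreover have "pos (scaleR 2 (s * s + t * t) + m)"
    by (intro pos_add pos_scaleR pos_square ss m) simp
  ultimately have q: "pos (y * st y)" by simp
  define T where "T = norm (y * st y)"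
  define M where "M = norm m"
  show ?thesis
  proof (rule ccontr)
    assume "y \<noteq> 0"
    then have "m \<noteq> 0" using y st_mult_self_eq_0[of y] by auto
    then have M: "M > 0" by (simp add: M_def)
    obtain k r where k: "k \<noteq> 0" "gen m k" "gen m r" "norm r \<le> M / 2"
      "m * k = (scaleR (norm m) 1 - r) * k"
      using top_localization[OF m, of "M / 2"] M by auto
    have stm: "st m = m" using m pos_st by blast
    have km: "k * m = (scaleR M 1 - r) * k"
      using k(5) gen_commute2[OF k(2) gen_refl stm] by (simp add: M_def)
    define z where "z = k * st y"
    have "z * (scaleR T 1 - y * st y) = k * (scaleR T (st y) - (st y * y) * st y)"
      by (simp add: z_def algebra_simps)
    also have "\<dots> = scaleR T (k * st y) + (k * m) * st y"
      unfolding y by (simp add: algebra_simps)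
    also have "\<dots> = scaleR (T + M) z - r * z"
      unfolding km by (simp add: z_def algebra_simps)
    finally have eq: "scaleR (T + M) z = z * (scaleR T 1 - y * st y) + r * z"
      by (simp add: algebra_simps)
    have "(T + M) * norm z = norm (scaleR (T + M) z)" using M by (simp add: T_def)
    also have "\<dots> \<le> norm (z * (scaleR T 1 - y * st y)) + norm (r * z)"
      unfolding eq by (rule norm_triangle_ineq)
    also have "\<dots> \<le> norm z * T + (M / 2) * norm z"
    proof (intro add_mono)
      have "norm (scaleR T 1 - y * st y) \<le> T"
        using pos_complement_norm[OF q order_refl] by (simp add: T_def)
      then show "norm (z * (scaleR T 1 - y * st y)) \<le> norm z * T"
        by (meson norm_mult_ineq mult_left_mono norm_ge_zero order_trans)
      show "norm (r * z) \<le> (M / 2) * norm z"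
        using k(4) by (meson norm_mult_ineq mult_right_mono norm_ge_zero order_trans)
    qed
    finally have "M / 2 * norm z \<le> 0" by (simp add: algebra_simps)
    then have "z = 0" using M by (simp add: mult_le_0_iff)
    then have "k * (st y * y) = 0" by (simp add: z_def flip: mult.assoc)
    then have "scaleR M k = r * k" using km by (simp add: y algebra_simps)
    then have "M * norm k \<le> M / 2 * norm k"
      using norm_mult_ineq[of r k] mult_right_mono[OF k(4) norm_ge_zero[of k]] M
      by (metis norm_scaleR abs_of_pos order_trans)
    then show False using M k(1) by simp
  qed
qed

text \<open>With \<open>n\<close> the negative part of \<open>st x * x\<close>, the element
  \<open>x * n\<close> has square \<open>st (x * n) * (x * n)\<close> equal to minus the cube of
  \<open>n\<close>; so \<open>x * n = 0\<close>, and this gives \<open>n = 0\<close>.\<close>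

theorem pos_st_mult_self: "pos (st x * x)"
proof -
  have "st (st x * x) = st x * x" by simp
  then obtain p n where pn: "pos p" "pos n" "st x * x = p - n" "p * n = 0" "n * p = 0"
    using pospart by metis
  have stn: "st n = n" using pn pos_st by blast
  have "st (x * n) * (x * n) = n * (st x * x) * n" by (simp add: stn mult.assoc)
  also have "\<dots> = - (n * (n * n))" unfolding pn(3) by (simp add: algebra_simps pn)
  finally have "x * n = 0"
    by (rule neg_st_mult_eq_0[rotated]) (intro pos_mult pn pos_square stn, simp add: mult.assoc)
  then have "(p - n) * n = 0" using pn(3) by (metis mult.assoc mult_zero_right)
  then have "n * n = 0" using pn by (simp add: algebra_simps)
  then have "n = 0" using square_eq_0 stn by blast
  then show ?thesis using pn by simp
qed

lemma pos_conj: "pos a \<Longrightarrow> pos (st x * a * x)"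
  unfolding pos_def[of a]
proof (elim exE conjE)
  fix b assume "st b = b" "a = b * b"
  then show ?thesis using pos_st_mult_self[of "b * x"] by (simp add: mult.assoc)
qed

text \<open>For \<open>x * y = 0\<close> the product \<open>(t - x) * (t - y)\<close> equals
  \<open>t * (t - (x + y))\<close>. The left side is positive as a product of commuting positive
  elements, hence \<open>x + y \<le> t\<close>.\<close>

lemma norm_pos_orthogonal_sum:
  assumes t: "0 < t"
  shows "finite F \<Longrightarrow> (\<And>v. v \<in> F \<Longrightarrow> pos (a v)) \<Longrightarrow> (\<And>v. v \<in> F \<Longrightarrow> norm (a v) \<le> t) \<Longrightarrow>
    (\<And>u v. u \<in> F \<Longrightarrow> v \<in> F \<Longrightarrow> u \<noteq> v \<Longrightarrow> a u * a v = 0) \<Longrightarrow> norm (\<Sum>v\<in>F. a v) \<le> t"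
proof (induction F rule: finite_induct)
  case (insert v F)
  define x y where "x = a v" and "y = (\<Sum>v\<in>F. a v)"
  have x: "pos x" "norm x \<le> t" using insert by (auto simp: x_def)
  have y: "pos y" "norm y \<le> t" using insert by (auto simp: y_def intro!: pos_sum insert.IH)
  have xy: "x * y = 0" "y * x = 0"
    using insert by (auto simp: x_def y_def sum_distrib_left sum_distrib_right intro!: sum.neutral)
  have "pos ((scaleR t 1 - x) * (scaleR t 1 - y))"
    using x y xy by (intro pos_mult pos_complement) (auto simp: algebra_simps)
  also have "(scaleR t 1 - x) * (scaleR t 1 - y) = scaleR t (scaleR t 1 - (x + y))"
    using xy by (simp add: algebra_simps)
  finally have "pos (scaleR (1 / t) (scaleR t (scaleR t 1 - (x + y))))"
    by (rule pos_scaleR) (use t in simp)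
  then have "pos (scaleR t 1 - (x + y))" using t by simp
  then have "norm (x + y) \<le> norm ((x + y) + (scaleR t 1 - (x + y)))"
    using x y by (intro pos_norm_mono pos_add)
  then show ?case using insert t by (simp add: x_def y_def)
qed (use t in simp)

lemma st_mult_orthogonal_sums:
  assumes "finite F" "\<And>u v. u \<in> F \<Longrightarrow> v \<in> F \<Longrightarrow> u \<noteq> v \<Longrightarrow> st (e u) * e v = 0"
  shows "st (\<Sum>u\<in>F. sc (a u) (e u)) * (\<Sum>v\<in>F. sc (b v) (e v)) =
    (\<Sum>v\<in>F. sc (cnj (a v) * b v) (st (e v) * e v))"
proof -
  have "st (\<Sum>u\<in>F. sc (a u) (e u)) * (\<Sum>v\<in>F. sc (b v) (e v)) =
      (\<Sum>u\<in>F. \<Sum>v\<in>F. sc (cnj (a u) * b v) (st (e u) * e v))"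
    by (simp add: st_sum sum_product mult.commute)
  also have "\<dots> = (\<Sum>u\<in>F. \<Sum>v\<in>F. if v = u then sc (cnj (a u) * b u) (st (e u) * e u) else 0)"
    using assms(2) by (intro sum.cong refl) auto
  finally show ?thesis using assms(1) by (simp add: sum.delta)
qed

text \<open>The set \<open>Z\<close> consists of right factors occurring in \<open>x\<close> and
  does not depend on \<open>k\<close>. If \<open>x * k\<close> is not small, then some
  \<open>a * z * k\<close> with \<open>z\<close> in \<open>Z\<close> is not small either.\<close>

lemma span_ideal_bound:
  fixes a x :: 'a
  assumes "x \<in> span (range (\<lambda>(c, c'). c * a * c'))"
  shows "\<exists>Z M. finite Z \<and> 0 \<le> M \<and> (\<forall>k. norm (x * k) \<le> M * (\<Sum>z\<in>Z. norm (a * z * k)))"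
  using assms
proof (induction rule: span_induct_alt)
  case base
  then show ?case by (intro exI[of _ "{}"] exI[of _ 0]) auto
next
  case (step r w y)
  then obtain c c' where w: "w = c * a * c'" by auto
  from step obtain Z M where Z: "finite Z" "0 \<le> M" "\<And>k. norm (y * k) \<le> M * (\<Sum>z\<in>Z. norm (a * z * k))"
    by blast
  show ?case
  proof (intro exI[of _ "insert c' Z"] exI[of _ "\<bar>r\<bar> * norm c + M"] conjI allI)
    fix k
    define S where "S = (\<Sum>z\<in>insert c' Z. norm (a * z * k))"
    have S1: "norm (a * c' * k) \<le> S"
      unfolding S_def by (rule member_le_sum) (use Z in auto)
    have S2: "(\<Sum>z\<in>Z. norm (a * z * k)) \<le> S"
      unfolding S_def by (rule sum_mono2) (use Z in auto)
    have "(scaleR r w + y) * k = scaleR r (c * (a * c' * k)) + y * k"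
      by (simp add: w distrib_right mult.assoc)
    then have "norm ((scaleR r w + y) * k) \<le> norm (scaleR r (c * (a * c' * k))) + norm (y * k)"
      by (simp only: norm_triangle_ineq)
    also have "\<dots> \<le> \<bar>r\<bar> * norm c * S + M * S"
    proof (intro add_mono)
      have "norm (c * (a * c' * k)) \<le> norm c * S"
        using norm_mult_ineq S1 by (meson mult_left_mono norm_ge_zero order_trans)
      then show "norm (scaleR r (c * (a * c' * k))) \<le> \<bar>r\<bar> * norm c * S"
        by (simp add: mult.assoc mult_left_mono)
      show "norm (y * k) \<le> M * S" using Z(2,3) S2 by (meson mult_left_mono order_trans)
    qed
    finally show "norm ((scaleR r w + y) * k) \<le> (\<bar>r\<bar> * norm c + M) * (\<Sum>z\<in>insert c' Z. norm (a * z * k))"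
      by (simp add: S_def distrib_right)
  qed (use Z in auto)
qed

text \<open>Although \<open>span\<close> is the real span, it is closed under complex scalars, since
  the left factor \<open>c\<close> of a generator absorbs them.\<close>

lemma closed_ideal_closure_span:
  "closed_ideal sc UNIV (closure (span (range (\<lambda>(c, c'). c * a * c'))))"
proof -
  define S where "S = range (\<lambda>(c, c'). c * a * c')"
  have cl: "f x \<in> closure (span S)"
    if "continuous_on UNIV f" "\<And>y. y \<in> span S \<Longrightarrow> f y \<in> closure (span S)" "x \<in> closure (span S)" for f x
    using image_closure_subset[of "span S" f "closure (span S)"] that
    by (auto intro: continuous_on_subset)
  have add: "x + y \<in> closure (span S)" if x: "x \<in> closure (span S)" and y: "y \<in> closure (span S)" for x y
  proof -
    have "x + z \<in> closure (span S)" if "z \<in> span S" for z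
      by (rule cl[of "\<lambda>x. x + z", OF _ _ x])
        (auto intro!: continuous_intros subsetD[OF closure_subset] span_add that)
    then show ?thesis by (intro cl[of "\<lambda>y. x + y", OF _ _ y]) (auto intro!: continuous_intros)
  qed
  have lift: "f x \<in> closure (span S)"
    if "bounded_linear f" "\<And>c c'. f (c * a * c') \<in> S" "x \<in> closure (span S)" for f x
  proof (rule cl[OF _ _ that(3)])
    show "continuous_on UNIV f" using that(1) by (rule linear_continuous_on)
    fix y assume "y \<in> span S"
    then have "f y \<in> f ` span S" by blast
    also have "\<dots> = span (f ` S)" using that(1) by (simp add: linear_span_image bounded_linear.linear)
    also have "\<dots> \<subseteq> span S" using that(2) by (intro span_mono) (auto simp: S_def)
    finally show "f y \<in> closure (span S)" using closure_subset by blast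
  qed
  have Sl: "c * a * c' \<in> S" for c c' by (auto simp: S_def)
  have sc: "bounded_linear (sc c)" for c
    by (rule bounded_linear_intro[where K = "cmod c"]) (auto simp: sc_add_right)
  have "sc c x \<in> closure (span S)" if "x \<in> closure (span S)" for c x
    by (rule lift[OF sc _ that]) (metis Sl sc_mult_left)
  moreover have "y * x \<in> closure (span S)" if "x \<in> closure (span S)" for y x
    by (rule lift[OF bounded_linear_mult_right _ that]) (metis Sl mult.assoc)
  moreover have "x * y \<in> closure (span S)" if "x \<in> closure (span S)" for y x
    by (rule lift[OF bounded_linear_mult_left _ that]) (metis Sl mult.assoc)
  moreover have "0 \<in> closure (span S)" using closure_subset span_zero by blast
  ultimately show ?thesis using add unfolding closed_ideal_def csubspace_def S_def[symmetric] by auto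
qed

text \<open>The product of the adjoint of the column \<open>x\<close> with \<open>x\<close>; its
  norm is the square of the column norm.\<close>

definition colsq :: "'i set \<Rightarrow> ('i \<Rightarrow> 'a) \<Rightarrow> 'a" where
  "colsq I x = (\<Sum>i\<in>I. st (x i) * x i)"

lemma pos_colsq: "pos (colsq I x)"
  unfolding colsq_def by (intro pos_sum pos_st_mult_self)

lemma colsq_mult: "colsq I (\<lambda>i. x i * z) = st z * colsq I x * z"
  by (simp add: colsq_def sum_distrib_left sum_distrib_right mult.assoc)

lemma norm_colsq_diff_le:
  assumes "\<And>i. i \<in> I \<Longrightarrow> norm (x i) + norm (y i) \<le> R" "\<And>i. i \<in> I \<Longrightarrow> norm (x i - y i) \<le> e"
  shows "norm (colsq I x - colsq I y) \<le> real (card I) * (R * e)"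
proof -
  have "colsq I x - colsq I y = (\<Sum>i\<in>I. st (x i - y i) * x i + st (y i) * (x i - y i))"
    by (simp add: colsq_def algebra_simps flip: sum_subtractf)
  also have "norm \<dots> \<le> (\<Sum>i\<in>I. R * e)"
  proof (rule sum_norm_le)
    fix i assume i: "i \<in> I"
    have "norm (st (x i - y i) * x i) \<le> norm (x i - y i) * norm (x i)"
      using norm_mult_ineq[of "st (x i - y i)" "x i"] by (simp only: norm_st)
    moreover have "norm (st (y i) * (x i - y i)) \<le> norm (y i) * norm (x i - y i)"
      using norm_mult_ineq[of "st (y i)" "x i - y i"] by (simp only: norm_st)
    ultimately have "norm (st (x i - y i) * x i + st (y i) * (x i - y i))
        \<le> (norm (x i) + norm (y i)) * norm (x i - y i)"
      using norm_triangle_ineq[of "st (x i - y i) * x i" "st (y i) * (x i - y i)"]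
      by (simp add: algebra_simps)
    also have "\<dots> \<le> R * e"
    proof (rule mult_mono)
      show "0 \<le> R" using assms(1)[OF i] norm_ge_zero[of "x i"] norm_ge_zero[of "y i"] by linarith
    qed (use assms i in auto)
    finally show "norm (st (x i - y i) * x i + st (y i) * (x i - y i)) \<le> R * e" .
  qed
  finally show ?thesis by simp
qed

section \<open>Localization in abelian subalgebras\<close>

lemma abelianD: "abelian A \<Longrightarrow> x \<in> A \<Longrightarrow> y \<in> A \<Longrightarrow> x * y = y * x"
  by (auto simp: abelian_def)

text \<open>On the support of its positive part, or on that of its negative part, an element of norm
  at most \<open>2 M\<close> is within \<open>M\<close> of one of the scalars \<open>M\<close> and \<open>- M\<close>.\<close>

lemma localize_self_adjoint:
  assumes A: "csub A" "abelian A" and "\<epsilon> > 0"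
  shows "norm a \<le> \<epsilon> * 2 ^ n \<Longrightarrow> a \<in> A \<Longrightarrow> st a = a \<Longrightarrow> h \<in> A \<Longrightarrow> h \<noteq> 0 \<Longrightarrow>
    \<exists>c::real. \<exists>r\<in>A. \<exists>m\<in>A. norm r \<le> \<epsilon> \<and> h * m \<noteq> 0 \<and> a * (h * m) = (scaleR c 1 + r) * (h * m)"
proof (induction n arbitrary: a h)
  case 0
  then show ?case using csub_one[OF A(1)]
    by (intro exI[of _ 0] bexI[of _ a] bexI[of _ 1]) auto
next
  case (Suc n)
  define M where "M = \<epsilon> * 2 ^ Suc n"
  have M: "norm a \<le> M" "M / 2 = \<epsilon> * 2 ^ n" using Suc.prems by (auto simp: M_def)
  obtain p q where pq: "pos p" "pos q" "a = p - q" "p * q = 0" "q * p = 0" "gen a p" "gen a q"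
    "norm p \<le> norm a" "norm q \<le> norm a"
    using pospart[OF Suc.prems(3)] .
  have inA: "p \<in> A" "q \<in> A" using pq genD A Suc.prems by blast+
  have st: "st p = p" "st q = q" using pq pos_st by auto
  show ?case
  proof (cases "h * p = 0")
    case False
    define a' where "a' = p - scaleR (M / 2) 1"
    have "\<exists>c::real. \<exists>r\<in>A. \<exists>m\<in>A. norm r \<le> \<epsilon> \<and> h * p * m \<noteq> 0 \<and>
        a' * (h * p * m) = (scaleR c 1 + r) * (h * p * m)"
    proof (rule Suc.IH)
      show "norm a' \<le> \<epsilon> * 2 ^ n"
        using pos_norm_sub_half[OF pq(1), of M] M pq unfolding a'_def by simp
    qed (use A inA Suc.prems False st in \<open>auto simp: a'_def intro!: csub_intros\<close>)
    then obtain c :: real and r m where crm: "r \<in> A" "m \<in> A" "norm r \<le> \<epsilon>" "h * p * m \<noteq> 0"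
      "a' * (h * p * m) = (scaleR c 1 + r) * (h * p * m)" by blast
    have "q * (h * p * m) = 0"
    proof -
      have "q * h = h * q" using abelianD A inA Suc.prems by blast
      then show ?thesis by (metis mult.assoc mult_zero_left mult_zero_right pq(5))
    qed
    then have "a * (h * p * m) = p * (h * p * m)" by (simp add: pq(3) left_diff_distrib)
    also have "\<dots> = (scaleR (c + M / 2) 1 + r) * (h * p * m)"
      using crm(5) by (simp add: a'_def algebra_simps)
    finally show ?thesis using crm A inA
      by (intro exI[of _ "c + M / 2"] bexI[of _ r] bexI[of _ "p * m"])
        (auto simp: mult.assoc intro: csub_intros)
  next
    case True
    define a' where "a' = - (q - scaleR (M / 2) 1)"
    have "\<exists>c::real. \<exists>r\<in>A. \<exists>m\<in>A. norm r \<le> \<epsilon> \<and> h * m \<noteq> 0 \<and>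
        a' * (h * m) = (scaleR c 1 + r) * (h * m)"
    proof (rule Suc.IH)
      show "norm a' \<le> \<epsilon> * 2 ^ n"
        using pos_norm_sub_half[OF pq(2), of M] M pq unfolding a'_def norm_minus_cancel by simp
    qed (use A inA Suc.prems st in \<open>auto simp: a'_def intro!: csub_intros\<close>)
    then obtain c :: real and r m where crm: "r \<in> A" "m \<in> A" "norm r \<le> \<epsilon>" "h * m \<noteq> 0"
      "a' * (h * m) = (scaleR c 1 + r) * (h * m)" by blast
    have "p * (h * m) = 0"
      using abelianD[OF A(2), of p h] inA Suc.prems True by (simp flip: mult.assoc)
    then have "a * (h * m) = - q * (h * m)" by (simp add: pq(3) left_diff_distrib)
    also have "\<dots> = (scaleR (c - M / 2) 1 + r) * (h * m)"
      using crm(5) by (simp add: a'_def algebra_simps)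
    finally show ?thesis using crm by blast
  qed
qed

text \<open>The scalar \<open>c\<close> plays the value of \<open>a\<close> at a point in the
  support of \<open>h\<close>, and \<open>h * m\<close> a bump near that point. Real and imaginary
  parts are treated in turn; the second shrinking multiplies from the right and so preserves what
  the first achieved.\<close>

lemma localize:
  assumes A: "csub A" "abelian A" and e: "\<epsilon> > 0" and a: "a \<in> A" and h: "h \<in> A" "h \<noteq> 0"
  shows "\<exists>c. \<exists>r\<in>A. \<exists>m\<in>A. norm r \<le> \<epsilon> \<and> h * m \<noteq> 0 \<and> a * (h * m) = (sc c 1 + r) * (h * m)"
proof -
  have *: "\<exists>c::real. \<exists>r\<in>A. \<exists>m\<in>A. norm r \<le> \<epsilon>/2 \<and> g * m \<noteq> 0 \<and> b * (g * m) = (scaleR c 1 + r) * (g * m)"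
    if "b \<in> A" "st b = b" "g \<in> A" "g \<noteq> 0" for b g
  proof -
    obtain n where "norm b / (\<epsilon>/2) < 2 ^ n" using real_arch_pow[of 2 "norm b / (\<epsilon>/2)"] by auto
    then have "norm b \<le> \<epsilon>/2 * 2 ^ n" using e by (simp add: field_simps)
    then show ?thesis using localize_self_adjoint[OF A, of "\<epsilon>/2"] e that by auto
  qed
  define x y where "x = scaleR (1/2) (a + st a)" and "y = sc (- \<i>/2) (a - st a)"
  have xy: "x \<in> A" "y \<in> A" "st x = x" "st y = y"
    using A a by (auto simp: x_def y_def sc_diff_right add.commute intro!: csub_intros)
  have "\<i> * (- \<i> / 2) = complex_of_real (1/2)" by simp
  then have "sc \<i> y = scaleR (1/2) (a - st a)" unfolding y_def by (metis sc_sc sc_of_real)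
  then have "x + sc \<i> y = scaleR (1/2) (a + st a + (a - st a))"
    by (simp only: x_def flip: scaleR_add_right)
  then have axy: "a = x + sc \<i> y" by (simp flip: scaleR_2)
  obtain c r m where 1: "r \<in> A" "m \<in> A" "norm r \<le> \<epsilon>/2" "h * m \<noteq> 0"
    "x * (h * m) = (scaleR c 1 + r) * (h * m)" using *[of x h] xy h by blast
  obtain c' r' m' where 2: "r' \<in> A" "m' \<in> A" "norm r' \<le> \<epsilon>/2" "h * m * m' \<noteq> 0"
    "y * (h * m * m') = (scaleR c' 1 + r') * (h * m * m')"
    using *[of y "h * m"] xy h 1 csub_mult[OF A(1)] by blast
  have "x * (h * m * m') = (scaleR c 1 + r) * (h * m * m')"
    using arg_cong[OF 1(5), of "\<lambda>z. z * m'"] by (simp add: mult.assoc)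
  then have "a * (h * (m * m')) = (sc (complex_of_real c + \<i> * complex_of_real c') 1 + (r + sc \<i> r')) * (h * (m * m'))"
    using 2(5) unfolding axy
    by (simp add: algebra_simps sc_add_right sc_add_left flip: sc_of_real)
  moreover have "norm (r + sc \<i> r') \<le> \<epsilon>"
    using norm_triangle_ineq[of r "sc \<i> r'"] 1(3) 2(3) by simp
  moreover have "r + sc \<i> r' \<in> A" "m * m' \<in> A" using 1 2 A by (auto intro!: csub_intros)
  ultimately show ?thesis using 2(4) by (metis mult.assoc)
qed

lemma localize_finite:
  assumes A: "csub A" "abelian A" and e: "\<epsilon> > 0" and h: "h \<in> A" "h \<noteq> 0"
  shows "finite E \<Longrightarrow> E \<subseteq> A \<Longrightarrow> \<exists>m\<in>A. h * m \<noteq> 0 \<and>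
    (\<forall>a\<in>E. \<exists>c. \<exists>r\<in>A. norm r \<le> \<epsilon> \<and> a * (h * m) = (sc c 1 + r) * (h * m))"
proof (induction E rule: finite_induct)
  case empty
  then show ?case using h csub_one[OF A(1)] by (intro bexI[of _ 1]) auto
next
  case (insert a E)
  then obtain m where m: "m \<in> A" "h * m \<noteq> 0"
    "\<And>b. b \<in> E \<Longrightarrow> \<exists>c. \<exists>r\<in>A. norm r \<le> \<epsilon> \<and> b * (h * m) = (sc c 1 + r) * (h * m)" by blast
  obtain c r m' where c: "r \<in> A" "m' \<in> A" "norm r \<le> \<epsilon>" "h * m * m' \<noteq> 0"
    "a * (h * m * m') = (sc c 1 + r) * (h * m * m')"
    using localize[OF A e, of a "h * m"] insert.prems m h csub_mult[OF A(1)] by blast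
  show ?case
  proof (intro bexI[of _ "m * m'"] conjI ballI)
    show "h * (m * m') \<noteq> 0" "m * m' \<in> A" using c m A by (auto simp: mult.assoc intro: csub_mult)
    fix b assume "b \<in> insert a E"
    then consider "b = a" | "b \<in> E" by blast
    then show "\<exists>c. \<exists>r\<in>A. norm r \<le> \<epsilon> \<and> b * (h * (m * m')) = (sc c 1 + r) * (h * (m * m'))"
    proof cases
      case 1
      then show ?thesis using c by (auto simp: mult.assoc)
    next
      case 2
      then obtain c r where "r \<in> A" "norm r \<le> \<epsilon>" "b * (h * m) = (sc c 1 + r) * (h * m)"
        using m(3) by blast
      then show ?thesis by (metis mult.assoc)
    qed
  qed
qed

section \<open>Inverses on small supports, and uniqueness of the C*-norm\<close>

lemma pos_inverse:
  assumes q: "pos q" and eta: "\<eta> > 0"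
  shows "\<exists>s. gen q s \<and> s * (scaleR \<eta> 1 + q) = 1"
proof -
  define Q where "Q = norm q"
  define x where "x = scaleR (1 / (\<eta> + Q)) (scaleR Q 1 - q)"
  have pos: "\<eta> + Q > 0" using eta by (simp add: Q_def add_pos_nonneg)
  have "norm x = norm (scaleR Q 1 - q) / (\<eta> + Q)" using pos by (simp add: x_def)
  also have "\<dots> \<le> Q / (\<eta> + Q)"
    using pos_complement_norm[OF q order_refl] pos by (simp add: Q_def divide_right_mono)
  also have "\<dots> < 1" using pos eta by simp
  finally have sm: "summable (\<lambda>n. x ^ n)" by (rule complete_algebra_summable_geometric)
  define S where "S = (\<Sum>n. x ^ n)"
  have "S * x = (\<Sum>n. x ^ n * x)" unfolding S_def by (rule suminf_mult2[OF sm])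
  also have "\<dots> = (\<Sum>n. x ^ Suc n)" by (simp add: power_Suc2 del: power_Suc)
  also have "\<dots> = S - 1" using suminf_split_head[OF sm] by (simp add: S_def)
  finally have S: "S * (1 - x) = 1" by (simp add: algebra_simps)
  have "scaleR (\<eta> + Q) x = scaleR Q 1 - q" using pos by (simp add: x_def)
  then have "scaleR \<eta> 1 + q = scaleR (\<eta> + Q) (1 - x)"
    by (simp add: algebra_simps)
  then have "scaleR (1 / (\<eta> + Q)) S * (scaleR \<eta> 1 + q) = 1" using pos S by simp
  moreover have "gen q S" unfolding gen_def
  proof (intro allI impI)
    fix A assume A: "csub A" "q \<in> A"
    then have "x \<in> A" unfolding x_def by (intro csub_intros)
    then have "x ^ n \<in> A" for n by (induction n) (use A in \<open>auto intro: csub_intros\<close>)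
    then have "(\<Sum>n<N. x ^ n) \<in> A" for N using A by (intro csub_sum)
    then show "S \<in> A"
      using summable_LIMSEQ[OF sm] csub_closed[OF A(1)] unfolding S_def
      by (metis closed_sequentially)
  qed
  ultimately show ?thesis by (meson gen_scaleR)
qed

text \<open>For \<open>p = st a * a\<close> let \<open>q\<close> be the positive part of
  \<open>p - \<eta>\<close>. On the support of \<open>q\<close> the element \<open>p\<close> acts as
  \<open>\<eta> + q\<close>, which is invertible by a Neumann series, and \<open>st a\<close>
  completes the inverse of \<open>a\<close>.\<close>

lemma local_inverse:
  assumes A: "csub A" "abelian A" and a: "a \<in> A" and h: "h \<in> A" "a * h \<noteq> 0"
  shows "\<exists>s\<in>A. \<exists>m\<in>A. h * m \<noteq> 0 \<and> s * a * (h * m) = h * m"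
proof -
  define p where "p = st a * a"
  have p: "pos p" "p \<in> A" "st p = p"
    using pos_st_mult_self A a by (auto simp: p_def intro: csub_intros)
  have hn0: "norm h > 0" using h by auto
  have ph: "p * h \<noteq> 0"
  proof
    assume "p * h = 0"
    then have "st h * (st a * a * h) = 0" by (simp add: p_def)
    then have "st (a * h) * (a * h) = 0" by (simp add: mult.assoc)
    then show False using h by (simp del: st_mult)
  qed
  \<comment> \<open>If \<open>q * h\<close> vanished, \<open>p * h\<close> would be
    \<open>\<eta> h - n * h\<close> with \<open>norm n \<le> \<eta>\<close>. Its norm would be at
    most \<open>2 * \<eta> * norm h\<close>, which by this choice is half of
    \<open>norm (p * h)\<close>.\<close>
  define \<eta> where "\<eta> = norm (p * h) / (4 * norm h)"
  have eta: "\<eta> > 0" using ph hn0 by (simp add: \<eta>_def)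
  define x where "x = p - scaleR \<eta> 1"
  have stx: "st x = x" by (simp add: x_def p)
  obtain q n where qn: "pos q" "pos n" "x = q - n" "q * n = 0" "n * q = 0" "gen x q" "gen x n"
    using pospart[OF stx] .
  have "x \<in> A" using A p by (auto simp: x_def intro: csub_intros)
  then have inA: "q \<in> A" "n \<in> A" using qn genD A by blast+
  have comm: "y * z = z * y" if "y \<in> A" "z \<in> A" for y z using abelianD A that by blast
  have "norm n \<le> \<eta>"
  proof -
    have "n * x = - (n * n)" unfolding qn(3) by (simp add: right_diff_distrib qn)
    then have eq: "n * n + n * p = scaleR \<eta> n" by (simp add: x_def algebra_simps)
    have "norm (n * n) \<le> norm (n * n + n * p)"
      using qn p inA comm pos_st by (intro pos_norm_mono pos_mult pos_square) auto
    then have "norm n * norm n \<le> \<eta> * norm n"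
      using eq norm_square[of n] pos_st[OF qn(2)] eta by (simp add: power2_eq_square)
    then show ?thesis using eta by (cases "norm n = 0") auto
  qed
  have "q * h \<noteq> 0"
  proof
    assume qh: "q * h = 0"
    have "p = q - n + scaleR \<eta> 1" using qn(3) by (simp add: x_def algebra_simps)
    then have "p * h = (q - n + scaleR \<eta> 1) * h" by (rule arg_cong)
    then have "p * h = - (n * h) + scaleR \<eta> h"
      by (simp add: left_diff_distrib distrib_right qh)
    then have "norm (p * h) \<le> norm (n * h) + norm (scaleR \<eta> h)"
      by (metis norm_minus_cancel norm_triangle_ineq)
    also have "\<dots> \<le> \<eta> * norm h + \<eta> * norm h"
    proof (intro add_mono)
      show "norm (n * h) \<le> \<eta> * norm h" using \<open>norm n \<le> \<eta>\<close>
        by (meson norm_mult_ineq mult_right_mono norm_ge_zero order_trans)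
    qed (use eta in simp)
    also have "\<dots> = norm (p * h) / 2" using hn0 by (simp add: \<eta>_def field_simps)
    finally show False using ph by simp
  qed
  then have hq: "h * q \<noteq> 0" using comm inA h by metis
  obtain s where s: "gen q s" "s * (scaleR \<eta> 1 + q) = 1" using pos_inverse[OF qn(1) eta] by blast
  have sA: "s \<in> A" using s inA genD A by blast
  have "x * q = q * q" unfolding qn(3) by (simp add: left_diff_distrib qn)
  then have pq: "p * q = (scaleR \<eta> 1 + q) * q" by (simp add: x_def algebra_simps)
  have "s * st a * a * (h * q) = s * p * (q * h)" using comm[of h q] inA h
    by (simp add: p_def mult.assoc)
  also have "\<dots> = s * (p * q) * h" by (simp add: mult.assoc)
  also have "\<dots> = (s * (scaleR \<eta> 1 + q)) * q * h" unfolding pq by (simp add: mult.assoc)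
  also have "\<dots> = h * q" using s(2) comm[of h q] inA h by simp
  finally show ?thesis using hq sA inA A a
    by (intro bexI[of _ "s * st a"] bexI[of _ q]) (auto intro: csub_intros)
qed

text \<open>Upper bound: a self-adjoint \<open>a\<close> is the real part of
  \<open>u = a + i c\<close>, where \<open>c * c = (norm a)^2 - a * a\<close>; both
  \<open>st u * u\<close> and \<open>u * st u\<close> are scalar, so \<open>M\<close> is known on
  \<open>u\<close> and \<open>st u\<close>. Lower bound: for positive \<open>a\<close> take
  \<open>k\<close> on which \<open>a\<close> is nearly \<open>norm a\<close> and compare the values
  of \<open>M\<close> on \<open>a * k\<close> and \<open>k\<close>. Completeness with respect to
  \<open>M\<close> does not enter.\<close>

lemma cstar_norm_unique:
  fixes M :: "'a \<Rightarrow> real"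
  assumes M0: "\<And>x. 0 \<le> M x" "\<And>x. M x = 0 \<longleftrightarrow> x = 0"
    and Madd: "\<And>x y. M (x + y) \<le> M x + M y"
    and Msc: "\<And>c x. M (sc c x) = cmod c * M x"
    and Mmult: "\<And>x y. M (x * y) \<le> M x * M y"
    and Mst: "\<And>x. M (st x * x) = (M x)\<^sup>2"
  shows "M x = norm x"
proof -
  have MR: "M (scaleR r x) = \<bar>r\<bar> * M x" for r x
    using Msc[of "complex_of_real r" x] by simp
  have "M 1 = (M 1)\<^sup>2" using Mst[of 1] by simp
  then have M1: "M 1 = 1" using M0(2)[of 1] by (simp add: power2_eq_square)
  have sa: "M a \<le> norm a" if a: "st a = a" for a
  proof -
    have "norm (a * a) \<le> (norm a)\<^sup>2" using norm_square[OF a] by simp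
    then obtain c where c: "st c = c" "scaleR ((norm a)\<^sup>2) 1 - a * a = c * c" "gen (a * a) c"
      using pos_complement_sqrt[OF pos_square[OF a]] by blast
    have ac: "a * c = c * a" using gen_commute[OF c(3), of a] a by (simp add: mult.assoc)
    define u where "u = a + sc \<i> c"
    have stu: "st u = a - sc \<i> c" by (simp add: u_def a c)
    have cc: "c * c = scaleR ((norm a)\<^sup>2) 1 - a * a" using c by simp
    have "st u * u = scaleR ((norm a)\<^sup>2) 1" unfolding stu unfolding u_def
      using ac by (simp add: algebra_simps sc_diff_right sc_add_right cc)
    then have "(M u)\<^sup>2 = (norm a)\<^sup>2" using Mst[of u] by (simp add: MR M1)
    then have Mu: "M u = norm a" using M0 by simp
    have "u * st u = scaleR ((norm a)\<^sup>2) 1" unfolding stu unfolding u_def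
      using ac by (simp add: algebra_simps sc_diff_right sc_add_right cc)
    then have "(M (st u))\<^sup>2 = (norm a)\<^sup>2" using Mst[of "st u"] by (simp add: MR M1)
    then have Mu': "M (st u) = norm a" using M0 by simp
    have "scaleR 2 a = u + st u" unfolding stu unfolding u_def by (simp add: scaleR_2)
    then have "2 * M a \<le> M u + M (st u)" using Madd[of u "st u"] MR[of 2 a] by simp
    then show ?thesis using Mu Mu' by simp
  qed
  have le: "M y \<le> norm y" for y
  proof -
    have "(M y)\<^sup>2 \<le> (norm y)\<^sup>2" using sa[of "st y * y"] Mst[of y] cstar_identity[of y] by simp
    then show ?thesis by (rule power2_le_imp_le) simp
  qed
  have "norm (st x * x) \<le> M (st x * x)"
  proof (rule field_le_epsilon)
    fix \<epsilon> :: real assume e: "\<epsilon> > 0"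
    define a where "a = st x * x"
    have a: "pos a" by (simp add: a_def pos_st_mult_self)
    obtain k r where k: "k \<noteq> 0" "norm r \<le> \<epsilon>" "a * k = (scaleR (norm a) 1 - r) * k"
      using top_localization[OF a e] by metis
    have "scaleR (norm a) k = a * k + r * k" using k(3) by (simp add: algebra_simps)
    then have "norm a * M k \<le> M (a * k) + M (r * k)" by (metis MR Madd abs_norm_cancel)
    also have "\<dots> \<le> M a * M k + \<epsilon> * M k"
    proof (intro add_mono)
      have "M r * M k \<le> \<epsilon> * M k" using le[of r] k(2) M0(1)[of k] by (intro mult_right_mono) auto
      then show "M (r * k) \<le> \<epsilon> * M k" using Mmult[of r k] by simp
    qed (rule Mmult)
    finally have "norm a * M k \<le> (M a + \<epsilon>) * M k" by (simp add: distrib_right)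
    moreover have "M k > 0" using M0 k(1) by (metis less_eq_real_def)
    ultimately show "norm (st x * x) \<le> M (st x * x) + \<epsilon>" by (simp add: a_def)
  qed
  then have "(norm x)\<^sup>2 \<le> (M x)\<^sup>2" using Mst[of x] cstar_identity[of x] by simp
  then have "norm x \<le> M x" using M0(1) by (rule power2_le_imp_le)
  then show ?thesis using le[of x] by simp
qed

end

section \<open>Normalizers\<close>

locale abelian_inclusion = cstar sc st
  for sc :: "complex \<Rightarrow> 'a::{banach,real_normed_algebra_1} \<Rightarrow> 'a" and st :: "'a \<Rightarrow> 'a" +
  fixes D :: "'a set"
  assumes csub_D: "csub D" and abelian_D: "abelian D"
begin

abbreviation Nz :: "'a set" where "Nz \<equiv> normalizers st D"
abbreviation B :: "'a set" where "B \<equiv> rel_commutant D"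

lemmas D_intros = csub_intros[OF csub_D]

lemma D_comm: "x \<in> D \<Longrightarrow> y \<in> D \<Longrightarrow> x * y = y * x"
  using abelian_D by (rule abelianD)

lemma D_subset_B: "D \<subseteq> B"
  using D_comm by (auto simp: rel_commutant_def)

lemma csub_B: "csub B"
  by (rule csub_rel_commutant) (rule D_intros)

lemmas B_intros = csub_intros[OF csub_B]

lemma
  assumes "v \<in> Nz"
  shows Nz_D: "d \<in> D \<Longrightarrow> v * d * st v \<in> D"
    and Nz_D': "d \<in> D \<Longrightarrow> st v * d * v \<in> D"
    and Nz_range: "v * st v \<in> D"
    and Nz_source: "st v * v \<in> D"
    and Nz_st: "st v \<in> Nz"
proof -
  show 1: "v * d * st v \<in> D" "st v * d * v \<in> D" if "d \<in> D" for d
    using assms that by (auto simp: normalizers_def)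
  show "v * st v \<in> D" "st v * v \<in> D" using 1[OF D_intros(2)] by simp_all
  show "st v \<in> Nz" using 1 by (auto simp: normalizers_def)
qed

lemma Nz_mult:
  assumes "v \<in> Nz" "w \<in> Nz" shows "v * w \<in> Nz"
  unfolding normalizers_def
proof (intro CollectI ballI conjI)
  fix d assume d: "d \<in> D"
  have "v * (w * d * st w) * st v \<in> D" "st w * (st v * d * v) * w \<in> D"
    using assms d Nz_D Nz_D' by simp_all
  then show "v * w * d * st (v * w) \<in> D" "st (v * w) * d * (v * w) \<in> D"
    by (simp_all add: mult.assoc)
qed

lemma D_subset_Nz: "D \<subseteq> Nz"
  by (auto simp: normalizers_def intro!: D_intros)

text \<open>An abelian C*-algebra has no nonzero nilpotents. In this form: a nonzero
  \<open>h * m\<close> survives multiplication by another \<open>h\<close>.\<close>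

lemma square_zero_D:
  assumes "h \<in> D" "m \<in> D" "h * (h * m) = 0" shows "h * m = 0"
proof -
  have "(h * m) * (h * m) = m * (h * (h * m))" using D_comm[of "h" "m"] assms by (metis mult.assoc)
  then have 0: "(h * m) * (h * m) = 0" using assms by simp
  have "st (h * m) * (h * m) = (h * m) * st (h * m)"
    using assms by (intro D_comm D_intros)
  moreover have "st (st (h * m) * (h * m)) = st (h * m) * (h * m)" by simp
  ultimately have "(st (h * m) * (h * m)) * (st (h * m) * (h * m)) = 0"
    using 0 by (metis mult.assoc mult_zero_right mult_zero_left)
  then show ?thesis using square_eq_0[of "st (h * m) * (h * m)"] by (metis st_mult st_st st_mult_self_eq_0)
qed

text \<open>If \<open>x\<close> does not commute with some \<open>d \<in> D\<close>, then on the support of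
  \<open>x\<^sup>* (d x - x d) \<in> D\<close> the partial homeomorphism induced by \<open>x\<close> moves points.\<close>

lemma commutator_witness:
  assumes x: "x \<in> Nz" and d: "d \<in> D" and "x * d \<noteq> d * x"
  shows "st x * (d * x - x * d) \<noteq> 0"
proof
  define t where "t = d * x - x * d"
  assume "st x * (d * x - x * d) = 0"
  then have 0: "st x * t = 0" by (simp add: t_def)
  have "st t * t = st x * st d * t - st d * (st x * t)"
    by (simp add: t_def algebra_simps)
  then have tt: "st t * t = st x * st d * t" by (simp add: 0)
  have xd: "d * (x * st x) = (x * st x) * d" using Nz_range[OF x] d D_comm by blast
  have dxd: "st (st x * st d * t) * (st x * st d * t) = st t * (d * (x * st x)) * st d * t"
    by (simp add: mult.assoc)
  also have "\<dots> = st t * ((x * st x) * d) * st d * t" by (simp add: xd)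
  also have "\<dots> = st t * ((x * st x) * (d * st d)) * t" by (simp add: mult.assoc)
  also have "(x * st x) * (d * st d) = (d * st d) * (x * st x)"
    using D_comm[OF Nz_range[OF x] D_intros(5)[OF d D_intros(6)[OF d]]] .
  also have "st t * (d * st d * (x * st x)) * t = st t * (d * st d) * x * (st x * t)"
    by (simp add: mult.assoc)
  finally have "st x * st d * t = 0" using 0 by (metis mult_zero_right st_mult_self_eq_0)
  then have "t = 0" using tt by simp
  then show False using assms(3) by (simp add: t_def)
qed

text \<open>Shrink to \<open>h\<close> on which \<open>e = st x * (d * x - x * d)\<close> is nearly
  a scalar \<open>l\<close> and \<open>d\<close> nearly a scalar \<open>c\<close>. Then
  \<open>h * (x * e) * h\<close> is nearly \<open>l w\<close> for \<open>w = h * x * h\<close>. But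
  \<open>x * e\<close> is a commutator with \<open>d\<close>, and \<open>d\<close> has nearly the
  same value on both sides, so that element is also small compared with \<open>w\<close>. Since
  \<open>l\<close> is bounded below, \<open>w = 0\<close> exactly.\<close>

lemma normalizer_displaces:
  assumes x: "x \<in> Nz" and d: "d \<in> D" and g: "g \<in> D"
    and ne: "st x * (d * x - x * d) * g \<noteq> 0"
  shows "\<exists>m\<in>D. g * m \<noteq> 0 \<and> (g * m) * x * (g * m) = 0"
proof -
  define e where "e = st x * (d * x - x * d)"
  have e: "e \<in> D"
  proof -
    have "e = st x * d * x - (st x * x) * d" by (simp add: e_def algebra_simps)
    then show ?thesis using Nz_D'[OF x d] Nz_source[OF x] d by (auto intro: D_intros)
  qed
  obtain s m1 where s: "s \<in> D" "m1 \<in> D" "g * m1 \<noteq> 0" "s * e * (g * m1) = g * m1"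
    using local_inverse[OF csub_D abelian_D e g] ne by (auto simp: e_def)
  have ns: "norm s > 0" using s by auto
  define X where "X = (norm x)\<^sup>2"
  \<comment> \<open>Invertibility of \<open>e\<close> on \<open>h\<close> gives
    \<open>cmod l \<ge> 1 / norm s - \<epsilon>\<close>, which is
    \<open>\<epsilon> * (2 * X + 2)\<close>. The commutator estimate costs
    \<open>\<epsilon> * (2 * X + 1)\<close>, so it is strictly beaten.\<close>
  define \<epsilon> where "\<epsilon> = 1 / (norm s * (2 * X + 3))"
  have X: "X \<ge> 0" by (simp add: X_def)
  have eps: "\<epsilon> > 0" using ns X by (simp add: \<epsilon>_def)
  obtain m2 where m2: "m2 \<in> D" "g * m1 * m2 \<noteq> 0"
    "\<forall>a\<in>{d, e}. \<exists>c. \<exists>r\<in>D. norm r \<le> \<epsilon> \<and> a * (g * m1 * m2) = (sc c 1 + r) * (g * m1 * m2)"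
    using localize_finite[OF csub_D abelian_D eps, of "g * m1" "{d, e}"] g s d e D_intros by auto
  define h where "h = g * m1 * m2"
  have h: "h \<in> D" "h \<noteq> 0" using g s m2 by (auto simp: h_def intro: D_intros)
  obtain c r where r: "r \<in> D" "norm r \<le> \<epsilon>" "d * h = (sc c 1 + r) * h"
    using m2 by (auto simp: h_def)
  obtain l q where q: "q \<in> D" "norm q \<le> \<epsilon>" "e * h = (sc l 1 + q) * h"
    using m2 by (auto simp: h_def)
  have seh: "s * (e * h) = h" using arg_cong[OF s(4), of "\<lambda>z. z * m2"] by (simp add: h_def mult.assoc)
  have "norm h \<le> norm s * ((cmod l + \<epsilon>) * norm h)"
  proof -
    have "norm (sc l 1 + q) \<le> cmod l + \<epsilon>" using norm_triangle_ineq[of "sc l 1" q] q by simp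
    then have "norm (e * h) \<le> (cmod l + \<epsilon>) * norm h" unfolding q(3)
      by (meson norm_mult_ineq mult_right_mono norm_ge_zero order_trans)
    then have "norm s * norm (e * h) \<le> norm s * ((cmod l + \<epsilon>) * norm h)"
      by (intro mult_left_mono) auto
    then show ?thesis using norm_mult_ineq[of s "e * h"] seh by simp
  qed
  then have "1 \<le> norm s * (cmod l + \<epsilon>)" using h by (simp flip: mult.assoc)
  then have l: "cmod l \<ge> 1 / norm s - \<epsilon>" using ns by (simp add: field_simps)
  have "1 / norm s = \<epsilon> * (2 * X + 3)" using ns X by (simp add: \<epsilon>_def)
  then have l: "cmod l \<ge> \<epsilon> * (2 * X + 2)" using l by (simp add: algebra_simps)
  define w where "w = h * x * h"
  have comm: "r * h = h * r" "d * h = h * d" "(st x * x) * h = h * (st x * x)" "q * h = h * q"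
      "(st x * x) * r = r * (st x * x)" "e * h = h * e" "c' \<in> D \<Longrightarrow> c' * h = h * c'" for c'
    using D_comm r q d e h Nz_source[OF x] by auto
  \<comment> \<open>The range element \<open>x * st x\<close> lies in \<open>D\<close> and commutes
    with \<open>d\<close>; this turns \<open>x * e\<close> into the commutator of \<open>d\<close>
    with \<open>p\<close>.\<close>
  define p where "p = x * st x * x"
  have xe: "x * e = d * p - p * d"
  proof -
    have "x * e = (x * st x) * d * x - p * d" by (simp add: e_def p_def algebra_simps)
    moreover have "(x * st x) * d = d * (x * st x)" using D_comm[OF Nz_range[OF x] d] .
    then have "(x * st x) * d * x = d * p" by (metis mult.assoc p_def)
    ultimately show ?thesis by simp
  qed
  have hph: "h * p * h = w * (st x * x)"
    using comm(3) by (simp add: w_def p_def mult.assoc)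
  have "h * (x * e) * h = h * x * ((sc l 1 + q) * h)" using q(3) by (simp add: mult.assoc)
  also have "\<dots> = sc l w + w * q" using comm(4) by (simp add: w_def algebra_simps)
  finally have 1: "h * (x * e) * h = sc l w + w * q" .
  have hd: "h * d = h * (sc c 1 + r)" using r(3) comm by (simp add: algebra_simps)
  have "h * (d * p - p * d) * h = (h * d) * p * h - h * p * (d * h)" by (simp add: algebra_simps)
  also have "\<dots> = h * r * p * h - h * p * r * h" unfolding hd r(3) by (simp add: algebra_simps)
  also have "\<dots> = r * (h * p * h) - (h * p * h) * r"
    using comm(1) by (metis mult.assoc)
  also have "\<dots> = r * w * (st x * x) - w * (st x * x) * r" unfolding hph by (simp add: mult.assoc)
  finally have eq: "sc l w = r * w * (st x * x) - w * (st x * x) * r - w * q"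
    using 1 xe by (simp add: algebra_simps)
  have "cmod l * norm w = norm (sc l w)" by simp
  also have "\<dots> \<le> \<epsilon> * norm w * X + norm w * X * \<epsilon> + norm w * \<epsilon>"
    unfolding eq
  proof (intro norm_triangle_le_diff add_mono)
    have nx: "norm (st x * x) = X" by (simp add: cstar_identity X_def)
    have "norm (r * w * (st x * x)) \<le> norm r * norm w * X"
      using norm_mult_ineq[of "r * w" "st x * x"] norm_mult_ineq[of r w] nx X
      by (smt (verit) mult_right_mono)
    also have "\<dots> \<le> \<epsilon> * norm w * X" using r X by (intro mult_right_mono) auto
    finally show "norm (r * w * (st x * x)) \<le> \<epsilon> * norm w * X" .
    have "norm (w * (st x * x) * r) \<le> norm w * X * norm r"
      using norm_mult_ineq[of "w * (st x * x)" r] norm_mult_ineq[of w "st x * x"] nx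
      by (smt (verit) mult_right_mono norm_ge_zero)
    also have "\<dots> \<le> norm w * X * \<epsilon>" using r X by (intro mult_left_mono) auto
    finally show "norm (w * (st x * x) * r) \<le> norm w * X * \<epsilon>" .
    show "norm (w * q) \<le> norm w * \<epsilon>"
      using q by (meson norm_mult_ineq mult_left_mono norm_ge_zero order_trans)
  qed
  finally have "cmod l * norm w \<le> \<epsilon> * (2 * X + 1) * norm w" by (simp add: algebra_simps)
  moreover have "\<epsilon> * (2 * X + 1) < cmod l" using l eps by (simp add: algebra_simps)
  ultimately have "w = 0"
    by (metis mult_le_cancel_right not_le norm_ge_zero norm_le_zero_iff order_antisym_conv linorder_not_less)
  then show ?thesis using h s m2 by (intro bexI[of _ "m1 * m2"]) (auto simp: h_def w_def mult.assoc intro: D_intros)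
qed

text \<open>If \<open>y * g\<close> is not in \<open>B\<close>, it fails to commute with some
  \<open>d\<close>, and the resulting witness is nonzero on \<open>g\<close>, so the displacement
  lemma applies to \<open>x = y * g\<close>. The self-adjoint \<open>g = h * st h\<close> is used so
  that the witness takes the form \<open>g * e' * g\<close>.\<close>

lemma normalizer_dichotomy:
  assumes y: "y \<in> Nz" and h: "h \<in> D" "h \<noteq> 0"
  shows "\<exists>m\<in>D. h * m \<noteq> 0 \<and> ((h * m) * y * (h * m) = 0 \<or> y * (h * m) \<in> B)"
proof -
  define g where "g = h * st h"
  have g: "g \<in> D" "st g = g" using h by (auto simp: g_def intro: D_intros)
  have g0: "g \<noteq> 0" using h st_mult_self_eq_0[of "st h"] by (simp add: g_def) (metis st_st st_zero)
  show ?thesis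
  proof (cases "y * g \<in> B")
    case True
    then show ?thesis using g0 h by (intro bexI[of _ "st h"]) (auto simp: g_def intro: D_intros)
  next
    case False
    then obtain d where d: "d \<in> D" "y * g * d \<noteq> d * (y * g)" by (auto simp: rel_commutant_def)
    define x where "x = y * g"
    have x: "x \<in> Nz" using Nz_mult y g D_subset_Nz by (auto simp: x_def)
    define e where "e = st x * (d * x - x * d)"
    have e0: "e \<noteq> 0" using commutator_witness[OF x d(1)] d(2) by (simp add: e_def x_def)
    define e' where "e' = st y * d * y - st y * y * d"
    have e': "e' \<in> D" using Nz_D'[OF y d(1)] Nz_source[OF y] d(1) by (auto simp: e'_def intro: D_intros)
    have "e = g * (st y * d * y * g - st y * y * (g * d))"
      by (simp add: e_def x_def g algebra_simps)
    also have "g * d = d * g" using D_comm g d by blast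
    finally have eg: "e = g * e' * g" by (simp add: e'_def algebra_simps)
    have "e * g \<noteq> 0"
    proof
      assume "e * g = 0"
      then have "g * e = 0" using D_comm[of e g] g e' by (simp add: eg D_intros)
      have "st e * e = g * st e' * (g * e)" by (simp add: eg g mult.assoc)
      then have "st e * e = 0" by (simp add: \<open>g * e = 0\<close>)
      then show False using e0 by simp
    qed
    then obtain m where m: "m \<in> D" "g * m \<noteq> 0" "(g * m) * x * (g * m) = 0"
      using normalizer_displaces[OF x d(1) g(1)] by (auto simp: e_def)
    \<comment> \<open>Displacement concerns \<open>x = y * g\<close>, so a second factor
      \<open>g\<close> is needed to reach \<open>y\<close> itself.\<close>
    have gm: "g * (g * m) \<noteq> 0" using square_zero_D g m by blast
    have "(g * (g * m)) * y * (g * (g * m)) = g * ((g * m) * x * (g * m))"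
      by (simp add: x_def mult.assoc)
    then have "(g * (g * m)) * y * (g * (g * m)) = 0" using m by simp
    then show ?thesis using gm m g h
      by (intro bexI[of _ "st h * (g * m)"]) (auto simp: g_def mult.assoc intro!: D_intros)
  qed
qed

text \<open>The factor \<open>b\<close> multiplies \<open>h\<close> itself, and
  \<open>st y * y\<close> is invertible on \<open>h\<close>. Applied to \<open>y = st v * w\<close>,
  this allows \<open>w * h\<close> to be solved for as \<open>v\<close> times an element of
  \<open>B\<close> times \<open>h\<close>. The factor \<open>b\<close> becomes nearly scalar after
  shrinking in \<open>B\<close>.\<close>

definition scalar_on :: "'a \<Rightarrow> 'a \<Rightarrow> bool" where
  "scalar_on y h \<longleftrightarrow> (\<exists>b\<in>B. y * h = b * h) \<and> (\<exists>s\<in>D. s * (st y * y) * h = h)"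

lemma scalar_on_mult: "scalar_on y h \<Longrightarrow> scalar_on y (h * m)"
  unfolding scalar_on_def by (metis mult.assoc)

lemma normalizer_dichotomy_scalar:
  assumes y: "y \<in> Nz" and h: "h \<in> D" "h \<noteq> 0"
  shows "\<exists>m\<in>D. h * m \<noteq> 0 \<and> ((h * m) * y * (h * m) = 0 \<or> scalar_on y (h * m))"
proof -
  obtain m where m: "m \<in> D" "h * m \<noteq> 0" "(h * m) * y * (h * m) = 0 \<or> y * (h * m) \<in> B"
    using normalizer_dichotomy[OF assms] by blast
  define k where "k = h * m"
  have k: "k \<in> D" "k \<noteq> 0" using m h by (auto simp: k_def intro: D_intros)
  show ?thesis
  proof (cases "k * y * k = 0")
    case True
    then show ?thesis using m by (auto simp: k_def)
  next
    case False
    then have yk: "y * k \<in> B" "y * k \<noteq> 0" using m by (auto simp: k_def mult.assoc)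
    have "st k * (st y * y) * k = st (y * k) * (y * k)" by (simp add: mult.assoc)
    then have "st y * y * k \<noteq> 0" using yk(2) by (metis mult.assoc mult_zero_right st_mult_self_eq_0)
    then obtain s m1 where s: "s \<in> D" "m1 \<in> D" "k * m1 \<noteq> 0" "s * (st y * y) * (k * m1) = k * m1"
      using local_inverse[OF csub_D abelian_D Nz_source[OF y] k(1)] by blast
    define k1 where "k1 = k * m1"
    have k1: "k1 \<in> D" using k s by (auto simp: k1_def intro: D_intros)
    have kk1: "k * k1 \<noteq> 0" using square_zero_D[OF k(1) s(2)] s(3) by (auto simp: k1_def)
    \<comment> \<open>So far only \<open>y * k\<close> is known to lie in \<open>B\<close>.
      Inverting \<open>k\<close> on a smaller support moves it to the other side: there
      \<open>y\<close> acts as \<open>y * k * s2\<close>.\<close>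
    obtain s2 m2 where s2: "s2 \<in> D" "m2 \<in> D" "k1 * m2 \<noteq> 0" "s2 * k * (k1 * m2) = k1 * m2"
      using local_inverse[OF csub_D abelian_D k(1) k1 kk1] by blast
    define k2 where "k2 = k * (k1 * m2)"
    have "k2 \<noteq> 0" using s2 by (auto simp: k2_def mult.assoc)
    have "y * k2 = (y * k) * (k1 * m2)" by (simp add: k2_def mult.assoc)
    also have "\<dots> = (y * k) * (s2 * k * (k1 * m2))" by (simp only: s2(4))
    also have "\<dots> = (y * k * s2) * k2" by (simp add: k2_def mult.assoc)
    finally have "y * k2 = (y * k * s2) * k2" .
    moreover have "y * k * s2 \<in> B" using yk s2 D_subset_B by (auto intro: B_intros)
    moreover have "s * (st y * y) * k2 = k2"
    proof -
      have "k2 = k1 * (k * m2)" using D_comm[of k k1] k k1 by (simp add: k2_def flip: mult.assoc)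
      then show ?thesis using arg_cong[OF s(4), of "\<lambda>z. z * (k * m2)"] by (simp add: k1_def mult.assoc)
    qed
    ultimately have "scalar_on y k2" using s unfolding scalar_on_def by blast
    moreover have "k2 = h * (m * (k1 * m2))" by (simp add: k2_def k_def mult.assoc)
    ultimately show ?thesis using \<open>k2 \<noteq> 0\<close> m k1 s2
      by (intro bexI[of _ "m * (k1 * m2)"]) (auto intro!: D_intros)
  qed
qed

lemma normalizer_dichotomy_finite:
  assumes h: "h \<in> D" "h \<noteq> 0"
  shows "finite Y \<Longrightarrow> Y \<subseteq> Nz \<Longrightarrow>
    \<exists>m\<in>D. h * m \<noteq> 0 \<and> (\<forall>y\<in>Y. (h * m) * y * (h * m) = 0 \<or> scalar_on y (h * m))"
proof (induction Y rule: finite_induct)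
  case empty
  then show ?case using h by (intro bexI[of _ 1]) (auto intro: D_intros)
next
  case (insert y Y)
  then obtain m where m: "m \<in> D" "h * m \<noteq> 0"
    "\<And>y. y \<in> Y \<Longrightarrow> (h * m) * y * (h * m) = 0 \<or> scalar_on y (h * m)" by blast
  define k where "k = h * m"
  have k: "k \<in> D" "k \<noteq> 0" using m h by (auto simp: k_def intro: D_intros)
  obtain m' where m': "m' \<in> D" "k * m' \<noteq> 0" "(k * m') * y * (k * m') = 0 \<or> scalar_on y (k * m')"
    using normalizer_dichotomy_scalar[of y, OF _ k] insert.prems by blast
  show ?case
  proof (intro bexI[of _ "m * m'"] conjI ballI)
    show "m * m' \<in> D" "h * (m * m') \<noteq> 0" using m m' by (auto simp: k_def mult.assoc intro: D_intros)
    fix z assume z: "z \<in> insert y Y"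
    have hk: "h * (m * m') = k * m'" by (simp add: k_def mult.assoc)
    show "h * (m * m') * z * (h * (m * m')) = 0 \<or> scalar_on z (h * (m * m'))"
    proof (cases "z = y")
      case True
      then show ?thesis using m' hk by simp
    next
      case False
      then consider "k * z * k = 0" | "scalar_on z k" using z m(3)[of z] by (auto simp: k_def)
      then show ?thesis
      proof cases
        case 1
        have "k * m' * z * (k * m') = m' * (k * z * k) * m'"
          using D_comm[OF k(1) m'(1)] by (simp add: mult.assoc)
        then show ?thesis using 1 hk by simp
      next
        case 2
        then show ?thesis using scalar_on_mult hk by simp
      qed
    qed
  qed
qed

text \<open>A selection in the manner of Gram-Schmidt. For a new \<open>w\<close> apply the
  dichotomy to \<open>st v * w\<close> for all \<open>v\<close> chosen so far. If one of these is
  scalar, \<open>w\<close> is a multiple of \<open>v\<close> on the support; if \<open>w\<close>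
  vanishes there, it is dropped; otherwise \<open>w\<close> is orthogonal to all of them and joins,
  after \<open>st w * w\<close> has been made invertible.\<close>

lemma orthogonal_normalizers:
  assumes h0: "h0 \<in> D" "h0 \<noteq> 0"
  shows "finite F \<Longrightarrow> F \<subseteq> Nz \<Longrightarrow> \<exists>m\<in>D. \<exists>F1\<subseteq>F. h0 * m \<noteq> 0 \<and>
    (\<forall>v\<in>F1. \<forall>w\<in>F1. v \<noteq> w \<longrightarrow> (h0 * m) * (st v * w) * (h0 * m) = 0) \<and>
    (\<forall>v\<in>F1. \<exists>s\<in>D. s * (st v * v) * (h0 * m) = h0 * m) \<and>
    (\<forall>w\<in>F. w * (h0 * m) = 0 \<or> (\<exists>v\<in>F1. \<exists>b\<in>B. w * (h0 * m) = v * b * (h0 * m)))"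
proof (induction F rule: finite_induct)
  case empty
  then show ?case using h0 by (intro bexI[of _ 1]) (auto intro: D_intros)
next
  case (insert w F)
  obtain m F1 where m: "m \<in> D" "h0 * m \<noteq> 0" and F1: "F1 \<subseteq> F"
    and ortho: "\<And>u v. u \<in> F1 \<Longrightarrow> v \<in> F1 \<Longrightarrow> u \<noteq> v \<Longrightarrow> (h0 * m) * (st u * v) * (h0 * m) = 0"
    and inv: "\<And>v. v \<in> F1 \<Longrightarrow> \<exists>s\<in>D. s * (st v * v) * (h0 * m) = h0 * m"
    and red: "\<And>u. u \<in> F \<Longrightarrow> u * (h0 * m) = 0 \<or> (\<exists>v\<in>F1. \<exists>b\<in>B. u * (h0 * m) = v * b * (h0 * m))"
  proof -
    have "F \<subseteq> Nz" using insert.prems by blast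
    from insert.IH[OF this] show ?thesis
      by (elim bexE exE conjE) (rule that; (assumption | (drule bspec; assumption)+ | fast))
  qed
  define h where "h = h0 * m"
  have h: "h \<in> D" "h \<noteq> 0" using h0 m by (auto simp: h_def intro: D_intros)
  have w: "w \<in> Nz" and F1N: "F1 \<subseteq> Nz" using insert.prems F1 by auto
  have finF1: "finite F1" using F1 insert.hyps finite_subset by blast
  define Y where "Y = (\<lambda>v. st v * w) ` F1"
  have Y: "finite Y" "Y \<subseteq> Nz" using finF1 F1N w Nz_mult Nz_st by (auto simp: Y_def)
  obtain m1 where m1: "m1 \<in> D" "h * m1 \<noteq> 0"
    "\<forall>y\<in>Y. (h * m1) * y * (h * m1) = 0 \<or> scalar_on y (h * m1)"
    using normalizer_dichotomy_finite[OF h Y] by blast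
  have ortho': "(h * n) * (st u * v) * (h * n) = 0" if "u \<in> F1" "v \<in> F1" "u \<noteq> v" "n \<in> D" for u v n
  proof -
    have "(h * n) * (st u * v) * (h * n) = n * (h * (st u * v) * h) * n"
      using D_comm[OF h(1) that(4)] by (simp add: mult.assoc)
    then show ?thesis using ortho[OF that(1-3)] by (simp add: h_def)
  qed
  have inv': "\<exists>s\<in>D. s * (st v * v) * (h * n) = h * n" if "v \<in> F1" for v n
    using inv[OF that] by (metis h_def mult.assoc)
  have red': "u * (h * n) = 0 \<or> (\<exists>v\<in>F1. \<exists>b\<in>B. u * (h * n) = v * b * (h * n))" if "u \<in> F" for u n
    using red[OF that] by (metis h_def mult.assoc mult_zero_left)
  have assoc: "h * n = h0 * (m * n)" for n by (simp add: h_def mult.assoc)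
  show ?case
  proof (cases "(\<exists>v\<in>F1. scalar_on (st v * w) (h * m1)) \<or> w * (h * m1) = 0")
    case True
    have "w * (h * m1) = 0 \<or> (\<exists>v\<in>F1. \<exists>b\<in>B. w * (h * m1) = v * b * (h * m1))"
    proof (cases "w * (h * m1) = 0")
      case False
      define k where "k = h * m1"
      have k: "k \<in> D" using h m1 by (auto simp: k_def intro: D_intros)
      obtain v where v: "v \<in> F1" "scalar_on (st v * w) k" using True False by (auto simp: k_def)
      define y where "y = st v * w"
      obtain b s where b: "b \<in> B" "y * k = b * k" and s: "s \<in> D" "s * (st y * y) * k = k"
        using v(2) unfolding scalar_on_def y_def by blast
      have vN: "v \<in> Nz" using v F1N by blast
      have yN: "y \<in> Nz" using vN w Nz_mult Nz_st by (simp add: y_def)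
      define z where "z = st w * w * s"
      have z: "z \<in> D" using Nz_source[OF w] s by (auto simp: z_def intro: D_intros)
      \<comment> \<open>Insert the inverse of \<open>st y * y\<close> for
        \<open>y = st v * w\<close> and exchange \<open>w * st w\<close> with
        \<open>v * st v\<close>, both in \<open>D\<close>. The factor \<open>v\<close> then comes
        out in front and leaves \<open>y\<close>, which acts on \<open>k\<close> as
        \<open>b\<close>.\<close>
      have "w * k = w * ((st y * y) * s) * k"
        using s(2) D_comm[OF s(1) Nz_source[OF yN]] by (simp add: mult.assoc)
      also have "\<dots> = ((w * st w) * (v * st v)) * w * s * k" by (simp add: y_def mult.assoc)
      also have "(w * st w) * (v * st v) = (v * st v) * (w * st w)"
        using Nz_range[OF vN] Nz_range[OF w] by (rule D_comm[rotated])
      also have "(v * st v) * (w * st w) * w * s * k = v * (y * (z * k))"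
        by (simp add: y_def z_def mult.assoc)
      also have "z * k = k * z" using D_comm z k by blast
      also have "y * (k * z) = b * (k * z)" using b(2) by (simp flip: mult.assoc)
      also have "k * z = z * k" using D_comm z k by blast
      finally have "w * k = v * (b * z) * k" by (simp add: mult.assoc)
      moreover have "b * z \<in> B" using b z D_subset_B by (auto intro: B_intros)
      ultimately show ?thesis using v(1) by (auto simp: k_def)
    qed simp
    then show ?thesis using m1 m F1 ortho'[OF _ _ _ m1(1)] inv'[of _ m1] red'[of _ m1]
      unfolding assoc
      by (intro bexI[of _ "m * m1"] exI[of _ F1]) (auto intro: D_intros)
  next
    case False
    define k where "k = h * m1"
    have k: "k \<in> D" using h m1 by (auto simp: k_def intro: D_intros)
    have wk: "w * k \<noteq> 0" using False by (simp add: k_def)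
    have ow: "k * (st v * w) * k = 0" if "v \<in> F1" for v
      using m1(3) that False by (auto simp: Y_def k_def)
    have "st k * (st w * w) * k = st (w * k) * (w * k)" by (simp add: mult.assoc)
    then have "st w * w * k \<noteq> 0" using wk by (metis mult.assoc mult_zero_right st_mult_self_eq_0)
    then obtain s m2 where s: "s \<in> D" "m2 \<in> D" "k * m2 \<noteq> 0" "s * (st w * w) * (k * m2) = k * m2"
      using local_inverse[OF csub_D abelian_D Nz_source[OF w] k(1)] by blast
    \<comment> \<open>Chosen so that \<open>h * n\<close> is the self-adjoint
      \<open>(k * m2) * st (k * m2)\<close>; orthogonality of \<open>v\<close> and \<open>w\<close>
      then passes to the reversed order by taking adjoints.\<close>
    define n where "n = m1 * (m2 * st (k * m2))"
    define g where "g = h * n"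
    have nD: "n \<in> D" using m1 s k by (auto simp: n_def intro!: D_intros)
    have g: "g = (k * m2) * st (k * m2)" by (simp add: g_def n_def k_def mult.assoc)
    then have stg: "st g = g" by simp
    have g0: "g \<noteq> 0"
      using s(3) st_mult_self_eq_0[of "st (k * m2)"] unfolding g by (metis st_st st_zero)
    define a where "a = m2 * st (k * m2)"
    have gka: "g = k * a" and a: "a \<in> D" using s k by (auto simp: g a_def mult.assoc intro!: D_intros)
    have owg: "g * (st v * w) * g = 0" if "v \<in> F1" for v
    proof -
      have "g * (st v * w) * g = a * (k * (st v * w) * k) * a"
        using D_comm[OF k a] by (simp add: gka mult.assoc)
      then show ?thesis using ow[OF that] by simp
    qed
    have owg': "g * (st w * v) * g = 0" if "v \<in> F1" for v
    proof -
      have "g * (st w * v) * g = st (g * (st v * w) * g)" by (simp add: stg mult.assoc)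
      then show ?thesis using owg[OF that] by simp
    qed
    have sw: "s * (st w * w) * g = g"
      using arg_cong[OF s(4), of "\<lambda>z. z * st (k * m2)"] by (simp add: g mult.assoc)
    have "\<exists>v\<in>insert w F1. \<exists>b\<in>B. w * g = v * b * g"
      using csub_one[OF csub_B] by (intro bexI[of _ w] bexI[of _ 1]) auto
    then have "\<forall>u\<in>insert w F. u * g = 0 \<or> (\<exists>v\<in>insert w F1. \<exists>b\<in>B. u * g = v * b * g)"
      using red'[of _ n] by (auto simp: g_def)
    moreover have "\<forall>v\<in>insert w F1. \<forall>u\<in>insert w F1. v \<noteq> u \<longrightarrow> g * (st v * u) * g = 0"
      using owg owg' ortho'[OF _ _ _ nD] by (auto simp: g_def)
    moreover have "\<forall>v\<in>insert w F1. \<exists>s\<in>D. s * (st v * v) * g = g"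
      using inv'[of _ n] sw s(1) by (auto simp: g_def)
    moreover have "g = h0 * (m * n)" by (simp add: g_def assoc)
    ultimately show ?thesis using m nD F1 g0
      by (intro bexI[of _ "m * n"] exI[of _ "insert w F1"]) (auto intro: D_intros)
  qed
qed

end

section \<open>Comparison of columns over the algebra with columns over \<open>D\<close>\<close>

locale masa_inclusion = abelian_inclusion +
  assumes abelian_B: "abelian B"
    and regular: "closure (cspan sc Nz) = UNIV"
    and ideal_meets_D: "\<And>J. closed_ideal sc UNIV J \<Longrightarrow> J \<noteq> {0} \<Longrightarrow> J \<inter> D \<noteq> {0}"
begin

text \<open>The \<open>v * k\<close> act as an orthogonal system that nearly spans all
  \<open>w * k\<close>, and \<open>d v\<close> acts nearly as the identity on \<open>v * k\<close>
  and kills the others. It is \<open>v * (g * g) * st v\<close> divided by the value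
  \<open>l v\<close> of \<open>st v * v\<close>. Since \<open>d v\<close> must lie in
  \<open>D\<close>, \<open>g\<close> is chosen in \<open>D\<close>, before the shrinking in
  \<open>B\<close> that makes the coefficients scalar.\<close>

lemma local_factorization:
  assumes F: "finite F" "F \<subseteq> Nz" and h0: "h0 \<in> D" "h0 \<noteq> 0" and e: "0 < \<epsilon>"
  obtains m k F1 c d where "m \<in> B" "k = h0 * m" "norm k = 1" "F1 \<subseteq> F"
    "\<And>v w. v \<in> F1 \<Longrightarrow> w \<in> F1 \<Longrightarrow> v \<noteq> w \<Longrightarrow> st (v * k) * (w * k) = 0"
    "\<And>w. w \<in> F \<Longrightarrow> norm (w * k - (\<Sum>v\<in>F1. sc (c w v) (v * k))) \<le> \<epsilon>"
    "\<And>v. v \<in> F1 \<Longrightarrow> d v \<in> D" "\<And>v. v \<in> F1 \<Longrightarrow> norm (d v) \<le> 1 + \<epsilon>"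
    "\<And>v w. v \<in> F1 \<Longrightarrow> w \<in> F1 \<Longrightarrow> v \<noteq> w \<Longrightarrow> st (d v) * d w = 0"
    "\<And>v w. v \<in> F1 \<Longrightarrow> w \<in> F1 \<Longrightarrow> v \<noteq> w \<Longrightarrow> d v * (w * k) = 0"
    "\<And>v w. v \<in> F1 \<Longrightarrow> w \<in> F \<Longrightarrow> cmod (c w v) * norm (d v * (v * k) - v * k) \<le> \<epsilon>"
proof -
  obtain m0 F1 where m0: "m0 \<in> D" "h0 * m0 \<noteq> 0" and F1: "F1 \<subseteq> F"
    and ortho0: "\<forall>v\<in>F1. \<forall>w\<in>F1. v \<noteq> w \<longrightarrow> (h0 * m0) * (st v * w) * (h0 * m0) = 0"
    and inv0: "\<forall>v\<in>F1. \<exists>s\<in>D. s * (st v * v) * (h0 * m0) = h0 * m0"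
    and red0: "\<forall>w\<in>F. w * (h0 * m0) = 0 \<or> (\<exists>v\<in>F1. \<exists>b\<in>B. w * (h0 * m0) = v * b * (h0 * m0))"
    using orthogonal_normalizers[OF h0 F] by blast
  define h where "h = h0 * m0"
  have h: "h \<in> D" "h \<noteq> 0" using m0 h0 by (auto simp: h_def intro: D_intros)
  have finF1: "finite F1" using F1 F finite_subset by blast
  have F1N: "v \<in> Nz" if "v \<in> F1" for v using that F1 F by blast
  have "\<exists>b. (\<forall>v\<in>F1. b v \<in> B) \<and> w * h = (\<Sum>v\<in>F1. v * b v) * h" if w: "w \<in> F" for w
  proof -
    consider "w * h = 0" | v b where "v \<in> F1" "b \<in> B" "w * h = v * b * h"
      using red0[folded h_def] w by blast
    then show ?thesis
    proof cases
      case 1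
      then show ?thesis by (intro exI[of _ "\<lambda>_. 0"]) (auto intro: B_intros)
    next
      case 2
      then have "(\<Sum>u\<in>F1. u * (if u = v then b else 0)) = v * b"
        using finF1 by (simp add: if_distrib sum.delta cong: if_cong)
      then show ?thesis using 2
        by (intro exI[of _ "\<lambda>u. if u = v then b else 0"]) (auto intro: B_intros)
    qed
  qed
  then obtain \<beta> where \<beta>: "\<And>w v. w \<in> F \<Longrightarrow> v \<in> F1 \<Longrightarrow> \<beta> w v \<in> B"
    "\<And>w. w \<in> F \<Longrightarrow> w * h = (\<Sum>v\<in>F1. v * \<beta> w v) * h" by metis
  obtain s where s: "\<And>v. v \<in> F1 \<Longrightarrow> s v \<in> D" "\<And>v. v \<in> F1 \<Longrightarrow> s v * (st v * v) * h = h"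
    using inv0 unfolding h_def by metis
  \<comment> \<open>The leading 1 is slack: coefficients in \<open>B\<close> have norm at most
    \<open>M - 1\<close>, so their approximate values satisfy
    \<open>cmod (c w v) \<le> M - 1 + \<epsilon>1 \<le> M\<close>.\<close>
  define M where "M = 1 + (\<Sum>v\<in>F1. norm v + norm (s v) + (\<Sum>w\<in>F. norm (\<beta> w v)))"
  have Mb: "norm v + norm (s v) + (\<Sum>w\<in>F. norm (\<beta> w v)) \<le> M - 1" if "v \<in> F1" for v
    unfolding M_def using finF1 that
    by (simp add: member_le_sum[of v F1 "\<lambda>v. norm v + norm (s v) + (\<Sum>w\<in>F. norm (\<beta> w v))"]
        sum_nonneg)
  have M1: "1 \<le> M" unfolding M_def by (simp add: sum_nonneg)
  have Mv: "norm v \<le> M" and Ms: "norm (s v) \<le> M" if "v \<in> F1" for v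
    using Mb[OF that] sum_nonneg[of F "\<lambda>w. norm (\<beta> w v)"]
    by (smt (verit) norm_ge_zero)+
  have Mbeta: "norm (\<beta> w v) \<le> M - 1" if "v \<in> F1" "w \<in> F" for v w
    using Mb[OF that(1)] member_le_sum[of w F "\<lambda>w. norm (\<beta> w v)"] that F
    by (smt (verit) norm_ge_zero)
  \<comment> \<open>The sum over \<open>F1\<close> costs \<open>card F1 * M * \<epsilon>1\<close>,
    and the estimate for \<open>d v\<close> costs
    \<open>(2 * M ^ 3 + 3 * M ^ 2) * \<epsilon>1\<close>; both fit under this denominator.\<close>
  define \<epsilon>1 where "\<epsilon>1 = min \<epsilon> 1 / (real (card F1 + 1) * (10 * M ^ 3))"
  have M3: "1 \<le> M ^ 3" "M \<le> M ^ 3" using M1 by (simp_all add: power_increasing[of 1 3 M, simplified])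
  have den: "real (card F1 + 1) * (10 * M ^ 3) > 0" using M1 by simp
  have e1: "\<epsilon>1 > 0" using e den by (simp add: \<epsilon>1_def)
  have e1_mult: "x * \<epsilon>1 \<le> min \<epsilon> 1" if "x \<le> real (card F1 + 1) * (10 * M ^ 3)" for x
  proof -
    have "x * \<epsilon>1 \<le> real (card F1 + 1) * (10 * M ^ 3) * \<epsilon>1"
      using that e1 by (intro mult_right_mono) auto
    also have "\<dots> = min \<epsilon> 1" using den unfolding \<epsilon>1_def by (metis nonzero_mult_div_cancel_left times_divide_eq_right less_irrefl)
    finally show ?thesis .
  qed
  have e1_M: "x * \<epsilon>1 \<le> min \<epsilon> 1" if "x \<le> 10 * M ^ 3" for x
  proof (rule e1_mult)
    have "1 * (10 * M ^ 3) \<le> real (card F1 + 1) * (10 * M ^ 3)"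
      using M1 by (intro mult_right_mono) auto
    then show "x \<le> real (card F1 + 1) * (10 * M ^ 3)" using that by simp
  qed
  obtain m1 where m1: "m1 \<in> D" "h * m1 \<noteq> 0"
    "\<forall>a\<in>(\<lambda>v. st v * v) ` F1. \<exists>c. \<exists>r\<in>D. norm r \<le> \<epsilon>1 \<and> a * (h * m1) = (sc c 1 + r) * (h * m1)"
    using localize_finite[OF csub_D abelian_D e1 h, of "(\<lambda>v. st v * v) ` F1"] finF1 F1N Nz_source
    by blast
  obtain l r where lr: "\<And>v. v \<in> F1 \<Longrightarrow> r v \<in> D" "\<And>v. v \<in> F1 \<Longrightarrow> norm (r v) \<le> \<epsilon>1"
    "\<And>v. v \<in> F1 \<Longrightarrow> st v * v * (h * m1) = (sc (l v) 1 + r v) * (h * m1)"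
    using m1(3) by (auto simp: ball_simps) metis
  \<comment> \<open>Made positive and of norm one, so that \<open>top_localization\<close> provides
    a place where \<open>g\<close> is nearly 1.\<close>
  define g0 where "g0 = (h * m1) * st (h * m1)"
  define g where "g = scaleR (1 / norm g0) g0"
  define gm where "gm = scaleR (1 / norm g0) (m1 * st (h * m1))"
  have g0: "g0 \<noteq> 0" using m1(2) st_mult_self_eq_0[of "st (h * m1)"] unfolding g0_def
    by (metis st_st st_zero)
  have ggm: "g = h * gm" by (simp add: g_def g0_def gm_def mult.assoc)
  have gmD: "gm \<in> D" using h m1 by (auto simp: gm_def intro!: D_intros)
  have gD: "g \<in> D" using h gmD by (auto simp: ggm intro: D_intros)
  have posg: "pos g" using pos_st_mult_self[of "st (h * m1)"]
    unfolding g_def g0_def by (intro pos_scaleR) (auto simp del: st_mult)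
  have stg: "st g = g" using posg pos_st by blast
  have ng: "norm g = 1" using g0 by (simp add: g_def)
  have ortho: "g * (st v * w) * g = 0" if "v \<in> F1" "w \<in> F1" "v \<noteq> w" for v w
  proof -
    have "g * (st v * w) * g = gm * (h * (st v * w) * h) * gm"
      using D_comm[OF h(1) gmD] by (simp add: ggm mult.assoc)
    then show ?thesis using ortho0 that by (simp add: h_def)
  qed
  have lrg: "st v * v * g = (sc (l v) 1 + r v) * g" if "v \<in> F1" for v
    using arg_cong[OF lr(3)[OF that], of "\<lambda>z. scaleR (1 / norm g0) (z * st (h * m1))"]
    by (simp add: g_def g0_def mult.assoc)
  have sg: "s v * (st v * v) * g = g" if "v \<in> F1" for v
    using arg_cong[OF s(2)[OF that], of "\<lambda>z. z * gm"] by (simp add: ggm mult.assoc)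
  \<comment> \<open>The inverse \<open>s v\<close> of \<open>st v * v\<close> on \<open>g\<close>
    has norm at most \<open>M\<close>, which keeps the approximate value \<open>l v\<close> away
    from zero.\<close>
  have linv: "l v \<noteq> 0" "1 / cmod (l v) \<le> 2 * M" if v: "v \<in> F1" for v
  proof -
    have "g = s v * ((sc (l v) 1 + r v) * g)" using sg[OF v] lrg[OF v] by (simp add: mult.assoc)
    then have "1 \<le> norm (s v) * (norm (sc (l v) 1 + r v) * norm g)"
      using ng norm_mult_ineq[of "s v" "(sc (l v) 1 + r v) * g"]
        mult_left_mono[OF norm_mult_ineq[of "sc (l v) 1 + r v" g], of "norm (s v)"] by simp
    also have "\<dots> \<le> M * (cmod (l v) + \<epsilon>1)"
      using norm_triangle_ineq[of "sc (l v) 1" "r v"] lr(2)[OF v] Ms[OF v] M1 ng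
      by (intro mult_mono) auto
    finally have 1: "1 \<le> M * cmod (l v) + M * \<epsilon>1" by (simp add: distrib_left)
    have "2 * M * \<epsilon>1 \<le> min \<epsilon> 1" by (rule e1_M) (use M3 M1 in simp)
    then have 2: "1 \<le> 2 * M * cmod (l v)" using 1 by simp
    then show "l v \<noteq> 0" by auto
    then show "1 / cmod (l v) \<le> 2 * M" using 2 by (simp add: field_simps)
  qed
  obtain k0 r0 where k0: "k0 \<noteq> 0" "gen g k0" "gen g r0" "norm r0 \<le> \<epsilon>1"
    "g * k0 = (1 - r0) * k0"
    using top_localization[OF posg e1] ng by auto
  have k0D: "k0 \<in> D" "r0 \<in> D" using k0 gD csub_D genD by blast+
  define k1 where "k1 = g * k0"
  have k1: "k1 \<in> D" using gD k0D by (auto simp: k1_def intro: D_intros)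
  have "k1 \<noteq> 0"
  proof
    assume "k1 = 0"
    then have "k0 = r0 * k0" using k0(5) by (simp add: k1_def algebra_simps)
    then have "norm k0 \<le> \<epsilon>1 * norm k0"
      using norm_mult_ineq[of r0 k0] mult_right_mono[OF k0(4), of "norm k0"] by simp
    moreover have "2 * \<epsilon>1 \<le> min \<epsilon> 1" by (rule e1_M) (use M3 in simp)
    ultimately show False using k0(1) by (simp add: mult_le_cancel_right)
  qed
  have gr0: "g * (1 - r0) = (1 - r0) * g"
    using D_comm[OF gD k0D(2)] by (simp add: left_diff_distrib right_diff_distrib)
  have "g * k1 = (g * (1 - r0)) * k0" by (simp add: k1_def k0(5) mult.assoc)
  then have gk1: "g * k1 = (1 - r0) * k1" unfolding gr0 by (simp add: k1_def mult.assoc)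
  have finE: "finite ((\<lambda>(w, v). \<beta> w v) ` (F \<times> F1))" "(\<lambda>(w, v). \<beta> w v) ` (F \<times> F1) \<subseteq> B"
    using F finF1 \<beta> by auto
  have k1B: "k1 \<in> B" using k1 D_subset_B by blast
  \<comment> \<open>From here the support leaves \<open>D\<close>: only in \<open>B\<close> can the
    coefficients \<open>\<beta> w v\<close> be made nearly scalar. The multipliers
    \<open>d v\<close> use \<open>g\<close> alone and are unaffected.\<close>
  obtain m2 where m2: "m2 \<in> B" "k1 * m2 \<noteq> 0"
    "\<forall>a\<in>(\<lambda>(w, v). \<beta> w v) ` (F \<times> F1).
      \<exists>c. \<exists>r\<in>B. norm r \<le> \<epsilon>1 \<and> a * (k1 * m2) = (sc c 1 + r) * (k1 * m2)"
    using localize_finite[OF csub_B abelian_B e1 k1B \<open>k1 \<noteq> 0\<close> finE] by blast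
  have "\<forall>w v. \<exists>c r. w \<in> F \<longrightarrow> v \<in> F1 \<longrightarrow> norm r \<le> \<epsilon>1 \<and>
      \<beta> w v * (k1 * m2) = (sc c 1 + r) * (k1 * m2)"
    using m2(3) by fastforce
  then obtain c q where cq: "\<And>w v. w \<in> F \<Longrightarrow> v \<in> F1 \<Longrightarrow> norm (q w v) \<le> \<epsilon>1"
      "\<And>w v. w \<in> F \<Longrightarrow> v \<in> F1 \<Longrightarrow> \<beta> w v * (k1 * m2) = (sc (c w v) 1 + q w v) * (k1 * m2)"
    by metis
  define \<nu> where "\<nu> = 1 / norm (k1 * m2)"
  define k where "k = scaleR \<nu> (k1 * m2)"
  have nk: "norm k = 1" using m2 by (simp add: k_def \<nu>_def)
  define km where "km = scaleR \<nu> (k0 * m2)"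
  have kgm: "k = g * km" by (simp add: k_def km_def k1_def mult.assoc)
  have k_h0: "k = h0 * (m0 * gm * km)" by (simp add: kgm ggm h_def mult.assoc)
  have mB: "m0 * gm * km \<in> B" using m0 gmD k0D m2 D_subset_B
    by (auto simp: km_def intro!: B_intros)
  have gk: "g * k = (1 - r0) * k"
    using arg_cong[OF gk1, of "\<lambda>z. scaleR \<nu> (z * m2)"] by (simp add: k_def mult.assoc)
  have bk: "\<beta> w v * k = (sc (c w v) 1 + q w v) * k" if "w \<in> F" "v \<in> F1" for w v
    using arg_cong[OF cq(2)[OF that], of "\<lambda>z. scaleR \<nu> z"] by (simp add: k_def)
  have lrk: "st v * v * k = (sc (l v) 1 + r v) * k" if "v \<in> F1" for v
    using arg_cong[OF lrg[OF that], of "\<lambda>z. z * km"] by (simp add: kgm mult.assoc)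
  have wk: "w * k = (\<Sum>v\<in>F1. v * \<beta> w v) * k" if "w \<in> F" for w
    using arg_cong[OF \<beta>(2)[OF that], of "\<lambda>z. z * (gm * km)"] by (simp add: kgm ggm mult.assoc)
  \<comment> \<open>On \<open>v * k\<close> this is nearly \<open>v * (g * g) * k\<close>, as
    \<open>st v * v\<close> is nearly \<open>l v\<close> there, and so nearly \<open>v * k\<close>,
    as \<open>g\<close> is nearly 1 on \<open>k\<close>.\<close>
  define d where "d v = sc (1 / l v) (v * (g * g) * st v)" for v
  have dD: "d v \<in> D" if "v \<in> F1" for v
    unfolding d_def using Nz_D[OF F1N[OF that], of "g * g"] gD by (auto intro: D_intros)
  have nd: "norm (d v) \<le> 1 + \<epsilon>" if v: "v \<in> F1" for v
  proof -
    have "norm (v * (g * g) * st v) = norm (st (g * st v) * (g * st v))"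
      by (simp add: stg mult.assoc)
    also have "\<dots> = (norm (st (g * st v)))\<^sup>2" by (simp only: cstar_identity norm_st)
    also have "\<dots> = norm (st (v * g) * (v * g))" unfolding cstar_identity by (simp add: stg)
    also have "\<dots> = norm (g * ((sc (l v) 1 + r v) * g))" using lrg[OF v] by (simp add: stg mult.assoc)
    also have "\<dots> \<le> norm g * (norm (sc (l v) 1 + r v) * norm g)"
      by (meson norm_mult_ineq mult_left_mono norm_ge_zero order_trans)
    also have "\<dots> \<le> cmod (l v) + \<epsilon>1"
      using norm_triangle_ineq[of "sc (l v) 1" "r v"] lr(2)[OF v] ng by simp
    finally have "norm (d v) \<le> 1 / cmod (l v) * (cmod (l v) + \<epsilon>1)"
      unfolding d_def norm_sc by (simp add: norm_divide divide_right_mono)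
    also have "\<dots> = 1 + 1 / cmod (l v) * \<epsilon>1" using linv(1)[OF v] by (simp add: field_simps)
    also have "\<dots> \<le> 1 + 2 * M * \<epsilon>1" using linv(2)[OF v] e1 by (intro add_left_mono mult_right_mono) auto
    also have "2 * M * \<epsilon>1 \<le> min \<epsilon> 1" by (rule e1_M) (use M3 M1 in simp)
    finally show ?thesis by simp
  qed
  have dd: "st (d v) * d w = 0" if "v \<in> F1" "w \<in> F1" "v \<noteq> w" for v w
  proof -
    have "st (d v) * d w = sc (1 / l w * cnj (1 / l v)) (v * g * (g * (st v * w) * g) * g * st w)"
      by (simp add: d_def stg mult.assoc)
    then show ?thesis using ortho[OF that] by simp
  qed
  have dwk: "d v * (w * k) = 0" if "v \<in> F1" "w \<in> F1" "v \<noteq> w" for v w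
  proof -
    have "d v * (w * k) = sc (1 / l v) (v * g * (g * (st v * w) * g) * km)"
      by (simp add: d_def kgm mult.assoc)
    then show ?thesis using ortho[OF that] by simp
  qed
  have vwk: "st (v * k) * (w * k) = 0" if "v \<in> F1" "w \<in> F1" "v \<noteq> w" for v w
  proof -
    have "st (v * k) * (w * k) = st km * (g * (st v * w) * g) * km"
      by (simp add: kgm stg mult.assoc)
    then show ?thesis using ortho[OF that] by simp
  qed
  have approx: "norm (w * k - (\<Sum>v\<in>F1. sc (c w v) (v * k))) \<le> \<epsilon>" if w: "w \<in> F" for w
  proof -
    have "v * \<beta> w v * k = sc (c w v) (v * k) + v * q w v * k" if "v \<in> F1" for v
      using bk[OF w that] by (simp add: mult.assoc algebra_simps)
    then have "w * k - (\<Sum>v\<in>F1. sc (c w v) (v * k)) = (\<Sum>v\<in>F1. v * q w v * k)"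
      unfolding wk[OF w] by (simp add: sum_distrib_right sum.distrib)
    also have "norm \<dots> \<le> (\<Sum>v\<in>F1. M * \<epsilon>1)"
    proof (rule sum_norm_le)
      fix v assume v: "v \<in> F1"
      have "norm (v * q w v * k) \<le> norm v * norm (q w v) * norm k"
        by (meson norm_mult_ineq mult_right_mono norm_ge_zero order_trans)
      also have "\<dots> \<le> M * \<epsilon>1" unfolding nk using Mv[OF v] cq(1)[OF w v] M1 by (auto intro!: mult_mono)
      finally show "norm (v * q w v * k) \<le> M * \<epsilon>1" .
    qed
    also have "\<dots> = (real (card F1) * M) * \<epsilon>1" by simp
    also have "\<dots> \<le> min \<epsilon> 1"
      using M3 M1 by (intro e1_mult mult_mono) auto
    finally show ?thesis by simp
  qed
  have dvk: "cmod (c w v) * norm (d v * (v * k) - v * k) \<le> \<epsilon>" if v: "v \<in> F1" and w: "w \<in> F" for v w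
  proof -
    have "sc (c w v) k = \<beta> w v * k - q w v * k" using bk[OF w v] by (simp add: algebra_simps)
    then have "norm (sc (c w v) k) \<le> norm (\<beta> w v * k) + norm (q w v * k)"
      by (metis norm_triangle_ineq4)
    also have "\<dots> \<le> (M - 1) + \<epsilon>1"
      using norm_mult_ineq[of "\<beta> w v" k] norm_mult_ineq[of "q w v" k] Mbeta[OF v w] cq(1)[OF w v] nk
      by simp
    finally have "cmod (c w v) \<le> M - 1 + \<epsilon>1" using nk by simp
    moreover have "1 * \<epsilon>1 \<le> min \<epsilon> 1" by (rule e1_M) (use M3 in simp)
    ultimately have cM: "cmod (c w v) \<le> M" by simp
    have le1: "\<epsilon>1 \<le> 1" using \<open>1 * \<epsilon>1 \<le> min \<epsilon> 1\<close> by simp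
    have "g * g * k = (g * (1 - r0)) * k" by (simp add: gk mult.assoc)
    then have "g * g * k = (1 - r0) * (g * k)" unfolding gr0 by (simp add: mult.assoc)
    then have ggk: "g * g * k = k - (r0 * k + r0 * k - r0 * (r0 * k))"
      by (simp add: gk algebra_simps)
    have "d v * (v * k) = sc (1 / l v) (v * (g * g) * (st v * v * k))"
      by (simp add: d_def mult.assoc)
    also have "\<dots> = v * (g * g * k) + sc (1 / l v) (v * (g * g) * (r v * k))"
      unfolding lrk[OF v] using linv(1)[OF v] by (simp add: algebra_simps sc_add_right mult.assoc)
    finally have "d v * (v * k) - v * k =
        sc (1 / l v) (v * (g * g) * (r v * k)) - v * (r0 * k + r0 * k - r0 * (r0 * k))"
      unfolding ggk by (simp add: algebra_simps)
    also have "norm \<dots> \<le> 2 * M * (M * \<epsilon>1) + M * (3 * \<epsilon>1)"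
    proof (intro norm_triangle_le_diff add_mono)
      have "norm (v * (g * g) * (r v * k)) \<le> norm v * norm (g * g) * (norm (r v) * norm k)"
        by (meson norm_mult_ineq mult_mono norm_ge_zero mult_nonneg_nonneg order_trans)
      also have "\<dots> \<le> M * 1 * (\<epsilon>1 * 1)"
        using Mv[OF v] lr(2)[OF v] nk ng norm_mult_ineq[of g g] M1 e1 by (intro mult_mono) auto
      finally have "norm (v * (g * g) * (r v * k)) \<le> M * \<epsilon>1" by simp
      moreover have "norm (sc (1 / l v) (v * (g * g) * (r v * k)))
          = 1 / cmod (l v) * norm (v * (g * g) * (r v * k))" by (simp add: norm_divide)
      ultimately show "norm (sc (1 / l v) (v * (g * g) * (r v * k))) \<le> 2 * M * (M * \<epsilon>1)"
        using linv(2)[OF v] M1 by (simp only:) (intro mult_mono, auto)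
      have r0k: "norm (r0 * k) \<le> \<epsilon>1" using norm_mult_ineq[of r0 k] k0(4) nk by simp
      have "norm (r0 * (r0 * k)) \<le> norm r0 * norm (r0 * k)" by (rule norm_mult_ineq)
      also have "\<dots> \<le> 1 * \<epsilon>1" using r0k k0(4) le1 by (intro mult_mono) auto
      finally have "norm (r0 * k + r0 * k - r0 * (r0 * k)) \<le> 3 * \<epsilon>1"
        using norm_triangle_ineq4[of "r0 * k + r0 * k" "r0 * (r0 * k)"]
          norm_triangle_ineq[of "r0 * k" "r0 * k"] r0k by simp
      then show "norm (v * (r0 * k + r0 * k - r0 * (r0 * k))) \<le> M * (3 * \<epsilon>1)"
        using norm_mult_ineq[of v "r0 * k + r0 * k - r0 * (r0 * k)"] Mv[OF v] M1
        by (meson mult_mono norm_ge_zero order_trans)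
    qed
    finally have "cmod (c w v) * norm (d v * (v * k) - v * k)
        \<le> M * (2 * M * (M * \<epsilon>1) + M * (3 * \<epsilon>1))"
      using cM M1 by (intro mult_mono) auto
    also have "\<dots> = (2 * M ^ 3 + 3 * M ^ 2) * \<epsilon>1"
      by (simp add: algebra_simps power2_eq_square power3_eq_cube)
    also have "\<dots> \<le> min \<epsilon> 1"
    proof (rule e1_M)
      have "M ^ 2 \<le> M ^ 3" using M1 by (intro power_increasing) auto
      then show "2 * M ^ 3 + 3 * M ^ 2 \<le> 10 * M ^ 3" using M3 by simp
    qed
    finally show ?thesis by simp
  qed
  show ?thesis
    using that[OF mB k_h0 nk F1 vwk approx dD nd dd dwk dvk] by blast
qed

lemma normalizer_approximation:
  assumes "finite T" "0 < \<epsilon>"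
  shows "\<exists>F C. finite F \<and> F \<subseteq> Nz \<and> (\<forall>x\<in>T. norm (x - (\<Sum>w\<in>F. sc (C x w) w)) \<le> \<epsilon>)"
proof -
  have "\<exists>F c. finite F \<and> F \<subseteq> Nz \<and> norm (x - (\<Sum>w\<in>F. sc (c w) w)) \<le> \<epsilon>" for x
  proof -
    have "x \<in> closure (cspan sc Nz)" using regular by simp
    then obtain y where y: "y \<in> cspan sc Nz" "dist y x < \<epsilon>"
      using assms closure_approachable by blast
    then obtain F c where "finite F" "F \<subseteq> Nz" "y = (\<Sum>w\<in>F. sc (c w) w)"
      by (auto simp: cspan_def)
    then show ?thesis using y(2) by (intro exI[of _ F] exI[of _ c]) (simp add: dist_norm norm_minus_commute)
  qed
  then obtain G c where G: "\<And>x. finite (G x)" "\<And>x. G x \<subseteq> Nz"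
    "\<And>x. norm (x - (\<Sum>w\<in>G x. sc (c x w) w)) \<le> \<epsilon>" by metis
  define F where "F = (\<Union>x\<in>T. G x)"
  define C where "C x w = (if w \<in> G x then c x w else 0)" for x w
  have F: "finite F" "F \<subseteq> Nz" using assms G by (auto simp: F_def)
  have "(\<Sum>w\<in>F. sc (C x w) w) = (\<Sum>w\<in>G x. sc (c x w) w)" if "x \<in> T" for x
    using that F by (intro sum.mono_neutral_cong_right) (auto simp: F_def C_def)
  then show ?thesis using F G(3) by (intro exI[of _ F] exI[of _ C]) auto
qed

text \<open>\<open>U\<close> plays the role of a locally cyclic vector for \<open>D\<close>; \<open>k\<close> does not depend on \<open>W\<close>.\<close>

lemma column_factorization:
  fixes J :: "'j set"
  assumes T: "finite T" and J: "finite J" and h0: "h0 \<in> D" "h0 \<noteq> 0" and e: "0 < \<epsilon>"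
  obtains m k where "m \<in> B" "k = h0 * m" "norm k = 1"
    "\<And>W :: 'j \<Rightarrow> 'a. (\<And>j. j \<in> J \<Longrightarrow> W j \<in> T) \<Longrightarrow> \<exists>K V U. (\<forall>j\<in>J. K j \<in> D) \<and>
      norm (\<Sum>j\<in>J. st (K j) * K j) \<le> (1 + \<epsilon>)\<^sup>2 \<and>
      (\<forall>j\<in>J. norm (W j * k - V j) \<le> \<epsilon> \<and> norm (K j * U - V j) \<le> \<epsilon>) \<and>
      (\<Sum>j\<in>J. st (V j) * V j) = st U * U"
proof -
  obtain F C where F: "finite F" "F \<subseteq> Nz"
    and C: "\<And>x. x \<in> T \<Longrightarrow> norm (x - (\<Sum>w\<in>F. sc (C x w) w)) \<le> \<epsilon> / 2"
    using normalizer_approximation[OF T, of "\<epsilon> / 2"] e by auto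
  define S where "S = 1 + (\<Sum>x\<in>T. \<Sum>w\<in>F. cmod (C x w))"
  have S: "(\<Sum>w\<in>F. cmod (C x w)) \<le> S" if "x \<in> T" for x
    using member_le_sum[of x T "\<lambda>x. \<Sum>w\<in>F. cmod (C x w)"] that T
    by (simp add: S_def sum_nonneg)
  have S1: "1 \<le> S" by (simp add: S_def sum_nonneg)
  \<comment> \<open>Summing errors \<open>\<delta>\<close> over \<open>F1\<close> with coefficient
    sums at most \<open>S\<close> costs at most \<open>\<epsilon> / 2\<close>. The other half is
    spent on approximating the \<open>W j\<close> by normalizers.\<close>
  define \<delta> where "\<delta> = \<epsilon> / (2 * S * (real (card F) + 1))"
  have den: "1 * 1 \<le> S * (real (card F) + 1)" using S1 by (intro mult_mono) auto
  have d: "0 < \<delta>" using e den by (simp add: \<delta>_def)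
  have d2: "S * (real (card F) + 1) * \<delta> = \<epsilon> / 2"
  proof -
    have "\<delta> = \<epsilon> / 2 / (S * (real (card F) + 1))" by (simp add: \<delta>_def mult.assoc)
    moreover have "S * (real (card F) + 1) \<noteq> 0" using den by linarith
    ultimately show ?thesis by (metis nonzero_mult_div_cancel_left times_divide_eq_right)
  qed
  have "1 * \<delta> \<le> S * (real (card F) + 1) * \<delta>" using den d by (intro mult_right_mono) auto
  then have de: "\<delta> \<le> \<epsilon>" using d2 e by simp
  obtain m k F1 c dd where m: "m \<in> B" "k = h0 * m" and nk: "norm k = 1" and F1: "F1 \<subseteq> F"
    and ortho: "\<And>v w. v \<in> F1 \<Longrightarrow> w \<in> F1 \<Longrightarrow> v \<noteq> w \<Longrightarrow> st (v * k) * (w * k) = 0"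
    and approx: "\<And>w. w \<in> F \<Longrightarrow> norm (w * k - (\<Sum>v\<in>F1. sc (c w v) (v * k))) \<le> \<delta>"
    and dD: "\<And>v. v \<in> F1 \<Longrightarrow> dd v \<in> D" and nd: "\<And>v. v \<in> F1 \<Longrightarrow> norm (dd v) \<le> 1 + \<delta>"
    and dortho: "\<And>v w. v \<in> F1 \<Longrightarrow> w \<in> F1 \<Longrightarrow> v \<noteq> w \<Longrightarrow> st (dd v) * dd w = 0"
    and dw: "\<And>v w. v \<in> F1 \<Longrightarrow> w \<in> F1 \<Longrightarrow> v \<noteq> w \<Longrightarrow> dd v * (w * k) = 0"
    and dv: "\<And>v w. v \<in> F1 \<Longrightarrow> w \<in> F \<Longrightarrow> cmod (c w v) * norm (dd v * (v * k) - v * k) \<le> \<delta>"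
  proof (rule local_factorization[OF F h0 d], goal_cases)
    case (1 m k F1 c dd)
    show ?case by (rule 1(1)[OF 1(2-)])
  qed
  have finF1: "finite F1" using F1 F finite_subset by blast
  have "\<exists>K V U. (\<forall>j\<in>J. K j \<in> D) \<and>
      norm (\<Sum>j\<in>J. st (K j) * K j) \<le> (1 + \<epsilon>)\<^sup>2 \<and>
      (\<forall>j\<in>J. norm (W j * k - V j) \<le> \<epsilon> \<and> norm (K j * U - V j) \<le> \<epsilon>) \<and>
      (\<Sum>j\<in>J. st (V j) * V j) = st U * U" if W: "\<And>j. j \<in> J \<Longrightarrow> W j \<in> T" for W :: "'j \<Rightarrow> 'a"
  proof -
    \<comment> \<open>The number \<open>\<gamma> j v\<close> is the coefficient of
      \<open>W j * k\<close> along \<open>v * k\<close>, and \<open>\<rho> v\<close> is the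
      Euclidean length of these coefficients over \<open>j\<close>. With \<open>\<rho>\<close> as
      coefficients of \<open>U\<close> and \<open>\<gamma> / \<rho>\<close> as those of
      \<open>K\<close>, the product \<open>K j * U\<close> is nearly \<open>V j\<close>.
      Orthogonality gives equal squares for \<open>V\<close> and \<open>U\<close>, and normalized
      coefficients keep the column \<open>K\<close> nearly contractive.\<close>
    define \<gamma> where "\<gamma> j v = (\<Sum>w\<in>F. C (W j) w * c w v)" for j v
    define \<rho> where "\<rho> v = sqrt (\<Sum>j\<in>J. (cmod (\<gamma> j v))\<^sup>2)" for v
    define V where "V j = (\<Sum>v\<in>F1. sc (\<gamma> j v) (v * k))" for j
    define U where "U = (\<Sum>v\<in>F1. sc (complex_of_real (\<rho> v)) (v * k))"
    define K where "K j = (\<Sum>v\<in>F1. sc (\<gamma> j v / complex_of_real (\<rho> v)) (dd v))" for j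
    have rho2: "(\<rho> v)\<^sup>2 = (\<Sum>j\<in>J. (cmod (\<gamma> j v))\<^sup>2)" for v by (simp add: \<rho>_def sum_nonneg)
    \<comment> \<open>If \<open>\<rho> v\<close> is zero, so are all \<open>\<gamma> j v\<close>,
      and the convention that division by zero gives zero yields the correct coefficient of
      \<open>K j\<close>.\<close>
    have rho0: "\<gamma> j v = 0" if "\<rho> v = 0" "j \<in> J" for j v
      using that rho2[of v] J by (simp add: sum_nonneg_eq_0_iff)
    have cnj: "cnj z * z = complex_of_real ((cmod z)\<^sup>2)" for z
      by (metis complex_norm_square mult.commute)
    have dsum: "st (\<Sum>u\<in>F1. sc (a u) (dd u)) * (\<Sum>v\<in>F1. sc (b v) (dd v)) =
        (\<Sum>v\<in>F1. sc (cnj (a v) * b v) (st (dd v) * dd v))" for a b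
      using finF1 dortho by (rule st_mult_orthogonal_sums)
    have ksum: "st (\<Sum>u\<in>F1. sc (a u) (u * k)) * (\<Sum>v\<in>F1. sc (b v) (v * k)) =
        (\<Sum>v\<in>F1. sc (cnj (a v) * b v) (st (v * k) * (v * k)))" for a b
      using finF1 ortho by (rule st_mult_orthogonal_sums)
    have 1: "\<forall>j\<in>J. K j \<in> D" unfolding K_def using dD by (auto intro!: D_intros)
    have 2: "norm (\<Sum>j\<in>J. st (K j) * K j) \<le> (1 + \<epsilon>)\<^sup>2"
    proof -
      define \<tau> where "\<tau> v = (\<Sum>j\<in>J. (cmod (\<gamma> j v / complex_of_real (\<rho> v)))\<^sup>2)" for v
      have tau: "\<tau> v \<le> 1" "0 \<le> \<tau> v" for v
      proof -
        have "\<tau> v = (\<Sum>j\<in>J. (cmod (\<gamma> j v))\<^sup>2) / (\<rho> v)\<^sup>2"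
          by (simp add: \<tau>_def norm_divide power_divide sum_divide_distrib)
        also have "\<dots> \<le> 1" by (simp add: rho2[symmetric])
        finally show "\<tau> v \<le> 1" .
        show "0 \<le> \<tau> v" by (simp add: \<tau>_def sum_nonneg)
      qed
      have "(\<Sum>j\<in>J. st (K j) * K j) =
          (\<Sum>j\<in>J. \<Sum>v\<in>F1. scaleR ((cmod (\<gamma> j v / complex_of_real (\<rho> v)))\<^sup>2) (st (dd v) * dd v))"
        unfolding K_def
        by (simp only: dsum cnj sc_of_real)
      also have "\<dots> = (\<Sum>v\<in>F1. scaleR (\<tau> v) (st (dd v) * dd v))"
        unfolding \<tau>_def by (subst sum.swap) (simp add: scaleR_left.sum)
      also have "norm \<dots> \<le> (1 + \<epsilon>)\<^sup>2"
      proof (rule norm_pos_orthogonal_sum[OF _ finF1])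
        show "0 < (1 + \<epsilon>)\<^sup>2" using e by simp
        fix v assume v: "v \<in> F1"
        show "pos (\<tau> v *\<^sub>R (st (dd v) * dd v))" using tau by (intro pos_scaleR pos_st_mult_self)
        have "norm (\<tau> v *\<^sub>R (st (dd v) * dd v)) = \<tau> v * (norm (dd v))\<^sup>2"
          using tau[of v] by (simp add: cstar_identity)
        also have "\<dots> \<le> 1 * (1 + \<epsilon>)\<^sup>2"
          using tau[of v] nd[OF v] de by (intro mult_mono power_mono) auto
        finally show "norm (\<tau> v *\<^sub>R (st (dd v) * dd v)) \<le> (1 + \<epsilon>)\<^sup>2" by simp
        fix u assume u: "u \<in> F1" "v \<noteq> u"
        have "(st (dd v) * dd v) * (st (dd u) * dd u) = (st (dd v) * (dd v * st (dd u))) * dd u"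
          by (simp add: mult.assoc)
        also have "\<dots> = (st (dd v) * (st (dd u) * dd v)) * dd u"
          using D_comm[of "dd v" "st (dd u)"] dD u v by (simp add: D_intros)
        also have "\<dots> = 0" using dortho[of u v] u v by simp
        finally show "\<tau> v *\<^sub>R (st (dd v) * dd v) * \<tau> u *\<^sub>R (st (dd u) * dd u) = 0" by simp
      qed
      finally show ?thesis .
    qed
    have 3: "norm (W j * k - V j) \<le> \<epsilon>" if j: "j \<in> J" for j
    proof -
      define A where "A = (\<Sum>w\<in>F. sc (C (W j) w) w)"
      have "V j = (\<Sum>v\<in>F1. \<Sum>w\<in>F. sc (C (W j) w * c w v) (v * k))"
        by (simp add: V_def \<gamma>_def sc_sum_left)
      also have "\<dots> = (\<Sum>w\<in>F. sc (C (W j) w) (\<Sum>v\<in>F1. sc (c w v) (v * k)))"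
        by (subst sum.swap) (simp add: sc_sum)
      finally have "A * k - V j = (\<Sum>w\<in>F. sc (C (W j) w) (w * k - (\<Sum>v\<in>F1. sc (c w v) (v * k))))"
        by (simp add: A_def sum_distrib_right sum_subtractf sc_diff_right)
      also have "norm \<dots> \<le> (\<Sum>w\<in>F. cmod (C (W j) w) * \<delta>)"
        using approx by (intro sum_norm_le) (simp add: mult_left_mono)
      also have "\<dots> = (\<Sum>w\<in>F. cmod (C (W j) w)) * \<delta>" by (simp add: sum_distrib_right)
      also have "\<dots> \<le> S * (real (card F) + 1) * \<delta>"
      proof (intro mult_right_mono)
        have "S * 1 \<le> S * (real (card F) + 1)" using S1 by (intro mult_left_mono) auto
        then show "(\<Sum>w\<in>F. cmod (C (W j) w)) \<le> S * (real (card F) + 1)" using S[OF W[OF j]] by simp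
      qed (use d in simp)
      finally have "norm (A * k - V j) \<le> \<epsilon> / 2" using d2 by simp
      moreover have "norm ((W j - A) * k) \<le> \<epsilon> / 2"
        using norm_mult_ineq[of "W j - A" k] C[OF W[OF j]] nk by (simp add: A_def)
      moreover have "W j * k - V j = (W j - A) * k + (A * k - V j)" by (simp add: algebra_simps)
      ultimately show ?thesis using norm_triangle_ineq[of "(W j - A) * k" "A * k - V j"] by (smt (verit) field_sum_of_halves)
    qed
    have 4: "norm (K j * U - V j) \<le> \<epsilon>" if j: "j \<in> J" for j
    proof -
      have "K j * U = (\<Sum>v\<in>F1. \<Sum>u\<in>F1.
          sc (\<gamma> j v / complex_of_real (\<rho> v) * complex_of_real (\<rho> u)) (dd v * (u * k)))"
        by (simp add: K_def U_def sum_product del: sc_of_real) (simp add: mult.commute)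
      also have "\<dots> = (\<Sum>v\<in>F1. \<Sum>u\<in>F1. if u = v then sc (\<gamma> j v) (dd v * (v * k)) else 0)"
        using dw rho0[OF _ j] by (intro sum.cong refl) auto
      also have "\<dots> = (\<Sum>v\<in>F1. sc (\<gamma> j v) (dd v * (v * k)))" using finF1 by (simp add: sum.delta)
      finally have "K j * U - V j = (\<Sum>v\<in>F1. sc (\<gamma> j v) (dd v * (v * k) - v * k))"
        by (simp add: V_def sum_subtractf sc_diff_right)
      also have "norm \<dots> \<le> (\<Sum>v\<in>F1. \<Sum>w\<in>F. cmod (C (W j) w) * \<delta>)"
      proof (rule sum_norm_le)
        fix v assume v: "v \<in> F1"
        define n where "n = norm (dd v * (v * k) - v * k)"
        have "cmod (\<gamma> j v) \<le> (\<Sum>w\<in>F. cmod (C (W j) w) * cmod (c w v))"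
          unfolding \<gamma>_def by (rule sum_norm_le) (simp add: norm_mult)
        then have "cmod (\<gamma> j v) * n \<le> (\<Sum>w\<in>F. cmod (C (W j) w) * cmod (c w v)) * n"
          by (rule mult_right_mono) (simp add: n_def)
        also have "\<dots> = (\<Sum>w\<in>F. cmod (C (W j) w) * (cmod (c w v) * n))"
          by (simp add: sum_distrib_right mult.assoc)
        also have "\<dots> \<le> (\<Sum>w\<in>F. cmod (C (W j) w) * \<delta>)"
          using dv[OF v] by (intro sum_mono mult_left_mono) (auto simp: n_def)
        finally show "norm (sc (\<gamma> j v) (dd v * (v * k) - v * k)) \<le> (\<Sum>w\<in>F. cmod (C (W j) w) * \<delta>)"
          by (simp add: n_def)
      qed
      also have "\<dots> = real (card F1) * (\<Sum>w\<in>F. cmod (C (W j) w)) * \<delta>"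
        by (simp add: sum_distrib_right)
      also have "\<dots> \<le> (real (card F) + 1) * S * \<delta>"
      proof (intro mult_right_mono mult_mono S W j)
        show "real (card F1) \<le> real (card F) + 1" using card_mono[OF F(1) F1] by simp
      qed (use d in \<open>auto intro: sum_nonneg\<close>)
      also have "\<dots> = \<epsilon> / 2" using d2 by (simp add: mult.commute)
      finally show ?thesis using e by simp
    qed
    have 5: "(\<Sum>j\<in>J. st (V j) * V j) = st U * U"
    proof -
      have "(\<Sum>j\<in>J. st (V j) * V j) =
          (\<Sum>j\<in>J. \<Sum>v\<in>F1. scaleR ((cmod (\<gamma> j v))\<^sup>2) (st (v * k) * (v * k)))"
        unfolding V_def by (simp only: ksum cnj sc_of_real)
      also have "\<dots> = (\<Sum>v\<in>F1. scaleR ((\<rho> v)\<^sup>2) (st (v * k) * (v * k)))"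
        unfolding rho2 by (subst sum.swap) (simp add: scaleR_left.sum)
      also have "\<dots> = st U * U"
        unfolding U_def ksum by (simp only: cnj sc_of_real norm_of_real power2_abs)
      finally show ?thesis .
    qed
    show ?thesis using 1 2 3 4 5 by blast
  qed
  then show ?thesis using that[OF m nk] by blast
qed

text \<open>Suppose \<open>p = colsq I x\<close> exceeds \<open>t\<close> somewhere and let
  \<open>y = g * z * k\<close> be supported there. Then \<open>colsq I (x y)\<close> is
  \<open>t (st y * y)\<close> plus a definite excess \<open>P\<close>. Replace the entries
  \<open>Y j * y\<close> by \<open>K j * U\<close>: up to small errors, the hypothesis bounds
  \<open>colsq I (x y)\<close> by \<open>st U * U\<close>, which is nearly
  \<open>colsq J (Y y)\<close> and hence at most about \<open>t (st y * y)\<close>. So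
  \<open>P\<close> would be small.\<close>

lemma norm_columns_le_of_D:
  fixes X :: "'i \<Rightarrow> 'j \<Rightarrow> 'a"
  assumes J: "finite J"
    and hyp: "\<And>K. (\<forall>j\<in>J. K j \<in> D) \<Longrightarrow> norm (colsq I (\<lambda>i. \<Sum>j\<in>J. X i j * K j)) \<le> norm (colsq J K)"
  shows "norm (colsq I (\<lambda>i. \<Sum>j\<in>J. X i j * Y j)) \<le> norm (colsq J Y)"
proof (rule ccontr)
  assume neg: "\<not> ?thesis"
  define x where "x = (\<lambda>i. \<Sum>j\<in>J. X i j * Y j)"
  define p q where "p = colsq I x" and "q = colsq J Y"
  obtain t where t: "norm q < t" "t < norm p"
    using neg dense[of "norm q" "norm p"] unfolding p_def q_def x_def by (auto simp: not_le)
  have t0: "0 < t" using t(1) norm_ge_zero[of q] by linarith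
  have pq: "pos p" "pos q" by (simp_all add: p_def q_def pos_colsq)
  obtain s where s: "st s = s" "scaleR t 1 - q = s * s"
    using pos_complement[OF pq(2), of t] t by (auto simp: pos_def)
  define e where "e = p - scaleR t 1"
  have ste: "st e = e" using pq pos_st by (simp add: e_def)
  obtain a n where an: "pos a" "pos n" "e = a - n" "a * n = 0" "n * a = 0" "gen e a" "gen e n"
    using pospart[OF ste] .
  have sta: "st a = a" using an pos_st by blast
  have "a \<noteq> 0"
  proof
    assume "a = 0"
    then have "p + n = scaleR t 1" using an(3) by (simp add: e_def algebra_simps)
    then show False using pos_norm_mono[OF pq(1) an(2)] t t0 by simp
  qed
  \<comment> \<open>The root of \<open>a\<close> is the right cutoff: since it commutes with
    \<open>e\<close>, compressing \<open>p - t\<close> by \<open>g\<close> gives exactly the square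
    of \<open>a\<close>.\<close>
  obtain g where g: "pos g" "a = g * g" "gen a g" using pos_sqrt[OF an(1)] by blast
  have stg: "st g = g" using g pos_st by blast
  have "g * e = e * g"
    using gen_commute2[OF gen_trans[OF an(6) g(3)] gen_refl ste] .
  then have "g * e * g = e * a" by (simp add: g(2) mult.assoc)
  also have "\<dots> = a * a" unfolding an(3) by (simp add: left_diff_distrib an(5))
  finally have geg: "g * e * g = a * a" .
  have gpg: "g * p * g = a * a + scaleR t (g * g)"
    using geg by (simp add: e_def algebra_simps)

  define Jd where "Jd = closure (span (range (\<lambda>(c, c'). c * a * c')))"
  have ideal: "closed_ideal sc UNIV Jd" unfolding Jd_def by (rule closed_ideal_closure_span)
  have "a \<in> range (\<lambda>(c, c'). c * a * c')" by (rule range_eqI[of _ _ "(1, 1)"]) simp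
  then have "a \<in> Jd" unfolding Jd_def by (intro subsetD[OF closure_subset] span_base)
  then have "Jd \<inter> D \<noteq> {0}" using ideal_meets_D[OF ideal] \<open>a \<noteq> 0\<close> by blast
  moreover have "0 \<in> Jd \<inter> D" using ideal D_intros(1) by (auto simp: closed_ideal_def csubspace_def)
  ultimately obtain b0 where b0: "b0 \<in> Jd" "b0 \<in> D" "b0 \<noteq> 0" by blast
  define b where "b = scaleR (1 / norm (st b0 * b0)) (st b0 * b0)"
  have nb: "norm b = 1" using b0 by (simp add: b_def)
  have posb: "pos b" unfolding b_def by (intro pos_scaleR pos_st_mult_self) simp
  have bD: "b \<in> D" using b0 by (auto simp: b_def intro!: D_intros)
  have "st b0 * b0 \<in> Jd" using ideal b0 by (auto simp: closed_ideal_def)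
  then have "sc (complex_of_real (1 / norm (st b0 * b0))) (st b0 * b0) \<in> Jd"
    using ideal unfolding closed_ideal_def csubspace_def by blast
  then have "b \<in> Jd" unfolding b_def by (simp only: sc_of_real)
  then obtain b' where b': "b' \<in> span (range (\<lambda>(c, c'). c * a * c'))" "dist b' b < 1/4"
    unfolding Jd_def using closure_approachable[of b] by (metis zero_less_divide_1_iff zero_less_numeral)
  obtain Z M where Z: "finite Z" "0 \<le> M"
    and ZM: "\<And>k. norm (b' * k) \<le> M * (\<Sum>z\<in>Z. norm (a * z * k))"
    using span_ideal_bound[OF b'(1)] by blast
  obtain k0 r0 where k0: "k0 \<noteq> 0" "gen b k0" "norm r0 \<le> 1/4" "b * k0 = (1 - r0) * k0"
    by (rule top_localization[OF posb, of "1/4"]) (simp_all add: nb)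
  have k0D: "k0 \<in> D" using k0 bD csub_D genD by blast

  \<comment> \<open>Makes \<open>M * card Z * \<delta>\<close> less than 1/2, so that not all
    \<open>a * z * k\<close> can be smaller than \<open>\<delta>\<close>.\<close>
  define \<delta> where "\<delta> = 1 / (2 * (M + 1) * (real (card Z) + 1))"
  have d0: "0 < \<delta>" using Z by (simp add: \<delta>_def)
  \<comment> \<open>All \<open>z\<close> in \<open>Z\<close> are included, because which of them
    survives is known only once \<open>k\<close> is fixed.\<close>
  define T where "T = (\<lambda>(z, j). Y j * g * z) ` (Z \<times> J)"
  have finT: "finite T" using Z J by (simp add: T_def)
  define L where "L = 1 + (\<Sum>w\<in>T. norm w)"
  have L1: "1 \<le> L" by (simp add: L_def sum_nonneg)
  have LT: "norm w \<le> L" if "w \<in> T" for w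
    using member_le_sum[of w T norm] that finT by (simp add: L_def)
  define A where "A = 1 + (\<Sum>i\<in>I. \<Sum>j\<in>J. norm (X i j))"
  \<comment> \<open>The total coefficient of \<open>\<epsilon>\<close> in the three error terms of
    the final estimate.\<close>
  define Q where "Q = real (card I) * (8 * A\<^sup>2 * L) + real (card J) * (3 * L + 12 * L\<^sup>2)"
  have Q0: "0 \<le> Q" using L1 by (simp add: Q_def)
  define \<epsilon> where "\<epsilon> = min 1 (\<delta>\<^sup>2 / (2 * (Q + 1)))"
  have e0: "0 < \<epsilon>" "\<epsilon> \<le> 1" using d0 Q0 by (auto simp: \<epsilon>_def)
  have eQ: "Q * \<epsilon> < \<delta>\<^sup>2"
  proof -
    have "Q * \<epsilon> \<le> Q * (\<delta>\<^sup>2 / (2 * (Q + 1)))" using Q0 by (intro mult_left_mono) (auto simp: \<epsilon>_def)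
    also have "\<dots> = \<delta>\<^sup>2 * (Q / (2 * (Q + 1)))" by simp
    also have "\<dots> < \<delta>\<^sup>2 * 1" using Q0 d0 by (intro mult_strict_left_mono) auto
    finally show ?thesis by simp
  qed
  obtain m k where k: "m \<in> B" "k = k0 * m" and nk: "norm k = 1"
    and fact: "\<And>W :: 'j \<Rightarrow> 'a. (\<And>j. j \<in> J \<Longrightarrow> W j \<in> T) \<Longrightarrow> \<exists>K V U. (\<forall>j\<in>J. K j \<in> D) \<and>
      norm (\<Sum>j\<in>J. st (K j) * K j) \<le> (1 + \<epsilon>)\<^sup>2 \<and>
      (\<forall>j\<in>J. norm (W j * k - V j) \<le> \<epsilon> \<and> norm (K j * U - V j) \<le> \<epsilon>) \<and>
      (\<Sum>j\<in>J. st (V j) * V j) = st U * U"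
  proof (rule column_factorization[OF finT J k0D k0(1) e0(1)], goal_cases)
    case (1 m k)
    show ?case by (rule 1(1)[OF 1(2-)])
  qed

  \<comment> \<open>Otherwise \<open>norm (b' * k) < 1/2\<close>. But \<open>b'\<close> is within
    1/4 of \<open>b\<close>, and \<open>b\<close> acts on \<open>k\<close> as \<open>1 - r0\<close>
    with \<open>norm r0 \<le> 1/4\<close>, so the norm of \<open>k\<close> would be less than
    1.\<close>
  have "\<exists>z\<in>Z. \<delta> \<le> norm (a * z * k)"
  proof (rule ccontr)
    assume "\<not> ?thesis"
    then have "(\<Sum>z\<in>Z. norm (a * z * k)) \<le> (\<Sum>z\<in>Z. \<delta>)" by (intro sum_mono) auto
    from order_trans[OF ZM mult_left_mono[OF this Z(2)]]
    have "norm (b' * k) \<le> M * (real (card Z) * \<delta>)" by simp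
    also have "\<dots> \<le> (M * real (card Z)) / ((M + 1) * (real (card Z) + 1)) / 2"
      by (simp add: \<delta>_def algebra_simps)
    also have "\<dots> < 1 / 2"
    proof -
      have "M * real (card Z) < (M + 1) * (real (card Z) + 1)" using Z(2) by (simp add: algebra_simps)
      then show ?thesis using Z(2) by (simp add: divide_less_eq)
    qed
    finally have 1: "norm (b' * k) < 1/2" .
    have bk: "b * k = k - r0 * k" using arg_cong[OF k0(4), of "\<lambda>z. z * m"]
      by (simp add: k algebra_simps)
    have "k = b' * k - (b' - b) * k + r0 * k" using bk by (simp add: algebra_simps)
    then have "norm k \<le> norm (b' * k) + norm ((b' - b) * k) + norm (r0 * k)"
      by (metis norm_triangle_ineq norm_triangle_ineq4 add_right_mono order_trans)
    moreover have "norm ((b' - b) * k) \<le> 1/4"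
      using norm_mult_ineq[of "b' - b" k] b'(2) nk by (simp add: dist_norm)
    moreover have "norm (r0 * k) \<le> 1/4" using norm_mult_ineq[of r0 k] k0(3) nk by simp
    ultimately show False using 1 nk by simp
  qed
  then obtain z where z: "z \<in> Z" "\<delta> \<le> norm (a * z * k)" by blast
  define W where "W j = Y j * g * z" for j
  have WT: "W j \<in> T" if "j \<in> J" for j using that z(1) by (auto simp: W_def T_def)
  obtain K V U where K: "\<And>j. j \<in> J \<Longrightarrow> K j \<in> D" "norm (colsq J K) \<le> (1 + \<epsilon>)\<^sup>2"
    and V: "\<And>j. j \<in> J \<Longrightarrow> norm (W j * k - V j) \<le> \<epsilon>" "\<And>j. j \<in> J \<Longrightarrow> norm (K j * U - V j) \<le> \<epsilon>"
    and U: "colsq J V = st U * U"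
    using fact[of W] WT unfolding colsq_def by blast
  define y where "y = g * z * k"
  have Wk: "W j * k = Y j * y" for j by (simp add: W_def y_def mult.assoc)
  define P where "P = st (a * z * k) * (a * z * k)"
  define u where "u = (\<lambda>i. \<Sum>j\<in>J. X i j * K j)"
  define \<kappa> where "\<kappa> = (1 + \<epsilon>)\<^sup>2"
  have eq1: "colsq I (\<lambda>i. x i * y) = P + scaleR t (st y * y)"
  proof -
    have "colsq I (\<lambda>i. x i * y) = st (z * k) * (g * p * g) * (z * k)"
      by (simp add: colsq_mult p_def y_def stg mult.assoc)
    then show ?thesis unfolding gpg by (simp add: P_def y_def sta stg algebra_simps)
  qed
  have eq2: "st (s * y) * (s * y) = scaleR t (st y * y) - colsq J (\<lambda>j. W j * k)"
  proof -
    have "st (s * y) * (s * y) = st y * (s * s) * y" by (simp add: s mult.assoc)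
    then show ?thesis unfolding s(2)[symmetric] Wk colsq_mult q_def[symmetric]
      by (simp add: algebra_simps)
  qed
  have posQ1: "pos (st U * (scaleR \<kappa> 1 - colsq I u) * U)"
  proof (intro pos_conj pos_complement pos_colsq)
    have "norm (colsq I u) \<le> norm (colsq J K)" unfolding u_def by (rule hyp) (use K in blast)
    then show "norm (colsq I u) \<le> \<kappa>" using K(2) by (simp add: \<kappa>_def)
  qed
  have eq3: "st U * (scaleR \<kappa> 1 - colsq I u) * U = scaleR \<kappa> (colsq J V) - colsq I (\<lambda>i. u i * U)"
    by (simp add: U colsq_mult algebra_simps)
  \<comment> \<open>The left side is \<open>P\<close> plus two positive elements, so its norm is at
    least \<open>norm P\<close>. The right side consists only of approximation errors.\<close>
  have sum_eq: "P + (st U * (scaleR \<kappa> 1 - colsq I u) * U + st (s * y) * (s * y)) =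
      (colsq I (\<lambda>i. x i * y) - colsq I (\<lambda>i. u i * U))
      + (colsq J V - colsq J (\<lambda>j. W j * k)) + scaleR (\<kappa> - 1) (colsq J V)"
    unfolding eq1 eq2 eq3 by (simp add: algebra_simps)
  have "\<delta>\<^sup>2 \<le> (norm (a * z * k))\<^sup>2" using z d0 by (intro power_mono) auto
  also have "\<dots> = norm P" unfolding P_def by (simp only: cstar_identity)
  also have "\<dots> \<le> norm (P + (st U * (scaleR \<kappa> 1 - colsq I u) * U + st (s * y) * (s * y)))"
    using posQ1 unfolding P_def by (intro pos_norm_mono pos_add pos_st_mult_self)
  also have "\<dots> \<le> norm (colsq I (\<lambda>i. x i * y) - colsq I (\<lambda>i. u i * U))
      + norm (colsq J V - colsq J (\<lambda>j. W j * k)) + norm (scaleR (\<kappa> - 1) (colsq J V))"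
    unfolding sum_eq by (intro norm_triangle_le add_mono norm_triangle_ineq order_refl)
  also have "\<dots> \<le> real (card I) * (4 * A * L * (2 * A * \<epsilon>)) + real (card J) * (3 * L * \<epsilon>)
      + 3 * \<epsilon> * (real (card J) * (4 * L\<^sup>2))"
  proof (intro add_mono)
    have WL: "norm (W j * k) \<le> L" if "j \<in> J" for j
      using norm_mult_ineq[of "W j" k] nk LT[OF WT[OF that]] by simp
    have VL: "norm (V j) \<le> 2 * L" if "j \<in> J" for j
      using norm_triangle_sub[of "V j" "W j * k"] V(1)[OF that] WL[OF that] e0 L1
      by (simp add: norm_minus_commute)
    have XA: "(\<Sum>j\<in>J. norm (X i j)) \<le> A" if "i \<in> I" "finite I" for i
      using member_le_sum[of i I "\<lambda>i. \<Sum>j\<in>J. norm (X i j)"] that by (simp add: A_def sum_nonneg)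
    have KU: "norm (K j * U) \<le> 3 * L" if "j \<in> J" for j
      using norm_triangle_sub[of "K j * U" "V j"] V(2)[OF that] VL[OF that] e0 L1 by simp
    have WKU: "norm (W j * k - K j * U) \<le> 2 * \<epsilon>" if "j \<in> J" for j
      using norm_triangle_ineq4[of "W j * k - V j" "K j * U - V j"] V[OF that] by simp
    have row: "norm (\<Sum>j\<in>J. X i j * f j) \<le> A * R"
      if "i \<in> I" "finite I" "0 \<le> R" "\<And>j. j \<in> J \<Longrightarrow> norm (f j) \<le> R" for i f R
    proof -
      have "norm (\<Sum>j\<in>J. X i j * f j) \<le> (\<Sum>j\<in>J. norm (X i j) * R)"
        using that(4) by (intro sum_norm_le order_trans[OF norm_mult_ineq] mult_left_mono) auto
      also have "\<dots> \<le> A * R" using XA[OF that(1,2)] that(3)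
        by (simp add: mult_right_mono flip: sum_distrib_right)
      finally show ?thesis .
    qed
    show "norm (colsq J V - colsq J (\<lambda>j. W j * k)) \<le> real (card J) * (3 * L * \<epsilon>)"
    proof (rule norm_colsq_diff_le)
      fix j assume j: "j \<in> J"
      show "norm (V j) + norm (W j * k) \<le> 3 * L" using VL[OF j] WL[OF j] by simp
      show "norm (V j - W j * k) \<le> \<epsilon>" using V(1)[OF j] by (simp add: norm_minus_commute)
    qed
    have xy: "x i * y = (\<Sum>j\<in>J. X i j * (W j * k))" for i
      by (simp add: x_def Wk sum_distrib_right mult.assoc)
    have uU: "u i * U = (\<Sum>j\<in>J. X i j * (K j * U))" for i
      by (simp add: u_def sum_distrib_right mult.assoc)
    have kap: "\<kappa> - 1 \<le> 3 * \<epsilon>" "0 \<le> \<kappa> - 1"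
      using e0 mult_left_mono[of \<epsilon> 1 \<epsilon>] by (auto simp: \<kappa>_def power2_eq_square algebra_simps)
    have nV: "norm (colsq J V) \<le> real (card J) * (4 * L\<^sup>2)"
    proof -
      have "norm (colsq J V) \<le> (\<Sum>j\<in>J. 4 * L\<^sup>2)" unfolding colsq_def
      proof (rule sum_norm_le)
        fix j assume "j \<in> J"
        then have "(norm (V j))\<^sup>2 \<le> (2 * L)\<^sup>2" using VL by (intro power_mono) auto
        then show "norm (st (V j) * V j) \<le> 4 * L\<^sup>2" by (simp add: cstar_identity power_mult_distrib)
      qed
      then show ?thesis by simp
    qed
    have "(\<kappa> - 1) * norm (colsq J V) \<le> 3 * \<epsilon> * (real (card J) * (4 * L\<^sup>2))"
      using kap nV e0 by (intro mult_mono) auto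
    then show "norm (scaleR (\<kappa> - 1) (colsq J V)) \<le> 3 * \<epsilon> * (real (card J) * (4 * L\<^sup>2))"
      using kap(2) by simp
    show "norm (colsq I (\<lambda>i. x i * y) - colsq I (\<lambda>i. u i * U)) \<le> real (card I) * (4 * A * L * (2 * A * \<epsilon>))"
    proof (cases "finite I")
      case True
      show ?thesis
      proof (rule norm_colsq_diff_le)
        fix i assume i: "i \<in> I"
        have "norm (x i * y) \<le> A * L" unfolding xy using i True L1 WL by (intro row) auto
        moreover have "norm (u i * U) \<le> A * (3 * L)" unfolding uU using i True L1 KU by (intro row) auto
        ultimately show "norm (x i * y) + norm (u i * U) \<le> 4 * A * L" by simp
        have "x i * y - u i * U = (\<Sum>j\<in>J. X i j * (W j * k - K j * U))"
          by (simp add: xy uU right_diff_distrib sum_subtractf)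
        also have "norm \<dots> \<le> A * (2 * \<epsilon>)" using i True e0 WKU by (intro row) auto
        finally show "norm (x i * y - u i * U) \<le> 2 * A * \<epsilon>" by simp
      qed
    next
      \<comment> \<open>A sum over an infinite index set is zero by convention, so both
        \<open>colsq\<close> vanish.\<close>
      case False
      then show ?thesis by (simp add: colsq_def)
    qed
  qed
  also have "\<dots> = Q * \<epsilon>" by (simp add: Q_def algebra_simps power2_eq_square)
  finally show False using eQ by simp
qed

corollary norm_columns_le_of_D_scaled:
  fixes X :: "'i \<Rightarrow> 'j \<Rightarrow> 'a"
  assumes J: "finite J" and S: "0 < S"
    and hyp: "\<And>K. (\<forall>j\<in>J. K j \<in> D) \<Longrightarrow>
      norm (colsq I (\<lambda>i. \<Sum>j\<in>J. X i j * K j)) \<le> S\<^sup>2 * norm (colsq J K)"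
  shows "norm (colsq I (\<lambda>i. \<Sum>j\<in>J. X i j * Y j)) \<le> S\<^sup>2 * norm (colsq J Y)"
proof -
  have eq: "colsq I (\<lambda>i. \<Sum>j\<in>J. scaleR (1 / S) (X i j) * Z j) =
      scaleR (1 / S\<^sup>2) (colsq I (\<lambda>i. \<Sum>j\<in>J. X i j * Z j))" for Z
    by (simp add: colsq_def st_sum scaleR_right.sum power2_eq_square flip: scaleR_right.sum)
  have "norm (colsq I (\<lambda>i. \<Sum>j\<in>J. scaleR (1 / S) (X i j) * Y j)) \<le> norm (colsq J Y)"
  proof (rule norm_columns_le_of_D[OF J])
    fix K assume "\<forall>j\<in>J. K j \<in> D"
    then show "norm (colsq I (\<lambda>i. \<Sum>j\<in>J. scaleR (1 / S) (X i j) * K j)) \<le> norm (colsq J K)"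
      using hyp[of K] S unfolding eq by (simp add: field_simps)
  qed
  then show ?thesis using S unfolding eq by (simp add: field_simps)
qed

end

section \<open>Matrix norms\<close>

lemma le_of_power_two_powers_le:
  fixes u v C :: real
  assumes "0 < v" and le: "\<And>k. u ^ (2 ^ k) \<le> C * v ^ (2 ^ k)"
  shows "u \<le> v"
proof (rule ccontr)
  assume "\<not> u \<le> v"
  then have uv: "1 < u / v" using assms(1) by simp
  obtain m where m: "C < (u / v) ^ m" using real_arch_pow[OF uv] by blast
  have "(u / v) ^ m \<le> (u / v) ^ (2 ^ m)"
    using uv less_exp[of m] by (intro power_increasing) auto
  also have "\<dots> \<le> C" using le[of m] assms(1) by (simp add: power_divide field_simps)
  finally show False using m by simp
qed

lemma mat_mult_assoc:
  "mat_mult n (mat_mult n X Y) Z = mat_mult n X (mat_mult n Y Z)"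
proof (intro ext)
  fix i j
  have "(\<Sum>k<n. (\<Sum>l<n. X i l * Y l k) * Z k j) = (\<Sum>l<n. X i l * (\<Sum>k<n. Y l k * Z k j))"
    unfolding sum_distrib_left sum_distrib_right
    by (subst sum.swap) (simp add: mult.assoc)
  then show "mat_mult n (mat_mult n X Y) Z i j = mat_mult n X (mat_mult n Y Z) i j"
    by (simp add: mat_mult_def)
qed

lemma mat_mult_in_mat_set [simp]: "mat_mult n X Y \<in> mat_set n"
  by (auto simp: mat_set_def mat_mult_def)

locale matrix_cstar_norm = cstar sc st
  for sc :: "complex \<Rightarrow> 'a::{banach,real_normed_algebra_1} \<Rightarrow> 'a" and st :: "'a \<Rightarrow> 'a" +
  fixes n :: nat and N :: "(nat \<Rightarrow> nat \<Rightarrow> 'a) \<Rightarrow> real"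
  assumes n: "1 \<le> n" and N: "cstar_matrix_norm sc st n N"
begin

lemma
  assumes "X \<in> mat_set n"
  shows N_ge_0: "0 \<le> N X"
    and N_eq_0: "N X = 0 \<longleftrightarrow> X = (\<lambda>i j. 0)"
    and N_scale: "N (mat_scale sc c X) = cmod c * N X"
    and N_star_self: "N (mat_mult n (mat_star st X) X) = (N X)\<^sup>2"
    and N_add: "Y \<in> mat_set n \<Longrightarrow> N (mat_add X Y) \<le> N X + N Y"
    and N_mult: "Y \<in> mat_set n \<Longrightarrow> N (mat_mult n X Y) \<le> N X * N Y"
  using N assms unfolding cstar_matrix_norm_def by auto

lemma mat_star_in_mat_set [simp]: "X \<in> mat_set n \<Longrightarrow> mat_star st X \<in> mat_set n"
  by (auto simp: mat_set_def mat_star_def)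

lemma mat_star_star [simp]: "mat_star st (mat_star st X) = X"
  by (simp add: mat_star_def)

lemma mat_star_mult [simp]:
  "mat_star st (mat_mult n X Y) = mat_mult n (mat_star st Y) (mat_star st X)"
  by (auto simp: mat_star_def mat_mult_def fun_eq_iff st_sum)

lemma N_star [simp]:
  assumes "X \<in> mat_set n" shows "N (mat_star st X) = N X"
proof -
  have le: "N Y \<le> N (mat_star st Y)" if Y: "Y \<in> mat_set n" for Y
  proof (cases "N Y = 0")
    case True
    then show ?thesis using N_ge_0[of "mat_star st Y"] Y by simp
  next
    case False
    have "N Y * N Y \<le> N (mat_star st Y) * N Y"
      using N_mult[of "mat_star st Y" Y] N_star_self[OF Y] Y by (simp add: power2_eq_square)
    then show ?thesis using False N_ge_0[OF Y] by simp
  qed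
  from le[OF assms] le[of "mat_star st X"] assms show ?thesis by simp
qed

definition corner :: "'a \<Rightarrow> nat \<Rightarrow> nat \<Rightarrow> 'a" where
  "corner x = (\<lambda>i j. if i = 0 \<and> j = 0 then x else 0)"

text \<open>Placing the column in a square matrix makes \<open>N\<close> itself measure
  columns.\<close>

definition col :: "(nat \<Rightarrow> 'a) \<Rightarrow> nat \<Rightarrow> nat \<Rightarrow> 'a" where
  "col Y = (\<lambda>i j. if i < n \<and> j = 0 then Y i else 0)"

lemma corner_in_mat_set [simp]: "corner x \<in> mat_set n"
  using n by (auto simp: corner_def mat_set_def)

lemma col_in_mat_set [simp]: "col Y \<in> mat_set n"
  using n by (auto simp: col_def mat_set_def)

text \<open>The corner embedding respects sums, products, scalars and adjoints, so \<open>N\<close>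
  restricts to a C*-norm on the algebra, and there is only one. All knowledge about \<open>N\<close>
  on columns and rows comes from here.\<close>

lemma N_corner [simp]: "N (corner x) = norm x"
proof (rule cstar_norm_unique)
  have eq: "corner (y + z) = mat_add (corner y) (corner z)"
    "corner (sc c y) = mat_scale sc c (corner y)"
    "corner (y * z) = mat_mult n (corner y) (corner z)"
    "corner (st y) = mat_star st (corner y)" for y z c
  proof -
    have "(\<Sum>k<n. (if i = 0 \<and> k = 0 then y else 0) * (if k = 0 \<and> j = 0 then z else 0)) =
        (\<Sum>k<n. if k = 0 then (if i = 0 \<and> j = 0 then y * z else 0) else 0)" for i j :: nat
      by (intro sum.cong) auto
    then show "corner (y * z) = mat_mult n (corner y) (corner z)"
      using n by (auto simp: corner_def mat_mult_def fun_eq_iff)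
  qed (auto simp: corner_def mat_add_def mat_scale_def mat_star_def fun_eq_iff)
  show "0 \<le> N (corner y)" for y by (simp add: N_ge_0)
  show "N (corner y) = 0 \<longleftrightarrow> y = 0" for y
    unfolding N_eq_0[OF corner_in_mat_set] by (auto simp: corner_def fun_eq_iff)
  show "N (corner (y + z)) \<le> N (corner y) + N (corner z)" for y z
    unfolding eq by (simp add: N_add)
  show "N (corner (sc c y)) = cmod c * N (corner y)" for c y
    unfolding eq by (simp add: N_scale)
  show "N (corner (y * z)) \<le> N (corner y) * N (corner z)" for y z
    unfolding eq by (simp add: N_mult)
  show "N (corner (st y * y)) = (N (corner y))\<^sup>2" for y
    unfolding eq by (simp add: N_star_self)
qed

lemma mat_star_col_mult_col:
  "mat_mult n (mat_star st (col Y)) (col Z) = corner (\<Sum>k<n. st (Y k) * Z k)"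
  using n by (auto simp: mat_mult_def mat_star_def col_def corner_def fun_eq_iff)

lemma mat_mult_col: "mat_mult n X (col Y) = col (\<lambda>i. \<Sum>k<n. X i k * Y k)"
  using n by (auto simp: mat_mult_def col_def fun_eq_iff)

lemma N_col: "(N (col Y))\<^sup>2 = norm (colsq {..<n} Y)"
  using N_star_self[of "col Y"] by (simp add: mat_star_col_mult_col colsq_def)

lemma norm_sum_st_mult_le: "norm (\<Sum>k<n. st (Y k) * Z k) \<le> N (col Y) * N (col Z)"
  using N_mult[of "mat_star st (col Y)" "col Z"] by (simp add: mat_star_col_mult_col)

lemma col_eq_0:
  assumes "N (col Y) = 0" "i < n" shows "Y i = 0"
proof -
  have "col Y i 0 = 0" using assms(1) N_eq_0[OF col_in_mat_set, of Y] by simp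
  then show ?thesis using assms(2) by (simp add: col_def)
qed

text \<open>Adds the columns one at a time. The single column \<open>m\<close> is \<open>B\<close>
  times the unit column \<open>e\<close> times the adjoint of \<open>e\<close>, so each contributes
  at most \<open>\<beta>\<close>.\<close>

lemma N_le_sum_columns:
  assumes B: "B \<in> mat_set n" and "0 \<le> \<beta>" and le: "\<And>Y. N (mat_mult n B (col Y)) \<le> \<beta> * N (col Y)"
  shows "N B \<le> real n * \<beta>"
proof -
  have "N (\<lambda>i j. if j < m then B i j else 0) \<le> real m * \<beta>" if "m \<le> n" for m
    using that
  proof (induction m)
    case 0
    have "(\<lambda>i j. 0 :: 'a) \<in> mat_set n" by (simp add: mat_set_def)
    then show ?case using N_eq_0[of "\<lambda>i j. 0"] by simp
  next
    case (Suc m)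
    define e where "e k = (if k = m then 1 else 0 :: 'a)" for k
    have "(\<Sum>k<n. B i k * e k) = B i m" for i
      using Suc.prems by (simp add: e_def if_distrib sum.delta cong: if_cong)
    then have Be: "mat_mult n B (col e) = col (\<lambda>i. B i m)" by (simp add: mat_mult_col)
    have "colsq {..<n} e = 1"
      using Suc.prems by (simp add: colsq_def e_def if_distrib sum.delta cong: if_cong)
    then have "(N (col e))\<^sup>2 = 1" by (simp add: N_col)
    then have Ne: "N (col e) = 1" using N_ge_0[of "col e"] by (simp add: power2_eq_1_iff)
    define C where "C = mat_mult n (mat_mult n B (col e)) (mat_star st (col e))"
    have C: "C = (\<lambda>i j. if j = m then B i j else 0)"
    proof (intro ext)
      fix i j
      have "(\<Sum>k<n. col (\<lambda>i. B i m) i k * st (col e j k)) =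
          (\<Sum>k<n. if k = 0 then (if i < n \<and> j < n \<and> j = m then B i m else 0) else 0)"
        by (intro sum.cong) (auto simp: col_def e_def)
      also have "\<dots> = (if i < n \<and> j < n \<and> j = m then B i m else 0)" using n by (simp add: sum.delta)
      finally show "C i j = (if j = m then B i j else 0)"
        using B Suc.prems unfolding C_def Be by (auto simp: mat_mult_def mat_star_def mat_set_def)
    qed
    have "N C \<le> N (mat_mult n B (col e)) * N (mat_star st (col e))"
      unfolding C_def by (intro N_mult) simp_all
    also have "\<dots> \<le> \<beta>" using le[of e] Ne by simp
    finally have NC: "N C \<le> \<beta>" .
    have "(\<lambda>i j. if j < Suc m then B i j else 0) = mat_add (\<lambda>i j. if j < m then B i j else 0) C"
      by (auto simp: C mat_add_def fun_eq_iff less_Suc_eq)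
    moreover have "(\<lambda>i j. if j < m then B i j else 0) \<in> mat_set n"
      using B by (auto simp: mat_set_def)
    moreover have "C \<in> mat_set n" by (simp add: C_def)
    ultimately show ?case using N_add NC Suc by (fastforce simp: distrib_right)
  qed
  from this[of n] have "N (\<lambda>i j. if j < n then B i j else 0) \<le> real n * \<beta>" by simp
  also have "(\<lambda>i j. if j < n then B i j else 0) = B"
    using B by (auto simp: mat_set_def fun_eq_iff)
  finally show ?thesis .
qed

text \<open>The norm of \<open>X\<^sup>* X\<close> is the limit of the \<open>2\<^sup>k\<close>-th roots of the norms of its powers, so a crude
  bound on the norm of a matrix by its action on columns becomes sharp.\<close>

lemma N_le_column_bound:
  assumes X: "X \<in> mat_set n" and S: "0 < S"
    and le: "\<And>Y. N (mat_mult n X (col Y)) \<le> S * N (col Y)"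
  shows "N X \<le> S"
proof -
  define A where "A = mat_mult n (mat_star st X) X"
  define P where "P k = ((\<lambda>B. mat_mult n B B) ^^ k) A" for k
  have P0: "P 0 = A" and PS: "P (Suc k) = mat_mult n (P k) (P k)" for k by (simp_all add: P_def)
  have Pm: "P k \<in> mat_set n" for k by (cases k) (simp_all add: P0 PS A_def)
  have Pst: "mat_star st (P k) = P k" for k by (induction k) (simp_all add: P0 PS A_def)
  have NP: "N (P k) = N A ^ (2 ^ k)" for k
  proof (induction k)
    case (Suc k)
    have "N (P (Suc k)) = (N (P k))\<^sup>2" using N_star_self[OF Pm[of k]] by (simp add: PS Pst)
    then show ?case using Suc by (simp add: power_mult[symmetric] mult.commute)
  qed (simp add: P0)
  \<comment> \<open>The column bound passes to the adjoint by duality: for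
    \<open>Q = st X * Z\<close> the square of \<open>N Q\<close> is the norm of the adjoint of
    \<open>Z\<close> times \<open>X * Q\<close>.\<close>
  have star: "N (mat_mult n (mat_star st X) (col Z)) \<le> S * N (col Z)" for Z
  proof -
    define Q where "Q = mat_mult n (mat_star st X) (col Z)"
    have Q: "Q \<in> mat_set n" by (simp add: Q_def)
    obtain Y where Y: "Q = col Y" by (simp add: Q_def mat_mult_col)
    have "(N Q)\<^sup>2 = N (mat_mult n (mat_star st Q) Q)" using N_star_self[OF Q] by simp
    also have "mat_mult n (mat_star st Q) Q = mat_mult n (mat_star st (col Z)) (mat_mult n X Q)"
      by (simp add: Q_def mat_mult_assoc)
    also have "N \<dots> \<le> N (mat_star st (col Z)) * N (mat_mult n X Q)" by (intro N_mult) simp_all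
    also have "\<dots> \<le> N (col Z) * (S * N Q)"
      using le[of Y] Y N_ge_0[of "col Z"] by (simp add: mult_left_mono)
    finally have "N Q * N Q \<le> (S * N (col Z)) * N Q" by (simp add: power2_eq_square mult.commute mult.left_commute)
    moreover have "0 \<le> S * N (col Z)" using S N_ge_0[of "col Z"] by simp
    ultimately show ?thesis using N_ge_0[OF Q] unfolding Q_def[symmetric]
      by (cases "N Q = 0") auto
  qed
  have bound: "N (mat_mult n (P k) (col Y)) \<le> (S\<^sup>2) ^ (2 ^ k) * N (col Y)" for k Y
  proof (induction k arbitrary: Y)
    case 0
    have eq: "mat_mult n (P 0) (col Y) = mat_mult n (mat_star st X) (mat_mult n X (col Y))"
      by (simp add: P0 A_def mat_mult_assoc)
    have "N (mat_mult n (mat_star st X) (mat_mult n X (col Y))) \<le> S * N (mat_mult n X (col Y))"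
      unfolding mat_mult_col[of X Y] by (rule star)
    also have "\<dots> \<le> S * (S * N (col Y))" by (rule mult_left_mono[OF le]) (use S in simp)
    also have "\<dots> = (S\<^sup>2) ^ 2 ^ 0 * N (col Y)" by (simp add: power2_eq_square mult.assoc)
    finally show ?case unfolding eq .
  next
    case (Suc k)
    have "N (mat_mult n (P (Suc k)) (col Y)) = N (mat_mult n (P k) (mat_mult n (P k) (col Y)))"
      by (simp add: PS mat_mult_assoc)
    also have "\<dots> \<le> (S\<^sup>2) ^ (2 ^ k) * N (mat_mult n (P k) (col Y))"
      unfolding mat_mult_col[of "P k" Y] by (rule Suc)
    also have "\<dots> \<le> (S\<^sup>2) ^ (2 ^ k) * ((S\<^sup>2) ^ (2 ^ k) * N (col Y))"
      by (intro mult_left_mono Suc) simp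
    also have "\<dots> = (S\<^sup>2) ^ (2 ^ Suc k) * N (col Y)"
      by (simp add: mult_2 power_add mult.assoc)
    finally show ?case .
  qed
  have "N A \<le> S\<^sup>2"
  proof (rule le_of_power_two_powers_le)
    show "0 < S\<^sup>2" using S by simp
    show "N A ^ 2 ^ k \<le> real n * S\<^sup>2 ^ 2 ^ k" for k
      unfolding NP[symmetric] by (rule N_le_sum_columns[OF Pm _ bound]) simp
  qed
  then have "(N X)\<^sup>2 \<le> S\<^sup>2" using N_star_self[OF X] by (simp add: A_def)
  then show ?thesis using S by (auto intro: power2_le_imp_le)
qed

lemma norm_row_mult_col_le:
  assumes X: "X \<in> mat_set n"
  shows "norm (\<Sum>i<n. \<Sum>j<n. r i * X i j * k j) \<le> N (col (\<lambda>i. st (r i))) * N X * N (col k)"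
proof -
  have "(\<Sum>i<n. \<Sum>j<n. r i * X i j * k j) = (\<Sum>i<n. st (st (r i)) * (\<Sum>j<n. X i j * k j))"
    by (simp add: sum_distrib_left mult.assoc)
  also have "norm \<dots> \<le> N (col (\<lambda>i. st (r i))) * N (mat_mult n X (col k))"
    unfolding mat_mult_col by (rule norm_sum_st_mult_le)
  also have "\<dots> \<le> N (col (\<lambda>i. st (r i))) * (N X * N (col k))"
    by (intro mult_left_mono N_mult N_ge_0 X) simp_all
  finally show ?thesis by (simp add: mult.assoc)
qed

lemma col_scaleR: "N (col (\<lambda>i. scaleR t (Y i))) = \<bar>t\<bar> * N (col Y)"
proof -
  have "col (\<lambda>i. scaleR t (Y i)) = mat_scale sc (complex_of_real t) (col Y)"
    by (auto simp: col_def mat_scale_def fun_eq_iff)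
  then show ?thesis by (simp add: N_scale)
qed

end

section \<open>Norming, from the comparison of columns\<close>

context masa_inclusion
begin

text \<open>The comparison is used twice. For a column \<open>K\<close> over \<open>D\<close>, it is
  applied to the row adjoint to \<open>Z = X K\<close>, which extends the bound from rows over
  \<open>D\<close> to all rows and so controls the norm of \<open>Z\<close>. This is the hypothesis
  of the comparison for \<open>X\<close> itself, which then bounds \<open>X\<close> on all
  columns.\<close>

lemma norms_D: "norms sc st D"
  unfolding norms_def
proof (intro allI impI ballI)
  fix n :: nat and N :: "(nat \<Rightarrow> nat \<Rightarrow> 'a) \<Rightarrow> real" and X :: "nat \<Rightarrow> nat \<Rightarrow> 'a"
  assume "1 \<le> n" "cstar_matrix_norm sc st n N" and X: "X \<in> mat_set n"
  then interpret matrix_cstar_norm sc st n N by unfold_locales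
  define \<Omega> where "\<Omega> = {norm (\<Sum>i<n. \<Sum>j<n. r i * X i j * k j) | r k.
            (\<forall>i<n. r i \<in> D) \<and> (\<forall>j<n. k j \<in> D) \<and>
            norm (\<Sum>i<n. r i * st (r i)) \<le> 1 \<and> norm (\<Sum>j<n. st (k j) * k j) \<le> 1}"
  have unit: "N (col Y) \<le> 1 \<longleftrightarrow> norm (\<Sum>j<n. st (Y j) * Y j) \<le> 1" for Y
    using N_col[of Y] N_ge_0[of "col Y"] power_le_one_iff[of "N (col Y)" 2] by (simp add: colsq_def)
  have upper: "w \<le> N X" if w\<Omega>: "w \<in> \<Omega>" for w
  proof -
    obtain r k where w: "w = norm (\<Sum>i<n. \<Sum>j<n. r i * X i j * k j)"
      "norm (\<Sum>i<n. r i * st (r i)) \<le> 1" "norm (\<Sum>j<n. st (k j) * k j) \<le> 1"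
      using w\<Omega> by (auto simp: \<Omega>_def)
    have "w \<le> N (col (\<lambda>i. st (r i))) * N X * N (col k)"
      unfolding w(1) by (rule norm_row_mult_col_le[OF X])
    also have "\<dots> \<le> 1 * N X * 1"
      using w(2,3) unit[of k] unit[of "\<lambda>i. st (r i)"] X
      by (intro mult_mono mult_nonneg_nonneg N_ge_0) auto
    finally show ?thesis by simp
  qed
  have bdd: "bdd_above \<Omega>" using upper by (auto simp: bdd_above_def)
  have "0 \<in> \<Omega>" unfolding \<Omega>_def using D_intros(1)
    by (intro CollectI exI[of _ "\<lambda>_. 0"]) auto
  have "N X \<le> Sup \<Omega>"
  proof (rule field_le_epsilon)
    fix e :: real assume e: "0 < e"
    \<comment> \<open>The added \<open>e\<close> makes \<open>S\<close> positive even when the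
      supremum is zero; the scaled comparison and the column bound divide by it.\<close>
    define S where "S = Sup \<Omega> + e"
    have S: "0 < S" using cSup_upper[OF \<open>0 \<in> \<Omega>\<close> bdd] e by (simp add: S_def)
    have unit_bound: "norm (\<Sum>i<n. \<Sum>j<n. r i * X i j * k j) \<le> S"
      if "\<forall>i<n. r i \<in> D" "\<forall>j<n. k j \<in> D" "N (col (\<lambda>i. st (r i))) \<le> 1" "N (col k) \<le> 1" for r k
    proof -
      have "norm (\<Sum>i<n. \<Sum>j<n. r i * X i j * k j) \<in> \<Omega>"
        unfolding \<Omega>_def using that unit[of k] unit[of "\<lambda>i. st (r i)"] by auto
      then show ?thesis using cSup_upper[OF _ bdd] e by (fastforce simp: S_def)
    qed
    have D_bound: "norm (\<Sum>i<n. \<Sum>j<n. r i * X i j * k j) \<le> S * N (col k) * N (col (\<lambda>i. st (r i)))"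
      if r: "\<forall>i<n. r i \<in> D" and k: "\<forall>j<n. k j \<in> D" for r k
    proof (cases "N (col k) = 0 \<or> N (col (\<lambda>i. st (r i))) = 0")
      case True
      then have "(\<forall>j<n. k j = 0) \<or> (\<forall>i<n. r i = 0)"
        using col_eq_0[of k] col_eq_0[of "\<lambda>i. st (r i)"] by (metis st_st st_zero)
      then have "(\<Sum>i<n. \<Sum>j<n. r i * X i j * k j) = 0" by (auto intro!: sum.neutral)
      then show ?thesis using S N_ge_0[of "col k"] N_ge_0[of "col (\<lambda>i. st (r i))"] by simp
    next
      case False
      define a b where "a = N (col k)" and "b = N (col (\<lambda>i. st (r i)))"
      have ab: "0 < a" "0 < b"
        using False N_ge_0[of "col k"] N_ge_0[of "col (\<lambda>i. st (r i))"] by (auto simp: a_def b_def)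
      have "norm (\<Sum>i<n. \<Sum>j<n. scaleR (1 / b) (r i) * X i j * scaleR (1 / a) (k j)) \<le> S"
      proof (rule unit_bound)
        show "N (col (\<lambda>j. scaleR (1 / a) (k j))) \<le> 1" using ab by (simp add: col_scaleR a_def)
        show "N (col (\<lambda>i. st (scaleR (1 / b) (r i)))) \<le> 1" using ab by (simp add: col_scaleR b_def)
      qed (use r k in \<open>auto intro: D_intros\<close>)
      moreover have "(\<Sum>i<n. \<Sum>j<n. scaleR (1 / b) (r i) * X i j * scaleR (1 / a) (k j)) =
          scaleR (1 / (a * b)) (\<Sum>i<n. \<Sum>j<n. r i * X i j * k j)"
        by (simp add: scaleR_right.sum)
      ultimately show ?thesis using ab by (simp add: a_def b_def field_simps)
    qed
    have D_column: "norm (colsq {..<n} (\<lambda>i. \<Sum>j<n. X i j * K j)) \<le> S\<^sup>2 * norm (colsq {..<n} K)"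
      if K: "\<forall>j\<in>{..<n}. K j \<in> D" for K
    proof -
      define Z where "Z = (\<lambda>i. \<Sum>j<n. X i j * K j)"
      define S1 where "S1 = S * N (col K)"
      have S1: "S1\<^sup>2 = S\<^sup>2 * norm (colsq {..<n} K)" by (simp add: S1_def power_mult_distrib N_col)
      show ?thesis
      proof (cases "N (col K) = 0")
        case True
        then have "Z = (\<lambda>i. 0)" using col_eq_0[of K] by (auto simp: Z_def intro!: sum.neutral)
        then have "colsq {..<n} Z = 0" by (simp add: colsq_def)
        then show ?thesis by (simp add: Z_def)
      next
        case False
        then have S1p: "0 < S1" using S N_ge_0[of "col K"] by (simp add: S1_def)
        \<comment> \<open>A single row is a matrix whose row index set is the one-element type, so
          the column comparison covers it.\<close>
        have *: "norm (colsq {()} (\<lambda>_. \<Sum>j<n. st (Z j) * Y j)) \<le> S1\<^sup>2 * norm (colsq {..<n} Y)" for Y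
        proof (rule norm_columns_le_of_D_scaled[OF _ S1p])
          fix K' assume K': "\<forall>j\<in>{..<n}. K' j \<in> D"
          have "(\<Sum>j<n. st (Z j) * K' j) = st (\<Sum>i<n. \<Sum>j<n. st (K' i) * X i j * K j)"
            by (simp add: Z_def st_sum sum_distrib_left sum_distrib_right mult.assoc)
          then have "norm (\<Sum>j<n. st (Z j) * K' j) = norm (\<Sum>i<n. \<Sum>j<n. st (K' i) * X i j * K j)"
            by (simp only: norm_st)
          also have "\<dots> \<le> S1 * N (col K')"
            using D_bound[of "\<lambda>i. st (K' i)" K] K K' by (simp add: S1_def D_intros)
          finally have "(norm (\<Sum>j<n. st (Z j) * K' j))\<^sup>2 \<le> (S1 * N (col K'))\<^sup>2"
            by (intro power_mono) auto
          then show "norm (colsq {()} (\<lambda>_. \<Sum>j<n. st (Z j) * K' j)) \<le> S1\<^sup>2 * norm (colsq {..<n} K')"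
            by (simp add: colsq_def cstar_identity power_mult_distrib N_col del: st_mult)
        qed simp
        \<comment> \<open>Testing the row adjoint to \<open>Z\<close> on \<open>Z\<close> itself
          gives \<open>\<zeta> * \<zeta> \<le> S1^2 * \<zeta>\<close>, that is, the norm of
          \<open>Z\<close>.\<close>
        define \<zeta> where "\<zeta> = norm (colsq {..<n} Z)"
        have "(norm (\<Sum>j<n. st (Z j) * Z j))\<^sup>2 \<le> S1\<^sup>2 * \<zeta>"
          using *[of Z] by (simp add: colsq_def \<zeta>_def cstar_identity)
        then have "\<zeta> * \<zeta> \<le> S1\<^sup>2 * \<zeta>" by (simp add: \<zeta>_def colsq_def power2_eq_square)
        moreover have "0 \<le> \<zeta>" by (simp add: \<zeta>_def)
        ultimately have "\<zeta> \<le> S1\<^sup>2" by (cases "\<zeta> = 0") auto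
        then show ?thesis by (simp add: \<zeta>_def Z_def S1)
      qed
    qed
    have "N X \<le> S"
    proof (rule N_le_column_bound[OF X S])
      fix Y
      have "norm (colsq {..<n} (\<lambda>i. \<Sum>j<n. X i j * Y j)) \<le> S\<^sup>2 * norm (colsq {..<n} Y)"
        by (rule norm_columns_le_of_D_scaled[OF finite_lessThan S D_column])
      then have "(N (mat_mult n X (col Y)))\<^sup>2 \<le> (S * N (col Y))\<^sup>2"
        by (simp add: mat_mult_col N_col power_mult_distrib)
      then show "N (mat_mult n X (col Y)) \<le> S * N (col Y)"
        by (rule power2_le_imp_le) (use S N_ge_0[of "col Y"] in simp)
    qed
    then show "N X \<le> Sup \<Omega> + e" by (simp add: S_def)
  qed
  moreover have "Sup \<Omega> \<le> N X" using upper \<open>0 \<in> \<Omega>\<close> by (intro cSup_least) auto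
  ultimately show "N X = Sup {norm (\<Sum>i<n. \<Sum>j<n. r i * X i j * k j) | r k.
            (\<forall>i<n. r i \<in> D) \<and> (\<forall>j<n. k j \<in> D) \<and>
            norm (\<Sum>i<n. r i * st (r i)) \<le> 1 \<and> norm (\<Sum>j<n. st (k j) * k j) \<le> 1}"
    unfolding \<Omega>_def by (rule order_antisym)
qed

end

theorem theorem7p5:
  fixes sc :: "complex \<Rightarrow> 'a::{banach,real_normed_algebra_1} \<Rightarrow> 'a"
    and st :: "'a \<Rightarrow> 'a"
    and D :: "'a set"
  assumes "cstar_algebra sc st"
    and "pseudo_cartan sc st D"
  shows "norms sc st D"
proof -
  interpret cstar sc st by unfold_locales (rule assms)
  interpret abelian_inclusion sc st D
    using assms(2) by unfold_locales (simp_all add: pseudo_cartan_def)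
  interpret masa_inclusion sc st D
  proof unfold_locales
    show "abelian (rel_commutant D)" "closure (cspan sc (normalizers st D)) = UNIV"
      using assms(2) by (simp_all add: pseudo_cartan_def regular_inclusion_def)
    \<comment> \<open>The two intersection properties compose because the trace of \<open>J\<close>
      on the commutant is a closed ideal there.\<close>
    fix J assume J: "closed_ideal sc UNIV J" "J \<noteq> {0}"
    then have "J \<inter> rel_commutant D \<noteq> {0}"
      using assms(2) by (auto simp: pseudo_cartan_def ideal_intersection_property_def)
    moreover have "closed_ideal sc (rel_commutant D) (J \<inter> rel_commutant D)"
      using J(1) csub_B unfolding closed_ideal_def csubspace_def
      by (auto intro: csub_intros simp: csub_closed closed_Int)
    ultimately have "(J \<inter> rel_commutant D) \<inter> D \<noteq> {0}"
      using assms(2) by (auto simp: pseudo_cartan_def ideal_intersection_property_def)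
    then show "J \<inter> D \<noteq> {0}" using D_subset_B by blast
  qed
  show ?thesis by (rule norms_D)
qed

end
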